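(* Let $k$ be a field, $\Gamma$ an abelian group, and $R$ a PDCF $\Gamma$-graded $k$-algebra which is an integral domain, with image monoid $Q$. The binary operation $([F],[F'])\mapsto[F\otimes_RF']$ (on classes of projective, equivalently free, BDF $\Gamma$-graded $R$-modules, extended biadditively) gives a well-defined commutative ring structure on $K^{\mathrm{BDF}}_{\Gamma,0}(R)$ with multiplicative identity $[R]$, and the group isomorphism $K^{\mathrm{BDF}}_{\Gamma,0}(R)\to\mathbb{Z}[[Q]]\{\Gamma\}$, $[F]\mapsto\mathcal{K}_\Gamma(F)$, is a ring map.
   Context: Abelian groups and monoids are written additively. A $\Gamma$-graded $k$-algebra is a commutative $k$-algebra $R$ with $k$-subspaces $R_g$ ($g\in\Gamma$) such that $R=\bigoplus_{g\in\Gamma}R_g$ and $R_gR_h\subseteq R_{g+h}$. A $\Gamma$-graded $R$-module is an $R$-module $M$ with $k$-subspaces $M_g$ such that $M=\bigoplus_{g\in\Gamma}M_g$ and $R_gM_h\subseteq M_{g+h}$. An $R$-linear map $\varphi:M\to N$ is graded if $\varphi(M_g)\subseteq N_g$ for all $g$. Write $\mathrm{Supp}_\Gamma(M)=\{g\in\Gamma\mid M_g\neq 0\}$. Since $R$ is a domain, $Q:=\mathrm{Supp}_\Gamma(R)$ is a submonoid of $\Gamma$ (the image monoid). $Q$ is pointed if $p+q=0$ with $p,q\in Q$ implies $p=q=0$; then $g\le_Q h :\iff h-g\in Q$ is a partial order on $\Gamma$. A subset $U\subseteq\Gamma$ is downward finite if for every $g\in\Gamma$ the set $\{u\in U\mid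 u\le_Q g\}$ is finite; it is finitely bounded below if there are finitely many $p_1,\dots,p_n\in\Gamma$ such that every $u\in U$ satisfies $p_i\le_Q u$ for some $i$. $R$ is PDCF if $Q$ is pointed and downward finite, $R$ is connected ($R_0=k$), and $\dim_k R_g<\infty$ for all $g\in\Gamma$. A $\Gamma$-graded $R$-module $M$ is BDF if $\mathrm{Supp}_\Gamma(M)$ is finitely bounded below and downward finite and $\dim_k M_g<\infty$ for all $g\in\Gamma$. For BDF modules $M,N$, the module $M\otimes_RN$ is graded with $(M\otimes_RN)_u$ the $k$-span of the $x\otimes y$ with $x\in M_g$, $y\in N_h$, $g+h=u$. $\mathbb{Z}[[Q]]\{\Gamma\}$ is the set of functions $a:\Gamma\to\mathbb{Z}$, written $a=\sum_{g\in\Gamma}a_g\mathbf{t}^g$, whose support $\{g\mid a_g\ne0\}$ is downward finite and finitely bounded below; it is a commutative ring under pointwise addition and the product with coefficients $(ab)_u=\sum_{g+h=u}a_gb_h$ (a sum with finitely many nonzero terms), with $1=\mathbf{t}^0$. The Hilbert series of a BDF module $M$ is $\mathcal{H}_\Gamma(M)=\sum_{g\in\Gamma}\dim_k(M_g)\mathbf{t}^g\in\mathbb{Z}[[Q]]\{\Gamma\}$. $\mathcal{H}_\Gamma(R)$ is a unit in $\mathbb{Z}[[Q]]\{\Gamma\}$, and the $K$-series of $M$ is $\mathcal{K}_\Gamma(M)=\mathcal{H}_\Gamma(M)\cdot\mathcal{H}_\Gamma(R)^{-1}$. $K^{\mathrm{BDF}}_{\Gamma,0}(R)$ is the Grothendieck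 group (group completion) of the commutative monoid of graded isomorphism classes of BDF $\Gamma$-graded $R$-modules that are projective as $R$-modules (all such modules are in fact free), with operation $[M]+[N]=[M\oplus N]$. The assignment $[F]\mapsto\mathcal{K}_\Gamma(F)$ induces a group isomorphism $K^{\mathrm{BDF}}_{\Gamma,0}(R)\to\mathbb{Z}[[Q]]\{\Gamma\}$. *)

theory Defs
  imports
    "Jordan_Normal_Form.Missing_VectorSpace"
    "HOL-Algebra.Free_Abelian_Groups"
begin

text \<open>
  The field \<open>k\<close>, the \<open>k\<close>-algebra \<open>R\<close> and the \<open>R\<close>-modules are records in the style of
  \<^theory>\<open>HOL-Algebra.Module\<close>; the grading group is a type of class
  \<^class>\<open>ab_group_add\<close>. In a record that stands for a module, the
  multiplicative fields \<open>mult\<close> and \<open>one\<close> carry no information.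
\<close>

section \<open>Graded algebras and graded modules\<close>

record ('a, 'b, 'g) graded_module = "('a, 'b) module" +
  gcomp :: "'g \<Rightarrow> 'b set"

definition with_grading :: "('a, 'b) module \<Rightarrow> ('g \<Rightarrow> 'b set) \<Rightarrow> ('a, 'b, 'g) graded_module"
  where "with_grading V C = module.extend V (graded_module.fields C)"

lemma with_grading_simps [simp]:
  "carrier (with_grading V C) = carrier V"
  "add (with_grading V C) = add V"
  "\<zero>\<^bsub>with_grading V C\<^esub> = \<zero>\<^bsub>V\<^esub>"
  "smult (with_grading V C) = smult V"
  "gcomp (with_grading V C) = C"
  by (simp_all add: with_grading_def module.defs graded_module.defs)

definition is_grading ::
    "('k, 'x) ring_scheme \<Rightarrow> ('k, 'm, 'y) module_scheme \<Rightarrow> ('g \<Rightarrow> 'm set) \<Rightarrow> bool"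
  where "is_grading k V C \<longleftrightarrow>
    (\<forall>g. subspace k (C g) V) \<and>
    (\<forall>x\<in>carrier V. \<exists>!f. (\<forall>g. f g \<in> C g) \<and> finite {g. f g \<noteq> \<zero>\<^bsub>V\<^esub>} \<and>
       x = finsum V f {g. f g \<noteq> \<zero>\<^bsub>V\<^esub>})"

definition is_graded_algebra ::
    "'k ring \<Rightarrow> ('k, 'r, 'g::ab_group_add) graded_module \<Rightarrow> bool"
  where "is_graded_algebra k R \<longleftrightarrow>
    algebra k R \<and> is_grading k R (gcomp R) \<and>
    (\<forall>g h. \<forall>x\<in>gcomp R g. \<forall>y\<in>gcomp R h. x \<otimes>\<^bsub>R\<^esub> y \<in> gcomp R (g + h))"

definition restrict_scalars ::
    "('k, 'r, 'x) module_scheme \<Rightarrow> ('r, 'm, 'y) module_scheme \<Rightarrow> ('k, 'm) module"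
  where "restrict_scalars R M =
    \<lparr>carrier = carrier M, mult = mult M, one = one M, ring.zero = \<zero>\<^bsub>M\<^esub>, add = add M,
     smult = (\<lambda>c x. (c \<odot>\<^bsub>R\<^esub> \<one>\<^bsub>R\<^esub>) \<odot>\<^bsub>M\<^esub> x)\<rparr>"

definition is_graded_module ::
    "'k ring \<Rightarrow> ('k, 'r, 'g::ab_group_add) graded_module \<Rightarrow> ('r, 'm, 'g) graded_module \<Rightarrow> bool"
  where "is_graded_module k R M \<longleftrightarrow>
    module R M \<and> is_grading k (restrict_scalars R M) (gcomp M) \<and>
    (\<forall>g h. \<forall>r\<in>gcomp R g. \<forall>x\<in>gcomp M h. r \<odot>\<^bsub>M\<^esub> x \<in> gcomp M (g + h))"

definition regular_module :: "('k, 'r, 'g) graded_module \<Rightarrow> ('r, 'r, 'g) graded_module"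
  where "regular_module R =
    \<lparr>carrier = carrier R, mult = mult R, one = one R, ring.zero = \<zero>\<^bsub>R\<^esub>, add = add R,
     smult = mult R, gcomp = gcomp R\<rparr>"

definition zero_graded_module :: "('r, unit, 'g) graded_module"
  where "zero_graded_module =
    \<lparr>carrier = {()}, mult = (\<lambda>_ _. ()), one = (), ring.zero = (), add = (\<lambda>_ _. ()),
     smult = (\<lambda>_ _. ()), gcomp = (\<lambda>_. {()})\<rparr>"

definition graded_direct_sum ::
    "('r, 'm, 'g) graded_module \<Rightarrow> ('r, 'n, 'g) graded_module \<Rightarrow> ('r, 'm \<times> 'n, 'g) graded_module"
  where "graded_direct_sum M N =
    with_grading (direct_sum M N) (\<lambda>g. gcomp M g \<times> gcomp N g)"

definition graded_hom ::
    "('k, 'r, 'g) graded_module \<Rightarrow> ('r, 'm, 'g) graded_module \<Rightarrow> ('r, 'n, 'g) graded_module \<Rightarrow>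
     ('m \<Rightarrow> 'n) set"
  where "graded_hom R M N = {f \<in> module_hom R M N. \<forall>g. f ` gcomp M g \<subseteq> gcomp N g}"

definition graded_isomorphic ::
    "('k, 'r, 'g) graded_module \<Rightarrow> ('r, 'm, 'g) graded_module \<Rightarrow> ('r, 'n, 'g) graded_module \<Rightarrow> bool"
  where "graded_isomorphic R M N \<longleftrightarrow>
    (\<exists>f\<in>graded_hom R M N. \<exists>f'\<in>graded_hom R N M.
       (\<forall>x\<in>carrier M. f' (f x) = x) \<and> (\<forall>y\<in>carrier N. f (f' y) = y))"

definition gsupp :: "('r, 'm, 'g) graded_module \<Rightarrow> 'g set"
  where "gsupp M = {g. gcomp M g \<noteq> {\<zero>\<^bsub>M\<^esub>}}"


section \<open>Finiteness conditions\<close>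

definition monoid_le :: "'g::ab_group_add set \<Rightarrow> 'g \<Rightarrow> 'g \<Rightarrow> bool"
  where "monoid_le Q g h \<longleftrightarrow> h - g \<in> Q"

definition pointed :: "'g::ab_group_add set \<Rightarrow> bool"
  where "pointed Q \<longleftrightarrow> (\<forall>p\<in>Q. \<forall>q\<in>Q. p + q = 0 \<longrightarrow> p = 0 \<and> q = 0)"

definition downward_finite :: "'g::ab_group_add set \<Rightarrow> 'g set \<Rightarrow> bool"
  where "downward_finite Q U \<longleftrightarrow> (\<forall>g. finite {u\<in>U. monoid_le Q u g})"

definition finitely_bounded_below :: "'g::ab_group_add set \<Rightarrow> 'g set \<Rightarrow> bool"
  where "finitely_bounded_below Q U \<longleftrightarrow> (\<exists>P. finite P \<and> (\<forall>u\<in>U. \<exists>p\<in>P. monoid_le Q p u))"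

definition pdcf :: "'k ring \<Rightarrow> ('k, 'r, 'g::ab_group_add) graded_module \<Rightarrow> bool"
  where "pdcf k R \<longleftrightarrow>
    pointed (gsupp R) \<and> downward_finite (gsupp R) (gsupp R) \<and>
    gcomp R 0 = (\<lambda>c. c \<odot>\<^bsub>R\<^esub> \<one>\<^bsub>R\<^esub>) ` carrier k \<and>
    (\<forall>g. vectorspace.fin_dim k (R\<lparr>carrier := gcomp R g\<rparr>))"

definition component_space ::
    "('k, 'r, 'g) graded_module \<Rightarrow> ('r, 'm, 'g) graded_module \<Rightarrow> 'g \<Rightarrow> ('k, 'm) module"
  where "component_space R M g = (restrict_scalars R M)\<lparr>carrier := gcomp M g\<rparr>"

definition bdf ::
    "'k ring \<Rightarrow> ('k, 'r, 'g::ab_group_add) graded_module \<Rightarrow> ('r, 'm, 'g) graded_module \<Rightarrow> bool"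
  where "bdf k R M \<longleftrightarrow>
    finitely_bounded_below (gsupp R) (gsupp M) \<and> downward_finite (gsupp R) (gsupp M) \<and>
    (\<forall>g. vectorspace.fin_dim k (component_space R M g))"

text \<open>
  Projectivity is the lifting property. Quantification over modules of all types is not possible
  inside a definition, but the two types below suffice: if \<open>R\<close> is not the zero ring, then
  \<^typ>\<open>'m \<Rightarrow> 'r\<close> contains the free module on \<open>carrier M\<close>, and lifting the identity of
  \<open>M\<close> along the canonical surjection from that free module exhibits \<open>M\<close> as a direct summand of a
  free module. The lemma \<open>projective_module_lift\<close> below derives the unrestricted lifting property.
\<close>

definition projective_module :: "('r, 'x) ring_scheme \<Rightarrow> ('r, 'm, 'y) module_scheme \<Rightarrow> bool"
  where "projective_module R M \<longleftrightarrow> module R M \<and>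
    (\<forall>(A :: ('r, 'm \<Rightarrow> 'r) module) (B :: ('r, 'm) module). module R A \<longrightarrow> module R B \<longrightarrow>
      (\<forall>p\<in>module_hom R A B. \<forall>f\<in>module_hom R M B. p ` carrier A = carrier B \<longrightarrow>
        (\<exists>h\<in>module_hom R M A. \<forall>x\<in>carrier M. p (h x) = f x)))"

definition free_module :: "('r, 'x) ring_scheme \<Rightarrow> 'm set \<Rightarrow> ('r, 'm \<Rightarrow> 'r) module" where
  "free_module R S = \<lparr>carrier = {f. (\<forall>m. f m \<in> carrier R) \<and> (\<forall>m. m \<notin> S \<longrightarrow> f m = \<zero>\<^bsub>R\<^esub>) \<and> finite {m. f m \<noteq> \<zero>\<^bsub>R\<^esub>}},
    mult = (\<lambda>_ _ _. \<zero>\<^bsub>R\<^esub>), one = (\<lambda>_. \<zero>\<^bsub>R\<^esub>), ring.zero = (\<lambda>_. \<zero>\<^bsub>R\<^esub>),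
    add = (\<lambda>f g m. f m \<oplus>\<^bsub>R\<^esub> g m), smult = (\<lambda>r f m. r \<otimes>\<^bsub>R\<^esub> f m)\<rparr>"

lemma free_module_is_module:
  assumes "cring R" shows "module R (free_module R S)"
proof -
  interpret cring R by fact
  have fin2: "finite {m. f m \<oplus>\<^bsub>R\<^esub> g m \<noteq> \<zero>\<^bsub>R\<^esub>}" if "finite {m. f m \<noteq> \<zero>\<^bsub>R\<^esub>}" "finite {m. g m \<noteq> \<zero>\<^bsub>R\<^esub>}" for f g
    by (rule finite_subset[OF _ finite_UnI[OF that]]) auto
  show ?thesis
  proof (rule moduleI)
    show "cring R" by fact
    show "abelian_group (free_module R S)"
    proof (rule abelian_groupI)
      fix x assume x: "x \<in> carrier (free_module R S)"
      show "\<exists>y\<in>carrier (free_module R S). y \<oplus>\<^bsub>free_module R S\<^esub> x = \<zero>\<^bsub>free_module R S\<^esub>"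
      proof (rule bexI[of _ "\<lambda>m. \<ominus>\<^bsub>R\<^esub> x m"])
        show "(\<lambda>m. \<ominus>\<^bsub>R\<^esub> x m) \<in> carrier (free_module R S)"
          using x finite_subset[of "{m. \<ominus>\<^bsub>R\<^esub> x m \<noteq> \<zero>\<^bsub>R\<^esub>}" "{m. x m \<noteq> \<zero>\<^bsub>R\<^esub>}"]
          by (force simp: free_module_def)
      qed (use x in \<open>auto simp: free_module_def l_neg\<close>)
    qed (auto simp: free_module_def fin2 a_ac)
    show "a \<odot>\<^bsub>free_module R S\<^esub> x \<in> carrier (free_module R S)" if "a \<in> carrier R" "x \<in> carrier (free_module R S)" for a x
      using that finite_subset[of "{m. a \<otimes>\<^bsub>R\<^esub> x m \<noteq> \<zero>\<^bsub>R\<^esub>}" "{m. x m \<noteq> \<zero>\<^bsub>R\<^esub>}"]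
      by (force simp: free_module_def)
  qed (auto simp: free_module_def l_distr r_distr m_assoc)
qed

definition free_module_eval ::
    "('r, 'x) ring_scheme \<Rightarrow> ('r, 'a, 'y) module_scheme \<Rightarrow> ('m \<Rightarrow> 'a) \<Rightarrow> ('m \<Rightarrow> 'r) \<Rightarrow> 'a"
  where "free_module_eval R A a f = finsum A (\<lambda>m. f m \<odot>\<^bsub>A\<^esub> a m) {m. f m \<noteq> \<zero>\<^bsub>R\<^esub>}"

lemma free_module_eval_eq:
  assumes "module R A" "a \<in> S \<rightarrow> carrier A" "f \<in> carrier (free_module R S)" "finite T" "{m. f m \<noteq> \<zero>\<^bsub>R\<^esub>} \<subseteq> T" "T \<subseteq> S"
  shows "free_module_eval R A a f = finsum A (\<lambda>m. f m \<odot>\<^bsub>A\<^esub> a m) T"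
proof -
  interpret module R A by fact
  show ?thesis unfolding free_module_eval_def
    by (rule M.add.finprod_mono_neutral_cong_left)
      (use assms in \<open>auto simp: free_module_def Pi_iff subset_eq intro!: smult_closed\<close>)
qed

lemma free_module_eval_hom:
  assumes "module R A" "a \<in> S \<rightarrow> carrier A"
  shows "free_module_eval R A a \<in> module_hom R (free_module R S) A"
proof -
  interpret module R A by fact
  interpret F: module R "free_module R S" by (rule free_module_is_module) (rule R.is_cring)
  have fs: "finite {m. f m \<noteq> \<zero>\<^bsub>R\<^esub>}" "{m. f m \<noteq> \<zero>\<^bsub>R\<^esub>} \<subseteq> S" "f m \<in> carrier R" if "f \<in> carrier (free_module R S)" for f m
    using that by (auto simp: free_module_def)
  have cl: "f m \<odot>\<^bsub>A\<^esub> a m \<in> carrier A" if "f \<in> carrier (free_module R S)" "m \<in> S" for f m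
    using that fs(3)[OF that(1)] assms by auto
  { fix f assume f: "f \<in> carrier (free_module R S)"
    have "free_module_eval R A a f \<in> carrier A" unfolding free_module_eval_def
      using fs[OF f] by (intro M.finsum_closed) (auto intro!: cl f) }
  moreover
  { fix f g assume f: "f \<in> carrier (free_module R S)" and g: "g \<in> carrier (free_module R S)"
    define h where "h = f \<oplus>\<^bsub>free_module R S\<^esub> g"
    let ?T = "{m. f m \<noteq> \<zero>\<^bsub>R\<^esub>} \<union> {m. g m \<noteq> \<zero>\<^bsub>R\<^esub>}"
    have h: "h \<in> carrier (free_module R S)" using f g by (simp add: h_def)
    have T: "finite ?T" "?T \<subseteq> S" using fs f g by auto
    have hm: "h m = f m \<oplus>\<^bsub>R\<^esub> g m" for m by (simp add: h_def free_module_def)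
    have "free_module_eval R A a h = finsum A (\<lambda>m. h m \<odot>\<^bsub>A\<^esub> a m) ?T"
      by (rule free_module_eval_eq[OF assms h T(1) _ T(2)]) (auto simp: hm)
    also have "\<dots> = finsum A (\<lambda>m. f m \<odot>\<^bsub>A\<^esub> a m \<oplus>\<^bsub>A\<^esub> g m \<odot>\<^bsub>A\<^esub> a m) ?T"
      using T assms(2) fs(3)[OF f] fs(3)[OF g] by (intro M.finsum_cong') (auto simp: hm smult_l_distr Pi_iff subset_eq)
    also have "\<dots> = finsum A (\<lambda>m. f m \<odot>\<^bsub>A\<^esub> a m) ?T \<oplus>\<^bsub>A\<^esub> finsum A (\<lambda>m. g m \<odot>\<^bsub>A\<^esub> a m) ?T"
      using T cl f g by (intro M.finsum_addf) auto
    also have "\<dots> = free_module_eval R A a f \<oplus>\<^bsub>A\<^esub> free_module_eval R A a g"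
      using free_module_eval_eq[OF assms f T(1) _ T(2)] free_module_eval_eq[OF assms g T(1) _ T(2)] by auto
    finally have "free_module_eval R A a h = \<dots>" . note this[unfolded h_def] }
  moreover
  { fix r f assume r: "r \<in> carrier R" and f: "f \<in> carrier (free_module R S)"
    define h where "h = r \<odot>\<^bsub>free_module R S\<^esub> f"
    let ?T = "{m. f m \<noteq> \<zero>\<^bsub>R\<^esub>}"
    have h: "h \<in> carrier (free_module R S)" using f r by (simp add: h_def)
    have T: "finite ?T" "?T \<subseteq> S" using fs f by auto
    have hm: "h m = r \<otimes>\<^bsub>R\<^esub> f m" for m by (simp add: h_def free_module_def)
    have "free_module_eval R A a h = finsum A (\<lambda>m. h m \<odot>\<^bsub>A\<^esub> a m) ?T"
      by (rule free_module_eval_eq[OF assms h T(1) _ T(2)]) (auto simp: hm r)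
    also have "\<dots> = finsum A (\<lambda>m. r \<odot>\<^bsub>A\<^esub> (f m \<odot>\<^bsub>A\<^esub> a m)) ?T"
      using T assms(2) fs(3)[OF f] r by (intro M.finsum_cong') (auto simp: hm smult_assoc1 Pi_iff subset_eq)
    also have "\<dots> = r \<odot>\<^bsub>A\<^esub> free_module_eval R A a f" unfolding free_module_eval_def
      using T cl f r by (intro finsum_smult_ldistr[symmetric]) auto
    finally have "free_module_eval R A a h = \<dots>" . note this[unfolded h_def] }
  ultimately show ?thesis unfolding module_hom_def by auto
qed

lemma free_module_eval_comp:
  assumes "module R A" "module R B" "a \<in> S \<rightarrow> carrier A" "p \<in> module_hom R A B" "f \<in> carrier (free_module R S)"
  shows "p (free_module_eval R A a f) = free_module_eval R B (p \<circ> a) f"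
proof -
  interpret mod_hom R A B p using assms by (auto simp: mod_hom_def mod_hom_axioms_def)
  have c: "f m \<in> carrier R" "f m \<noteq> \<zero>\<^bsub>R\<^esub> \<Longrightarrow> m \<in> S" for m using assms(5) by (auto simp: free_module_def)
  have "p (finsum A (\<lambda>m. f m \<odot>\<^bsub>A\<^esub> a m) T) = finsum B (\<lambda>m. f m \<odot>\<^bsub>B\<^esub> (p \<circ> a) m) T"
    if "finite T" "T \<subseteq> S" for T using that
  proof (induction T)
    case (insert x T)
    have A: "(\<lambda>m. f m \<odot>\<^bsub>A\<^esub> a m) \<in> T \<rightarrow> carrier A" "f x \<odot>\<^bsub>A\<^esub> a x \<in> carrier A" "a x \<in> carrier A"
      using insert.prems assms(3) c by (auto simp: subset_eq Pi_iff)
    have B: "(\<lambda>m. f m \<odot>\<^bsub>B\<^esub> (p \<circ> a) m) \<in> T \<rightarrow> carrier B" "f x \<odot>\<^bsub>B\<^esub> (p \<circ> a) x \<in> carrier B"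
      using insert.prems assms(3) c module_hom_closed[OF assms(4)] by (auto simp: subset_eq Pi_iff)
    show ?case using insert A B c
      by (simp add: M.M.finsum_insert N.M.finsum_insert f_smult f_add M.M.finsum_closed)
  qed simp
  from this[of "{m. f m \<noteq> \<zero>\<^bsub>R\<^esub>}"] assms(5) show ?thesis
    by (auto simp: free_module_eval_def free_module_def)
qed

lemma projective_module_lift:
  fixes R :: "('r, 'x) ring_scheme" and M :: "('r, 'm, 'y) module_scheme"
  fixes A :: "('r, 'a, 'y1) module_scheme" and B :: "('r, 'b, 'y2) module_scheme"
  assumes P: "projective_module R M" and ne: "\<one>\<^bsub>R\<^esub> \<noteq> \<zero>\<^bsub>R\<^esub>"
    and A: "module R A" and B: "module R B" and p: "p \<in> module_hom R A B" and f: "f \<in> module_hom R M B"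
    and s: "p ` carrier A = carrier B"
  shows "\<exists>h\<in>module_hom R M A. \<forall>x\<in>carrier M. p (h x) = f x"
proof -
  have M: "module R M" using P by (simp add: projective_module_def)
  interpret M: module R M by fact
  define M' :: "('r, 'm) module" where "M' = \<lparr>carrier = carrier M, mult = mult M, one = one M, ring.zero = \<zero>\<^bsub>M\<^esub>, add = add M, smult = smult M\<rparr>"
  have M': "module R M'"
    apply (rule moduleI)
           apply (rule M.R.is_cring)
          apply (rule abelian_groupI)
    by (auto simp: M'_def M.M.a_ac M.smult_l_distr M.smult_r_distr M.smult_assoc1 intro: M.M.l_neg M.M.a_inv_closed)
  interpret M': module R M' by fact
  let ?F = "free_module R (carrier M)"
  let ?q = "free_module_eval R M' id"
  have cM: "carrier M' = carrier M" by (simp add: M'_def)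
  have q: "?q \<in> module_hom R ?F M'" by (rule free_module_eval_hom[OF M']) (simp add: cM)
  have idh: "id \<in> module_hom R M M'" by (auto simp: module_hom_def M'_def)
  have idh': "id \<in> module_hom R M' M" by (auto simp: module_hom_def M'_def)
  have "\<exists>h\<in>module_hom R M ?F. \<forall>x\<in>carrier M. ?q (h x) = id x"
  proof -
    have "?q ` carrier ?F = carrier M'"
    proof
      show "?q ` carrier ?F \<subseteq> carrier M'" using module_hom_closed[OF q] by auto
      show "carrier M' \<subseteq> ?q ` carrier ?F"
      proof
        fix x assume x: "x \<in> carrier M'"
        let ?d = "\<lambda>m. if m = x then \<one>\<^bsub>R\<^esub> else \<zero>\<^bsub>R\<^esub>"
        have "?d \<in> carrier ?F" using x by (auto simp: free_module_def cM)
        moreover have "{m. ?d m \<noteq> \<zero>\<^bsub>R\<^esub>} = {x}" using ne by auto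
        then have "?q ?d = x" using x by (simp add: free_module_eval_def M'.smult_one)
        ultimately show "x \<in> ?q ` carrier ?F" by (metis imageI)
      qed
    qed
    then show ?thesis
      using P M' free_module_is_module[OF M.R.is_cring, of "carrier M"] q idh
      unfolding projective_module_def by blast
  qed
  then obtain h where h: "h \<in> module_hom R M ?F" and qh: "\<And>x. x \<in> carrier M \<Longrightarrow> ?q (h x) = x" by auto
  have fM: "f m \<in> carrier B" if "m \<in> carrier M" for m
    using funcset_mem[OF module_hom_closed[OF f] that] .
  have "\<exists>a\<in>carrier A. p a = f m" if "m \<in> carrier M" for m
    using fM[OF that] unfolding s[symmetric] by (metis imageE)
  then obtain a where a: "\<And>m. m \<in> carrier M \<Longrightarrow> a m \<in> carrier A \<and> p (a m) = f m" by metis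
  have aS: "a \<in> carrier M \<rightarrow> carrier A" using a by auto
  have e: "free_module_eval R A a \<in> module_hom R ?F A" by (rule free_module_eval_hom[OF A aS])
  have f': "f \<in> module_hom R M' B" using f by (simp add: module_hom_def M'_def)
  have hx: "h x \<in> carrier ?F" if "x \<in> carrier M" for x
    using funcset_mem[OF module_hom_closed[OF h] that] .
  have eh: "free_module_eval R A a (h x) \<in> carrier A" if "x \<in> carrier M" for x
    using funcset_mem[OF module_hom_closed[OF e] hx[OF that]] .
  show ?thesis
  proof (rule bexI[of _ "\<lambda>x. free_module_eval R A a (h x)"], rule ballI)
    show "(\<lambda>x. free_module_eval R A a (h x)) \<in> module_hom R M A"
      unfolding module_hom_def
    proof (intro CollectI conjI allI impI)
      show "(\<lambda>x. free_module_eval R A a (h x)) \<in> carrier M \<rightarrow> carrier A" using eh by (rule Pi_I)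
    qed (simp_all add: module_hom_add[OF h] module_hom_smult[OF h]
        module_hom_add[OF e] module_hom_smult[OF e] hx)
    fix x assume x: "x \<in> carrier M"
    have "p (free_module_eval R A a (h x)) = free_module_eval R B (p \<circ> a) (h x)"
      by (rule free_module_eval_comp[OF A B aS p hx[OF x]])
    also have "\<dots> = free_module_eval R B (f \<circ> id) (h x)"
    proof -
      have mem: "h x m \<noteq> \<zero>\<^bsub>R\<^esub> \<Longrightarrow> m \<in> carrier M" "h x m \<in> carrier R" for m
        using hx[OF x] by (auto simp: free_module_def)
      interpret B: module R B by fact
      show ?thesis unfolding free_module_eval_def
        by (rule B.M.finsum_cong') (simp_all add: mem a fM)
    qed
    also have "\<dots> = f (?q (h x))" using free_module_eval_comp[OF M' B _ f' hx[OF x], of id] by (simp add: cM)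
    also have "\<dots> = f x" using qh x by simp
    finally show "p (free_module_eval R A a (h x)) = f x" .
  qed
qed

definition bdf_projective ::
    "'k ring \<Rightarrow> ('k, 'r, 'g::ab_group_add) graded_module \<Rightarrow> ('r, 'm, 'g) graded_module \<Rightarrow> bool"
  where "bdf_projective k R M \<longleftrightarrow> is_graded_module k R M \<and> bdf k R M \<and> projective_module R M"


section \<open>Tensor products\<close>

definition tensor_relations ::
    "('r, 'x) ring_scheme \<Rightarrow> ('r, 'm, 'y) module_scheme \<Rightarrow> ('r, 'n, 'z) module_scheme \<Rightarrow>
     ('m \<times> 'n \<Rightarrow>\<^sub>0 int) set"
  where "tensor_relations R M N =
    {frag_of (x \<oplus>\<^bsub>M\<^esub> x', y) - frag_of (x, y) - frag_of (x', y) | x x' y.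
       x \<in> carrier M \<and> x' \<in> carrier M \<and> y \<in> carrier N} \<union>
    {frag_of (x, y \<oplus>\<^bsub>N\<^esub> y') - frag_of (x, y) - frag_of (x, y') | x y y'.
       x \<in> carrier M \<and> y \<in> carrier N \<and> y' \<in> carrier N} \<union>
    {frag_of (r \<odot>\<^bsub>M\<^esub> x, y) - frag_of (x, r \<odot>\<^bsub>N\<^esub> y) | r x y.
       r \<in> carrier R \<and> x \<in> carrier M \<and> y \<in> carrier N}"

definition tensor_kernel ::
    "('r, 'x) ring_scheme \<Rightarrow> ('r, 'm, 'y) module_scheme \<Rightarrow> ('r, 'n, 'z) module_scheme \<Rightarrow>
     ('m \<times> 'n \<Rightarrow>\<^sub>0 int) set"
  where "tensor_kernel R M N =
    generate (free_Abelian_group (carrier M \<times> carrier N)) (tensor_relations R M N)"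

definition tensor_coset ::
    "('r, 'x) ring_scheme \<Rightarrow> ('r, 'm, 'y) module_scheme \<Rightarrow> ('r, 'n, 'z) module_scheme \<Rightarrow>
     ('m \<times> 'n \<Rightarrow>\<^sub>0 int) \<Rightarrow> ('m \<times> 'n \<Rightarrow>\<^sub>0 int) set"
  where "tensor_coset R M N c =
    tensor_kernel R M N #>\<^bsub>free_Abelian_group (carrier M \<times> carrier N)\<^esub> c"

text \<open>The scalar \<open>r\<close> acts by \<open>r (x \<otimes> y) = (r x) \<otimes> y\<close>, extended additively.\<close>

definition tensor_module ::
    "('r, 'x) ring_scheme \<Rightarrow> ('r, 'm, 'y) module_scheme \<Rightarrow> ('r, 'n, 'z) module_scheme \<Rightarrow>
     ('r, ('m \<times> 'n \<Rightarrow>\<^sub>0 int) set) module"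
  where "tensor_module R M N =
    (let G = free_Abelian_group (carrier M \<times> carrier N) Mod tensor_kernel R M N
     in \<lparr>carrier = carrier G, mult = (\<lambda>_ _. one G), one = one G, ring.zero = one G, add = mult G,
         smult = (\<lambda>r X. \<Union>c\<in>X.
           tensor_coset R M N (frag_extend (\<lambda>(x, y). frag_of (r \<odot>\<^bsub>M\<^esub> x, y)) c))\<rparr>)"

definition graded_tensor ::
    "'k ring \<Rightarrow> ('k, 'r, 'g::ab_group_add) graded_module \<Rightarrow>
     ('r, 'm, 'g) graded_module \<Rightarrow> ('r, 'n, 'g) graded_module \<Rightarrow>
     ('r, ('m \<times> 'n \<Rightarrow>\<^sub>0 int) set, 'g) graded_module"
  where "graded_tensor k R M N =
    with_grading (tensor_module R M N)
      (\<lambda>u. module.span k (restrict_scalars R (tensor_module R M N))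
        {tensor_coset R M N (frag_of (x, y)) | x y g h.
           g + h = u \<and> x \<in> gcomp M g \<and> y \<in> gcomp N h})"


section \<open>Hilbert series and K-series\<close>

definition series_ring :: "'g::ab_group_add set \<Rightarrow> ('g \<Rightarrow> int) ring"
  where "series_ring Q =
    \<lparr>carrier = {a. downward_finite Q {g. a g \<noteq> 0} \<and> finitely_bounded_below Q {g. a g \<noteq> 0}},
     mult = (\<lambda>a b u. \<Sum>(g, h) | g + h = u \<and> a g \<noteq> 0 \<and> b h \<noteq> 0. a g * b h),
     one = (\<lambda>g. if g = 0 then 1 else 0),
     ring.zero = (\<lambda>_. 0),
     add = (\<lambda>a b g. a g + b g)\<rparr>"

definition hilbert_series ::
    "'k ring \<Rightarrow> ('k, 'r, 'g) graded_module \<Rightarrow> ('r, 'm, 'g) graded_module \<Rightarrow> 'g \<Rightarrow> int"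
  where "hilbert_series k R M = (\<lambda>g. int (vectorspace.dim k (component_space R M g)))"

definition K_series ::
    "'k ring \<Rightarrow> ('k, 'r, 'g::ab_group_add) graded_module \<Rightarrow> ('r, 'm, 'g) graded_module \<Rightarrow> 'g \<Rightarrow> int"
  where "K_series k R M =
    hilbert_series k R M \<otimes>\<^bsub>series_ring (gsupp R)\<^esub>
      inv\<^bsub>series_ring (gsupp R)\<^esub> (hilbert_series k R (regular_module R))"


section \<open>Grothendieck groups\<close>

definition grothendieck_rel :: "'a monoid \<Rightarrow> (('a \<times> 'a) \<times> ('a \<times> 'a)) set"
  where "grothendieck_rel S =
    {((a, b), (c, d)) | a b c d. {a, b, c, d} \<subseteq> carrier S \<and>
       (\<exists>e\<in>carrier S. a \<otimes>\<^bsub>S\<^esub> d \<otimes>\<^bsub>S\<^esub> e = c \<otimes>\<^bsub>S\<^esub> b \<otimes>\<^bsub>S\<^esub> e)}"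

definition grothendieck_group :: "'a monoid \<Rightarrow> ('a \<times> 'a) set monoid"
  where "grothendieck_group S =
    \<lparr>carrier = (carrier S \<times> carrier S) // grothendieck_rel S,
     mult = (\<lambda>X Y. \<Union>(a, b)\<in>X. \<Union>(c, d)\<in>Y. grothendieck_rel S `` {(a \<otimes>\<^bsub>S\<^esub> c, b \<otimes>\<^bsub>S\<^esub> d)}),
     one = grothendieck_rel S `` {(\<one>\<^bsub>S\<^esub>, \<one>\<^bsub>S\<^esub>)}\<rparr>"

definition grothendieck_class :: "'a monoid \<Rightarrow> 'a \<Rightarrow> ('a \<times> 'a) set"
  where "grothendieck_class S a = grothendieck_rel S `` {(a, \<one>\<^bsub>S\<^esub>)}"

text \<open>
  A single type must hold representatives of all isomorphism classes. For a graded module whose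
  components are finite-dimensional, choosing a basis of each component identifies the
  underlying vector space with a space of functions
  \<^typ>\<open>'g \<times> nat \<Rightarrow> 'k\<close>; so every such module, whatever its type, is isomorphic to
  one of the following type. The class of a module of arbitrary type is its set of representatives.
\<close>

type_synonym ('k, 'r, 'g) gmodule_rep = "('r, 'g \<times> nat \<Rightarrow> 'k, 'g) graded_module"

definition iso_class ::
    "'k ring \<Rightarrow> ('k, 'r, 'g::ab_group_add) graded_module \<Rightarrow> ('r, 'm, 'g) graded_module \<Rightarrow>
     ('k, 'r, 'g) gmodule_rep set"
  where "iso_class k R M = {P. bdf_projective k R P \<and> graded_isomorphic R M P}"

definition bdf_monoid ::
    "'k ring \<Rightarrow> ('k, 'r, 'g::ab_group_add) graded_module \<Rightarrow> ('k, 'r, 'g) gmodule_rep set monoid"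
  where "bdf_monoid k R =
    \<lparr>carrier = iso_class k R ` {P :: ('k, 'r, 'g) gmodule_rep. bdf_projective k R P},
     mult = (\<lambda>X Y. \<Union>P\<in>X. \<Union>P'\<in>Y. iso_class k R (graded_direct_sum P P')),
     one = iso_class k R zero_graded_module\<rparr>"

type_synonym ('k, 'r, 'g) K0_elem =
  "(('k, 'r, 'g) gmodule_rep set \<times> ('k, 'r, 'g) gmodule_rep set) set"

definition K0 ::
    "'k ring \<Rightarrow> ('k, 'r, 'g::ab_group_add) graded_module \<Rightarrow> ('k, 'r, 'g) K0_elem monoid"
  where "K0 k R = grothendieck_group (bdf_monoid k R)"

definition K0_class ::
    "'k ring \<Rightarrow> ('k, 'r, 'g::ab_group_add) graded_module \<Rightarrow> ('r, 'm, 'g) graded_module \<Rightarrow>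
     ('k, 'r, 'g) K0_elem"
  where "K0_class k R M = grothendieck_class (bdf_monoid k R) (iso_class k R M)"

definition is_tensor_mult ::
    "'k ring \<Rightarrow> ('k, 'r, 'g::ab_group_add) graded_module \<Rightarrow>
     (('k, 'r, 'g) K0_elem \<times> ('k, 'r, 'g) K0_elem \<Rightarrow> ('k, 'r, 'g) K0_elem) \<Rightarrow> bool"
  where "is_tensor_mult k R mul \<longleftrightarrow>
    mul \<in> carrier (K0 k R) \<times> carrier (K0 k R) \<rightarrow>\<^sub>E carrier (K0 k R) \<and>
    (\<forall>a\<in>carrier (K0 k R). \<forall>b\<in>carrier (K0 k R). \<forall>c\<in>carrier (K0 k R).
       mul (a \<otimes>\<^bsub>K0 k R\<^esub> b, c) = mul (a, c) \<otimes>\<^bsub>K0 k R\<^esub> mul (b, c) \<and>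
       mul (a, b \<otimes>\<^bsub>K0 k R\<^esub> c) = mul (a, b) \<otimes>\<^bsub>K0 k R\<^esub> mul (a, c)) \<and>
    (\<forall>(F :: ('k, 'r, 'g) gmodule_rep) (F' :: ('k, 'r, 'g) gmodule_rep).
       bdf_projective k R F \<longrightarrow> bdf_projective k R F' \<longrightarrow>
       mul (K0_class k R F, K0_class k R F') = K0_class k R (graded_tensor k R F F'))"

definition K0_ring ::
    "'k ring \<Rightarrow> ('k, 'r, 'g::ab_group_add) graded_module \<Rightarrow>
     (('k, 'r, 'g) K0_elem \<times> ('k, 'r, 'g) K0_elem \<Rightarrow> ('k, 'r, 'g) K0_elem) \<Rightarrow>
     ('k, 'r, 'g) K0_elem ring"
  where "K0_ring k R mul =
    \<lparr>carrier = carrier (K0 k R), mult = (\<lambda>a b. mul (a, b)), one = K0_class k R (regular_module R),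
     ring.zero = one (K0 k R), add = mult (K0 k R)\<rparr>"

definition is_K_series_iso ::
    "'k ring \<Rightarrow> ('k, 'r, 'g::ab_group_add) graded_module \<Rightarrow>
     (('k, 'r, 'g) K0_elem \<Rightarrow> 'g \<Rightarrow> int) \<Rightarrow> bool"
  where "is_K_series_iso k R \<phi> \<longleftrightarrow>
    \<phi> \<in> iso (K0 k R) (add_monoid (series_ring (gsupp R))) \<and> \<phi> \<in> extensional (carrier (K0 k R)) \<and>
    (\<forall>F :: ('k, 'r, 'g) gmodule_rep. bdf_projective k R F \<longrightarrow> \<phi> (K0_class k R F) = K_series k R F)"

end

theory Submission
  imports Defs
begin

text \<open>
  The Grothendieck group is compared with the series ring by counting homogeneous generators.
  A BDF projective module \<open>M\<close> is graded free: lifting a basis of \<open>M / \<mm>M\<close> (with \<open>\<mm>\<close> spanned by the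
  components of nonzero degree) gives a graded surjection from a free module \<open>F\<close>, by induction along
  the degrees of the downward finite support. If \<open>K\<close> is its kernel, then \<open>K \<subseteq> \<mm>F\<close> by minimality, and
  since \<open>K\<close> is a direct summand of \<open>F\<close> this yields \<open>K = \<mm>K\<close>, whence \<open>K = 0\<close> by the same induction.
  For a graded free module the Hilbert series is the Hilbert series of \<open>R\<close> times the series counting
  the generators by degree, so the latter is the \<open>K\<close>-series, and it determines the module up to
  isomorphism. Every series with nonnegative coefficients occurs, direct sums add the counting
  series, and tensor products multiply them because the pairs of generators form a basis of the
  tensor product. Hence the Grothendieck group is the additive group of the series ring, and the
  tensor product corresponds to the product of series.
\<close>

section \<open>Series supported in a pointed monoid\<close>

text \<open>Statements about classes are reduced to statements about series: two BDF projective
  modules are isomorphic exactly when their \<open>K_series\<close> agree, so the ring laws on the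
  Grothendieck group are never checked on modules but pulled back from the series ring. For tensor
  products two facts suffice: the result is again graded free, and its counting series is the
  product. Integer series cancel, so the relation that defines the group becomes equality of
  differences of series; and an additive map on the group is determined by its values on classes,
  which makes both the product and the isomorphism unique. The hypotheses on \<open>R\<close> enter
  at separate places. The domain property makes the support a monoid. Pointedness gives
  antisymmetry, hence strict descent in every recursion on degrees. The equation
  \<open>R_0 = k\<close> turns coefficients of degree 0 into scalars, which drives the minimality
  argument, and gives the Hilbert series of \<open>R\<close> the constant term 1, which makes it a
  unit. Since isomorphism classes are sets over one fixed type, a module of another type must first
  be copied to functions on \<open>'g \<times> nat\<close>.\<close>

locale pointed_monoid =
  fixes Q :: "'g::ab_group_add set"
  assumes zero_mem: "0 \<in> Q"
    and add_mem: "p \<in> Q \<Longrightarrow> q \<in> Q \<Longrightarrow> p + q \<in> Q"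
    and pointed: "pointed Q"
    and downward_finite: "downward_finite Q Q"
begin

lemma le_refl [simp]: "monoid_le Q g g"
  by (simp add: monoid_le_def zero_mem)

lemma le_trans: "monoid_le Q g h \<Longrightarrow> monoid_le Q h u \<Longrightarrow> monoid_le Q g u"
  using add_mem[of "h - g" "u - h"] by (simp add: monoid_le_def)

lemma le_antisym: "monoid_le Q g h \<Longrightarrow> monoid_le Q h g \<Longrightarrow> g = h"
  using pointed unfolding monoid_le_def pointed_def
  by (metis add.commute add.right_inverse diff_add_cancel minus_diff_eq uminus_add_conv_diff right_minus_eq)

text \<open>Supports of series and supports of BDF modules obey the same two conditions, so one set
  of closure rules serves both.\<close>

definition bounded_support :: "'g set \<Rightarrow> bool"
  where "bounded_support U \<longleftrightarrow> downward_finite Q U \<and> finitely_bounded_below Q U"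

lemma bounded_support_subset: "bounded_support V" if "bounded_support U" "V \<subseteq> U"
proof -
  have "finite {u \<in> V. monoid_le Q u g}" for g
    by (rule finite_subset[of _ "{u \<in> U. monoid_le Q u g}"])
      (use that in \<open>auto simp: bounded_support_def downward_finite_def\<close>)
  with that show ?thesis
    unfolding bounded_support_def downward_finite_def finitely_bounded_below_def by blast
qed

lemma bounded_support_Un:
  assumes "bounded_support U" "bounded_support V"
  shows "bounded_support (U \<union> V)"
proof -
  have "{u \<in> U \<union> V. monoid_le Q u g} = {u \<in> U. monoid_le Q u g} \<union> {u \<in> V. monoid_le Q u g}" for g
    by auto
  moreover obtain P P' where "finite P" "\<forall>u\<in>U. \<exists>p\<in>P. monoid_le Q p u"
      "finite P'" "\<forall>u\<in>V. \<exists>p\<in>P'. monoid_le Q p u"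
    using assms unfolding bounded_support_def finitely_bounded_below_def by auto
  then have "finitely_bounded_below Q (U \<union> V)"
    unfolding finitely_bounded_below_def by (intro exI[of _ "P \<union> P'"]) auto
  ultimately show ?thesis
    using assms by (simp add: bounded_support_def downward_finite_def)
qed

lemma bounded_support_Q: "bounded_support Q"
  using downward_finite unfolding bounded_support_def finitely_bounded_below_def
  by (auto intro!: exI[of _ "{0}"] simp: monoid_le_def)

lemma bounded_support_zero: "bounded_support {0}"
  by (rule bounded_support_subset[OF bounded_support_Q]) (simp add: zero_mem)

text \<open>If \<open>h\<close> lies above a lower bound \<open>p'\<close>, then
  \<open>g + h\<close> below \<open>u\<close> forces \<open>g\<close> below \<open>u - p'\<close>.
  Finitely many bounds thus leave finitely many \<open>g\<close>, and likewise finitely many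
  \<open>h\<close>. This is the finiteness behind every product of series.\<close>

lemma finite_bounded_pairs:
  assumes "bounded_support U" "bounded_support V"
  shows "finite {(g, h). g \<in> U \<and> h \<in> V \<and> monoid_le Q (g + h) u}"
proof -
  obtain P P' where P: "finite P" "\<forall>u\<in>U. \<exists>p\<in>P. monoid_le Q p u"
      and P': "finite P'" "\<forall>u\<in>V. \<exists>p\<in>P'. monoid_le Q p u"
    using assms unfolding bounded_support_def finitely_bounded_below_def by auto
  have fin: "finite (\<Union>p\<in>P'. {g \<in> U. monoid_le Q g (u - p)})" "finite (\<Union>p\<in>P. {h \<in> V. monoid_le Q h (u - p)})"
    using assms P P' by (auto simp: bounded_support_def downward_finite_def)
  have "{(g, h). g \<in> U \<and> h \<in> V \<and> monoid_le Q (g + h) u} \<subseteq>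
      (\<Union>p\<in>P'. {g \<in> U. monoid_le Q g (u - p)}) \<times> (\<Union>p\<in>P. {h \<in> V. monoid_le Q h (u - p)})"
  proof clarify
    fix g h assume gh: "g \<in> U" "h \<in> V" "monoid_le Q (g + h) u"
    obtain p p' where p: "p \<in> P" "monoid_le Q p g" "p' \<in> P'" "monoid_le Q p' h"
      using P P' gh by blast
    have "monoid_le Q g (u - p')" "monoid_le Q h (u - p)"
      using p gh add_mem[of "u - (g + h)" "h - p'"] add_mem[of "u - (g + h)" "g - p"]
      by (simp_all add: monoid_le_def algebra_simps)
    with p gh show "g \<in> (\<Union>p\<in>P'. {g \<in> U. monoid_le Q g (u - p)}) \<and> h \<in> (\<Union>p\<in>P. {h \<in> V. monoid_le Q h (u - p)})"
      by auto
  qed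
  with fin show ?thesis by (meson finite_SigmaI finite_subset)
qed

text \<open>Downward finiteness is the finiteness of pairs pushed forward along addition; the lower
  bounds are the sums of lower bounds.\<close>

lemma bounded_support_plus:
  assumes "bounded_support U" "bounded_support V"
  shows "bounded_support {g + h | g h. g \<in> U \<and> h \<in> V}"
proof -
  have "finite {x \<in> {g + h | g h. g \<in> U \<and> h \<in> V}. monoid_le Q x u}" for u
  proof (rule finite_subset)
    show "finite ((\<lambda>(g, h). g + h) ` {(g, h). g \<in> U \<and> h \<in> V \<and> monoid_le Q (g + h) u})"
      by (intro finite_imageI finite_bounded_pairs assms)
  qed (auto simp: image_iff)
  moreover obtain P P' where P: "finite P" "\<forall>u\<in>U. \<exists>p\<in>P. monoid_le Q p u"
      and P': "finite P'" "\<forall>u\<in>V. \<exists>p\<in>P'. monoid_le Q p u"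
    using assms unfolding bounded_support_def finitely_bounded_below_def by auto
  have "\<exists>p\<in>(\<lambda>(p, q). p + q) ` (P \<times> P'). monoid_le Q p (g + h)" if gh: "g \<in> U" "h \<in> V" for g h
  proof -
    obtain p p' where p: "p \<in> P" "monoid_le Q p g" "p' \<in> P'" "monoid_le Q p' h"
      using P P' gh by blast
    have "monoid_le Q (p + p') (g + h)"
      using p add_mem[of "g - p" "h - p'"] by (simp add: monoid_le_def algebra_simps)
    with p show ?thesis by auto
  qed
  then have "finitely_bounded_below Q {g + h | g h. g \<in> U \<and> h \<in> V}"
    unfolding finitely_bounded_below_def
    using P P' by (intro exI[of _ "(\<lambda>(p, q). p + q) ` (P \<times> P')"]) auto
  ultimately show ?thesis by (simp add: bounded_support_def downward_finite_def)
qed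

text \<open>By antisymmetry \<open>g\<close> itself is lost when passing from \<open>g\<close> to a
  strictly smaller \<open>h\<close>. The cardinality serves as the measure for recursion and
  induction on degrees.\<close>

lemma card_below_less:
  assumes "downward_finite Q U" "g \<in> U" "monoid_le Q h g" "h \<noteq> g"
  shows "card {u \<in> U. monoid_le Q u h} < card {u \<in> U. monoid_le Q u g}"
proof (rule psubset_card_mono)
  show "finite {u \<in> U. monoid_le Q u g}" using assms(1) by (simp add: downward_finite_def)
  have "\<not> monoid_le Q g h" using assms le_antisym by blast
  then have "g \<in> {u \<in> U. monoid_le Q u g} - {u \<in> U. monoid_le Q u h}" using assms by simp
  moreover have "{u \<in> U. monoid_le Q u h} \<subseteq> {u \<in> U. monoid_le Q u g}"
    using le_trans[OF _ assms(3)] by blast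
  ultimately show "{u \<in> U. monoid_le Q u h} \<subset> {u \<in> U. monoid_le Q u g}" by blast
qed

section \<open>The commutative ring of series\<close>

abbreviation "A \<equiv> series_ring Q"

lemma series_carrier: "a \<in> carrier A \<longleftrightarrow> bounded_support {g. a g \<noteq> 0}"
  by (simp add: series_ring_def bounded_support_def)

lemma series_simps [simp]:
  "\<zero>\<^bsub>A\<^esub> = (\<lambda>_. 0)" "\<one>\<^bsub>A\<^esub> = (\<lambda>g. if g = 0 then 1 else 0)" "a \<oplus>\<^bsub>A\<^esub> b = (\<lambda>g. a g + b g)"
  by (simp_all add: series_ring_def)

text \<open>Any finite set that contains the contributing degrees may index the sum, so several
  products can be expanded over one common set.\<close>

lemma series_mult_eq:
  assumes "finite X" "\<And>g. a g \<noteq> 0 \<Longrightarrow> b (u - g) \<noteq> 0 \<Longrightarrow> g \<in> X"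
  shows "(a \<otimes>\<^bsub>A\<^esub> b) u = (\<Sum>g\<in>X. a g * b (u - g))"
proof -
  have "(a \<otimes>\<^bsub>A\<^esub> b) u = (\<Sum>(g, h) \<in> {(g, h). g + h = u \<and> a g \<noteq> 0 \<and> b h \<noteq> 0}. a g * b h)"
    by (simp add: series_ring_def)
  also have "\<dots> = (\<Sum>g\<in>{g \<in> X. a g \<noteq> 0 \<and> b (u - g) \<noteq> 0}. a g * b (u - g))"
    by (rule sum.reindex_bij_witness[where i = "\<lambda>g. (g, u - g)" and j = fst])
      (use assms(2) in \<open>auto simp: algebra_simps\<close>)
  also have "\<dots> = (\<Sum>g\<in>X. a g * b (u - g))"
    by (rule sum.mono_neutral_left) (use assms(1) in auto)
  finally show ?thesis .
qed

lemma finite_mult_support: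
  assumes "a \<in> carrier A" "b \<in> carrier A"
  shows "finite {g. a g \<noteq> 0 \<and> b (u - g) \<noteq> 0}"
proof (rule finite_subset)
  show "finite (fst ` {(g, h). g \<in> {g. a g \<noteq> 0} \<and> h \<in> {g. b g \<noteq> 0} \<and> monoid_le Q (g + h) u})"
    using assms by (intro finite_imageI finite_bounded_pairs) (auto simp: series_carrier)
  show "{g. a g \<noteq> 0 \<and> b (u - g) \<noteq> 0} \<subseteq> \<dots>"
  proof
    fix g assume "g \<in> {g. a g \<noteq> 0 \<and> b (u - g) \<noteq> 0}"
    then show "g \<in> fst ` {(g, h). g \<in> {g. a g \<noteq> 0} \<and> h \<in> {g. b g \<noteq> 0} \<and> monoid_le Q (g + h) u}"
      by (intro image_eqI[of _ _ "(g, u - g)"]) auto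
  qed
qed

lemma series_mult_nonzero: "(a \<otimes>\<^bsub>A\<^esub> b) u \<noteq> 0 \<Longrightarrow> \<exists>g. a g \<noteq> 0 \<and> b (u - g) \<noteq> 0"
  by (rule ccontr) (use series_mult_eq[of "{}" a b u] in auto)

lemma series_mult_closed: "a \<otimes>\<^bsub>A\<^esub> b \<in> carrier A" if "a \<in> carrier A" "b \<in> carrier A"
  unfolding series_carrier
proof (rule bounded_support_subset)
  show "bounded_support {g + h | g h. g \<in> {g. a g \<noteq> 0} \<and> h \<in> {g. b g \<noteq> 0}}"
    using that by (intro bounded_support_plus) (auto simp: series_carrier)
  show "{g. (a \<otimes>\<^bsub>A\<^esub> b) g \<noteq> 0} \<subseteq> \<dots>"
  proof
    fix u assume "u \<in> {g. (a \<otimes>\<^bsub>A\<^esub> b) g \<noteq> 0}"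
    then obtain g where "a g \<noteq> 0" "b (u - g) \<noteq> 0" using series_mult_nonzero by blast
    moreover have "u = g + (u - g)" by simp
    ultimately show "u \<in> {g + h | g h. g \<in> {g. a g \<noteq> 0} \<and> h \<in> {g. b g \<noteq> 0}}" by blast
  qed
qed

lemma series_add_closed: "(\<lambda>g. a g + b g) \<in> carrier A" if "a \<in> carrier A" "b \<in> carrier A"
  using that unfolding series_carrier
  by (rule bounded_support_subset[OF bounded_support_Un, of "{g. a g \<noteq> 0}" "{g. b g \<noteq> 0}"]) auto

lemma series_mult_assoc:
  assumes a: "a \<in> carrier A" and b: "b \<in> carrier A" and c: "c \<in> carrier A"
  shows "(a \<otimes>\<^bsub>A\<^esub> b) \<otimes>\<^bsub>A\<^esub> c = a \<otimes>\<^bsub>A\<^esub> (b \<otimes>\<^bsub>A\<^esub> c)"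
proof
  fix u
  let ?T = "{(g, (h, l)). g \<in> {g. a g \<noteq> 0} \<and> (h, l) \<in> {(h, l). b h \<noteq> 0 \<and> c l \<noteq> 0 \<and> g + (h + l) = u}}"
  \<comment> \<open>Contributing triples of degrees with sum \<open>u\<close>, recorded by their
    first two entries. The degree of \<open>a\<close> against the sum of the other two, and the
    degree of \<open>b\<close> against the sum of the other two, are bounded pairs; hence both
    projections of \<open>T\<close> are finite.\<close>
  define T where "T = {(g, h). a g \<noteq> 0 \<and> b h \<noteq> 0 \<and> c (u - (g + h)) \<noteq> 0}"
  let ?P = "{(g, x). g \<in> {g. a g \<noteq> 0} \<and> x \<in> {h + l | h l. h \<in> {g. b g \<noteq> 0} \<and> l \<in> {g. c g \<noteq> 0}} \<and> monoid_le Q (g + x) u}"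
  let ?P' = "{(h, x). h \<in> {g. b g \<noteq> 0} \<and> x \<in> {h + l | h l. h \<in> {g. a g \<noteq> 0} \<and> l \<in> {g. c g \<noteq> 0}} \<and> monoid_le Q (h + x) u}"
  have "finite ?P" "finite ?P'"
    by (intro finite_bounded_pairs bounded_support_plus; use a b c in \<open>simp add: series_carrier\<close>)+
  moreover have "fst ` T \<subseteq> fst ` ?P"
  proof
    fix g assume "g \<in> fst ` T"
    then obtain h where "a g \<noteq> 0" "b h \<noteq> 0" "c (u - (g + h)) \<noteq> 0" by (auto simp: T_def)
    moreover from this have "h + (u - (g + h)) \<in> {h + l | h l. h \<in> {g. b g \<noteq> 0} \<and> l \<in> {g. c g \<noteq> 0}}"
      by blast
    ultimately have "(g, h + (u - (g + h))) \<in> ?P" by simp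
    then show "g \<in> fst ` ?P" by force
  qed
  moreover have "snd ` T \<subseteq> fst ` ?P'"
  proof
    fix h assume "h \<in> snd ` T"
    then obtain g where "a g \<noteq> 0" "b h \<noteq> 0" "c (u - (g + h)) \<noteq> 0" by (auto simp: T_def)
    moreover from this have "g + (u - (g + h)) \<in> {h + l | h l. h \<in> {g. a g \<noteq> 0} \<and> l \<in> {g. c g \<noteq> 0}}"
      by blast
    ultimately have "(h, g + (u - (g + h))) \<in> ?P'" by (simp add: algebra_simps)
    then show "h \<in> fst ` ?P'" by force
  qed
  ultimately have G: "finite (fst ` T)" and H: "finite (snd ` T)" by (meson finite_imageI finite_subset)+
  \<comment> \<open>A finite set containing every intermediate degree \<open>g + h\<close> that
    occurs, over which the two summations can be interchanged.\<close>
  define X where "X = (\<lambda>(g, h). g + h) ` (fst ` T \<times> snd ` T)"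
  have X: "finite X" using G H by (simp add: X_def)
  have mem: "g \<in> fst ` T" "x \<in> X" if "a g \<noteq> 0" "b (x - g) \<noteq> 0" "c (u - x) \<noteq> 0" for g x
  proof -
    have "(g, x - g) \<in> T" using that by (simp add: T_def)
    then have *: "g \<in> fst ` T" "x - g \<in> snd ` T" by force+
    have "x = (\<lambda>(g, h). g + h) (g, x - g)" by simp
    with * show "g \<in> fst ` T" "x \<in> X" unfolding X_def by blast+
  qed
  have "((a \<otimes>\<^bsub>A\<^esub> b) \<otimes>\<^bsub>A\<^esub> c) u = (\<Sum>x\<in>X. (a \<otimes>\<^bsub>A\<^esub> b) x * c (u - x))"
    using mem series_mult_nonzero by (intro series_mult_eq X) blast
  also have "\<dots> = (\<Sum>x\<in>X. \<Sum>g\<in>fst ` T. a g * b (x - g) * c (u - x))"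
  proof (rule sum.cong[OF refl])
    fix x
    show "(a \<otimes>\<^bsub>A\<^esub> b) x * c (u - x) = (\<Sum>g\<in>fst ` T. a g * b (x - g) * c (u - x))"
    proof (cases "c (u - x) = 0")
      case False
      then show ?thesis using mem series_mult_eq[OF G, of a b x] by (simp add: sum_distrib_right)
    qed simp
  qed
  also have "\<dots> = (\<Sum>g\<in>fst ` T. \<Sum>x\<in>X. a g * b (x - g) * c (u - x))"
    by (rule sum.swap)
  also have "\<dots> = (\<Sum>g\<in>fst ` T. a g * (b \<otimes>\<^bsub>A\<^esub> c) (u - g))"
  proof (rule sum.cong[OF refl])
    fix g assume g: "g \<in> fst ` T"
    have ag: "a g \<noteq> 0" using g by (auto simp: T_def)
    have "(b \<otimes>\<^bsub>A\<^esub> c) (u - g) = (\<Sum>h\<in>(\<lambda>x. x - g) ` X. b h * c (u - g - h))"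
    proof (rule series_mult_eq)
      fix h assume "b h \<noteq> 0" "c (u - g - h) \<noteq> 0"
      then have "g + h \<in> X" using mem[of g "g + h"] ag by (simp add: algebra_simps)
      then show "h \<in> (\<lambda>x. x - g) ` X" by (intro image_eqI[of _ _ "g + h"]) auto
    qed (simp add: X)
    also have "\<dots> = (\<Sum>x\<in>X. b (x - g) * c (u - x))"
      by (subst sum.reindex) (auto simp: inj_on_def)
    finally show "(\<Sum>x\<in>X. a g * b (x - g) * c (u - x)) = a g * (b \<otimes>\<^bsub>A\<^esub> c) (u - g)"
      by (simp add: sum_distrib_left mult.assoc)
  qed
  also have "\<dots> = (a \<otimes>\<^bsub>A\<^esub> (b \<otimes>\<^bsub>A\<^esub> c)) u"
  proof (rule series_mult_eq[symmetric, OF G])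
    fix g assume "a g \<noteq> 0" "(b \<otimes>\<^bsub>A\<^esub> c) (u - g) \<noteq> 0"
    then obtain h where "b h \<noteq> 0" "c (u - g - h) \<noteq> 0" using series_mult_nonzero by blast
    then show "g \<in> fst ` T" using \<open>a g \<noteq> 0\<close> mem(1)[of g "g + h"] by (simp add: algebra_simps)
  qed
  finally show "((a \<otimes>\<^bsub>A\<^esub> b) \<otimes>\<^bsub>A\<^esub> c) u = (a \<otimes>\<^bsub>A\<^esub> (b \<otimes>\<^bsub>A\<^esub> c)) u" .
qed

lemma series_mult_comm: "a \<otimes>\<^bsub>A\<^esub> b = b \<otimes>\<^bsub>A\<^esub> a"
proof
  fix u
  show "(a \<otimes>\<^bsub>A\<^esub> b) u = (b \<otimes>\<^bsub>A\<^esub> a) u"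
    unfolding series_ring_def ring.simps monoid.simps
    by (rule sum.reindex_bij_witness[where i = prod.swap and j = prod.swap])
      (auto simp: add.commute mult.commute)
qed

lemma series_ring_cring: "cring A"
proof (rule cringI)
  show "abelian_group A"
  proof (rule abelian_groupI)
    fix a assume a: "a \<in> carrier A"
    then show "\<exists>b\<in>carrier A. b \<oplus>\<^bsub>A\<^esub> a = \<zero>\<^bsub>A\<^esub>"
      by (intro bexI[of _ "\<lambda>g. - a g"]) (auto simp: series_carrier)
  next
    show "\<zero>\<^bsub>A\<^esub> \<in> carrier A"
      using bounded_support_subset[OF bounded_support_Q, of "{}"] by (simp add: series_carrier)
  qed (auto simp: series_add_closed algebra_simps)
  show "Group.comm_monoid A"
  proof (rule comm_monoidI)
    show one: "\<one>\<^bsub>A\<^esub> \<in> carrier A" using bounded_support_zero by (simp add: series_carrier)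
    fix a assume "a \<in> carrier A"
    show "\<one>\<^bsub>A\<^esub> \<otimes>\<^bsub>A\<^esub> a = a"
    proof
      fix u show "(\<one>\<^bsub>A\<^esub> \<otimes>\<^bsub>A\<^esub> a) u = a u"
        by (subst series_mult_eq[of "{0}"]) (auto split: if_splits)
    qed
  qed (auto simp: series_mult_closed series_mult_assoc intro: series_mult_comm)
  fix a b c assume abc: "a \<in> carrier A" "b \<in> carrier A" "c \<in> carrier A"
  show "(a \<oplus>\<^bsub>A\<^esub> b) \<otimes>\<^bsub>A\<^esub> c = a \<otimes>\<^bsub>A\<^esub> c \<oplus>\<^bsub>A\<^esub> b \<otimes>\<^bsub>A\<^esub> c"
  proof
    fix u
    let ?X = "{g. a g \<noteq> 0 \<and> c (u - g) \<noteq> 0} \<union> {g. b g \<noteq> 0 \<and> c (u - g) \<noteq> 0}"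
    have X: "finite ?X" using abc by (simp add: finite_mult_support)
    show "((a \<oplus>\<^bsub>A\<^esub> b) \<otimes>\<^bsub>A\<^esub> c) u = (a \<otimes>\<^bsub>A\<^esub> c \<oplus>\<^bsub>A\<^esub> b \<otimes>\<^bsub>A\<^esub> c) u"
      using series_mult_eq[OF X, of "\<lambda>g. a g + b g" c u] series_mult_eq[OF X, of a c u] series_mult_eq[OF X, of b c u]
      by (auto simp: sum.distrib algebra_simps)
  qed
qed

text \<open>The equation \<open>H v = 1\<close> is solved coefficient by coefficient: as
  \<open>H 0 = 1\<close>, the coefficient of \<open>v\<close> at \<open>g\<close> is determined by
  those at \<open>g - q\<close> with \<open>q \<noteq> 0\<close> in \<open>Q\<close>, and these
  degrees are strictly smaller.\<close>

lemma series_Units: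
  assumes H: "H 0 = 1" "\<And>g. H g \<noteq> 0 \<Longrightarrow> g \<in> Q"
  shows "H \<in> Units A"
proof -
  define r where "r = {(h, g). g \<in> Q \<and> monoid_le Q h g \<and> h \<noteq> g}"
  have wf: "wf r"
    by (rule wf_subset[OF wf_measure[of "\<lambda>g. card {u \<in> Q. monoid_le Q u g}"]])
      (auto simp: r_def intro!: card_below_less downward_finite)
  define Y where "Y g = {q \<in> Q. q \<noteq> 0 \<and> g - q \<in> Q}" for g
  have Y: "finite (Y g)" for g
    by (rule finite_subset[of _ "{u \<in> Q. monoid_le Q u g}"])
      (use downward_finite in \<open>auto simp: downward_finite_def Y_def monoid_le_def\<close>)
  define F where "F v g = (if g \<in> Q then if g = 0 then 1 else - (\<Sum>q\<in>Y g. H q * v (g - q)) else 0)"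
    for v :: "'g \<Rightarrow> int" and g
  define v where "v = wfrec r F"
  \<comment> \<open>The recursion equation without \<open>cut\<close>: \<open>F\<close> looks up its
    argument only at \<open>g - q\<close> with \<open>q\<close> in \<open>Y g\<close>, and these lie
    below \<open>g\<close> in \<open>r\<close>.\<close>
  have v: "v g = F v g" for g
  proof -
    have "v g = F (cut v r g) g" unfolding v_def by (rule wfrec[OF wf])
    also have "\<dots> = F v g"
    proof (cases "g \<in> Q")
      case True
      have "cut v r g (g - q) = v (g - q)" if "q \<in> Y g" for q
        using that True by (auto simp: Y_def cut_def r_def monoid_le_def)
      then have "(\<Sum>q\<in>Y g. H q * cut v r g (g - q)) = (\<Sum>q\<in>Y g. H q * v (g - q))"
        by (intro sum.cong) auto
      then show ?thesis by (simp add: F_def)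
    qed (simp add: F_def)
    finally show ?thesis .
  qed
  have vQ: "v g \<noteq> 0 \<Longrightarrow> g \<in> Q" for g by (subst (asm) v) (auto simp: F_def split: if_splits)
  have car: "H \<in> carrier A" "v \<in> carrier A" using H(2) vQ
    by (auto simp: series_carrier intro!: bounded_support_subset[OF bounded_support_Q])
  have "(H \<otimes>\<^bsub>A\<^esub> v) g = \<one>\<^bsub>A\<^esub> g" for g
  proof (cases "g \<in> Q")
    case False
    have "(H \<otimes>\<^bsub>A\<^esub> v) g = 0"
    proof (rule ccontr)
      assume "(H \<otimes>\<^bsub>A\<^esub> v) g \<noteq> 0"
      then obtain q where "H q \<noteq> 0" "v (g - q) \<noteq> 0" using series_mult_nonzero by blast
      then have "q + (g - q) \<in> Q" by (intro add_mem H(2) vQ)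
      with False show False by simp
    qed
    then show ?thesis using False zero_mem by auto
  next
    case True
    have "(H \<otimes>\<^bsub>A\<^esub> v) g = (\<Sum>q\<in>insert 0 (Y g). H q * v (g - q))"
      by (rule series_mult_eq) (use Y H(2) vQ in \<open>auto simp: Y_def\<close>)
    also have "\<dots> = v g + (\<Sum>q\<in>Y g. H q * v (g - q))"
      using Y H by (subst sum.insert) (auto simp: Y_def)
    also have "\<dots> = \<one>\<^bsub>A\<^esub> g"
    proof (cases "g = 0")
      case True
      \<comment> \<open>An element of \<open>Y 0\<close> would be a nonzero \<open>q\<close> in
        \<open>Q\<close> with \<open>- q\<close> in \<open>Q\<close>.\<close>
      then have "Y g = {}" using pointed by (auto simp: Y_def pointed_def)
      then show ?thesis using True by (subst v) (simp add: F_def zero_mem)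
    next
      case False
      then show ?thesis using True by (subst v) (simp add: F_def)
    qed
    finally show ?thesis .
  qed
  then have "H \<otimes>\<^bsub>A\<^esub> v = \<one>\<^bsub>A\<^esub>" by blast
  then show ?thesis using car series_mult_comm[of H v] unfolding Units_def by auto
qed

end

section \<open>Group completion of a cancellative monoid\<close>

text \<open>The abstract form of the computation: an injective additive invariant \<kappa> with
  values in an abelian group whose differences exhaust that group identifies the group completion
  with it.\<close>

locale grothendieck_iso = abelian_group A
  for A :: "('c, 'y) ring_scheme" (structure) +
  fixes S :: "'a monoid" and \<kappa> :: "'a \<Rightarrow> 'c"
  assumes mult_mem: "x \<in> carrier S \<Longrightarrow> y \<in> carrier S \<Longrightarrow> x \<otimes>\<^bsub>S\<^esub> y \<in> carrier S"
    and one_mem: "\<one>\<^bsub>S\<^esub> \<in> carrier S"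
    and \<kappa>_mem: "x \<in> carrier S \<Longrightarrow> \<kappa> x \<in> carrier A"
    and \<kappa>_inj: "inj_on \<kappa> (carrier S)"
    and \<kappa>_mult: "x \<in> carrier S \<Longrightarrow> y \<in> carrier S \<Longrightarrow> \<kappa> (x \<otimes>\<^bsub>S\<^esub> y) = \<kappa> x \<oplus> \<kappa> y"
    and \<kappa>_one: "\<kappa> \<one>\<^bsub>S\<^esub> = \<zero>"
    and \<kappa>_diff: "c \<in> carrier A \<Longrightarrow> \<exists>x\<in>carrier S. \<exists>y\<in>carrier S. c = \<kappa> x \<ominus> \<kappa> y"
begin

text \<open>Injectivity of \<kappa> moves the equation into a group, where the common summand
  \<open>e\<close> cancels and the terms can be rearranged to differences.\<close>

lemma rel_iff:
  "((x, y), (z, w)) \<in> grothendieck_rel S \<longleftrightarrow>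
    {x, y, z, w} \<subseteq> carrier S \<and> \<kappa> x \<ominus> \<kappa> y = \<kappa> z \<ominus> \<kappa> w"
proof -
  have cancel: "(p \<oplus> q) \<ominus> q = p" "(p \<ominus> q) \<oplus> q = p" if "p \<in> carrier A" "q \<in> carrier A" for p q
    using that by (simp_all add: minus_eq a_assoc r_neg l_neg)
  have eq: "x \<otimes>\<^bsub>S\<^esub> w \<otimes>\<^bsub>S\<^esub> e = z \<otimes>\<^bsub>S\<^esub> y \<otimes>\<^bsub>S\<^esub> e \<longleftrightarrow> \<kappa> x \<ominus> \<kappa> y = \<kappa> z \<ominus> \<kappa> w"
    if c: "x \<in> carrier S" "y \<in> carrier S" "z \<in> carrier S" "w \<in> carrier S" "e \<in> carrier S" for e
  proof -
    have k: "\<kappa> x \<in> carrier A" "\<kappa> y \<in> carrier A" "\<kappa> z \<in> carrier A" "\<kappa> w \<in> carrier A" "\<kappa> e \<in> carrier A"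
      using c \<kappa>_mem by auto
    have "x \<otimes>\<^bsub>S\<^esub> w \<otimes>\<^bsub>S\<^esub> e = z \<otimes>\<^bsub>S\<^esub> y \<otimes>\<^bsub>S\<^esub> e \<longleftrightarrow>
        \<kappa> (x \<otimes>\<^bsub>S\<^esub> w \<otimes>\<^bsub>S\<^esub> e) = \<kappa> (z \<otimes>\<^bsub>S\<^esub> y \<otimes>\<^bsub>S\<^esub> e)"
      using c \<kappa>_inj mult_mem by (metis inj_on_eq_iff)
    also have "\<dots> \<longleftrightarrow> \<kappa> x \<oplus> \<kappa> w \<oplus> \<kappa> e = \<kappa> z \<oplus> \<kappa> y \<oplus> \<kappa> e"
      using c mult_mem by (simp add: \<kappa>_mult)
    also have "\<dots> \<longleftrightarrow> \<kappa> x \<oplus> \<kappa> w = \<kappa> z \<oplus> \<kappa> y" using k by simp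
    also have "\<dots> \<longleftrightarrow> \<kappa> x \<ominus> \<kappa> y = \<kappa> z \<ominus> \<kappa> w"
    proof
      assume *: "\<kappa> x \<oplus> \<kappa> w = \<kappa> z \<oplus> \<kappa> y"
      have "\<kappa> x \<ominus> \<kappa> y = ((\<kappa> x \<oplus> \<kappa> w) \<ominus> \<kappa> w) \<ominus> \<kappa> y" using k by (simp add: cancel)
      also have "\<dots> = ((\<kappa> z \<ominus> \<kappa> w) \<oplus> \<kappa> y) \<ominus> \<kappa> y" using k unfolding * by (simp add: minus_eq a_ac)
      also have "\<dots> = \<kappa> z \<ominus> \<kappa> w" using k by (simp add: cancel)
      finally show "\<kappa> x \<ominus> \<kappa> y = \<kappa> z \<ominus> \<kappa> w" .
    next
      assume *: "\<kappa> x \<ominus> \<kappa> y = \<kappa> z \<ominus> \<kappa> w"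
      have "\<kappa> x \<oplus> \<kappa> w = ((\<kappa> x \<ominus> \<kappa> y) \<oplus> \<kappa> y) \<oplus> \<kappa> w" using k by (simp add: cancel)
      also have "\<dots> = ((\<kappa> z \<ominus> \<kappa> w) \<oplus> \<kappa> w) \<oplus> \<kappa> y" using k unfolding * by (simp add: a_ac)
      also have "\<dots> = \<kappa> z \<oplus> \<kappa> y" using k by (simp add: cancel)
      finally show "\<kappa> x \<oplus> \<kappa> w = \<kappa> z \<oplus> \<kappa> y" .
    qed
    finally show ?thesis .
  qed
  show ?thesis unfolding grothendieck_rel_def using eq one_mem by auto
qed

definition cls :: "'a \<Rightarrow> 'a \<Rightarrow> ('a \<times> 'a) set"
  where "cls x y = grothendieck_rel S `` {(x, y)}"

lemma cls_eq: "cls x y = {(z, w). {x, y, z, w} \<subseteq> carrier S \<and> \<kappa> x \<ominus> \<kappa> y = \<kappa> z \<ominus> \<kappa> w}"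
  unfolding cls_def using rel_iff by auto

lemma cls_eq_iff:
  assumes "x \<in> carrier S" "y \<in> carrier S" "z \<in> carrier S" "w \<in> carrier S"
  shows "cls x y = cls z w \<longleftrightarrow> \<kappa> x \<ominus> \<kappa> y = \<kappa> z \<ominus> \<kappa> w"
  using assms unfolding cls_eq by auto

abbreviation "G \<equiv> grothendieck_group S"

lemma carrier_G: "carrier G = {cls x y | x y. x \<in> carrier S \<and> y \<in> carrier S}"
  by (auto simp: grothendieck_group_def quotient_def cls_def)

lemma one_G: "\<one>\<^bsub>G\<^esub> = cls \<one>\<^bsub>S\<^esub> \<one>\<^bsub>S\<^esub>"
  by (simp add: grothendieck_group_def cls_def)

lemma class_eq: "grothendieck_class S x = cls x \<one>\<^bsub>S\<^esub>"
  by (simp add: grothendieck_class_def cls_def)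

text \<open>On the class of a pair, the value does not depend on the representative; \<open>THE\<close> is meaningless on other sets.\<close>

definition \<Phi> :: "('a \<times> 'a) set \<Rightarrow> 'c"
  where "\<Phi> X = (THE c. \<exists>x y. (x, y) \<in> X \<and> c = \<kappa> x \<ominus> \<kappa> y)"

lemma \<Phi>_cls: "\<Phi> (cls x y) = \<kappa> x \<ominus> \<kappa> y" if "x \<in> carrier S" "y \<in> carrier S"
  unfolding \<Phi>_def by (rule the_equality) (use that in \<open>auto simp: cls_eq\<close>)

text \<open>The product is a union over all pairs of representatives. All members of this union are
  the same class, because the difference of \<kappa>-values is additive, and the index sets are
  nonempty.\<close>

lemma mult_cls:
  assumes c: "x \<in> carrier S" "y \<in> carrier S" "z \<in> carrier S" "w \<in> carrier S"
  shows "cls x y \<otimes>\<^bsub>G\<^esub> cls z w = cls (x \<otimes>\<^bsub>S\<^esub> z) (y \<otimes>\<^bsub>S\<^esub> w)"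
proof -
  have diff: "\<kappa> (x \<otimes>\<^bsub>S\<^esub> z) \<ominus> \<kappa> (y \<otimes>\<^bsub>S\<^esub> w) = (\<kappa> x \<ominus> \<kappa> y) \<oplus> (\<kappa> z \<ominus> \<kappa> w)"
    if "x \<in> carrier S" "y \<in> carrier S" "z \<in> carrier S" "w \<in> carrier S" for x y z w
    using that by (simp add: \<kappa>_mult \<kappa>_mem minus_eq minus_add a_ac)
  let ?C = "cls (x \<otimes>\<^bsub>S\<^esub> z) (y \<otimes>\<^bsub>S\<^esub> w)"
  have const: "cls (x' \<otimes>\<^bsub>S\<^esub> z') (y' \<otimes>\<^bsub>S\<^esub> w') = ?C"
    if "(x', y') \<in> cls x y" "(z', w') \<in> cls z w" for x' y' z' w'
    using that c by (subst cls_eq_iff) (auto simp: cls_eq mult_mem diff)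
  have ne: "cls x y \<noteq> {}" "cls z w \<noteq> {}" using c by (auto simp: cls_eq)
  have "(\<Union>(z', w')\<in>cls z w. cls (x' \<otimes>\<^bsub>S\<^esub> z') (y' \<otimes>\<^bsub>S\<^esub> w')) = ?C"
    if "(x', y') \<in> cls x y" for x' y'
  proof (rule SUP_eq_const[OF ne(2)])
    fix i assume "i \<in> cls z w"
    then show "(case i of (z', w') \<Rightarrow> cls (x' \<otimes>\<^bsub>S\<^esub> z') (y' \<otimes>\<^bsub>S\<^esub> w')) = ?C"
      by (cases i) (simp add: const[OF that])
  qed
  note inner = this
  have "(\<Union>(x', y')\<in>cls x y. \<Union>(z', w')\<in>cls z w. cls (x' \<otimes>\<^bsub>S\<^esub> z') (y' \<otimes>\<^bsub>S\<^esub> w')) = ?C"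
  proof (rule SUP_eq_const[OF ne(1)])
    fix i assume "i \<in> cls x y"
    then show "(case i of (x', y') \<Rightarrow> \<Union>(z', w')\<in>cls z w. cls (x' \<otimes>\<^bsub>S\<^esub> z') (y' \<otimes>\<^bsub>S\<^esub> w')) = ?C"
      by (cases i) (simp only: prod.case inner)
  qed
  moreover have "cls x y \<otimes>\<^bsub>G\<^esub> cls z w =
      (\<Union>(x', y')\<in>cls x y. \<Union>(z', w')\<in>cls z w. cls (x' \<otimes>\<^bsub>S\<^esub> z') (y' \<otimes>\<^bsub>S\<^esub> w'))"
    by (simp add: grothendieck_group_def cls_def)
  ultimately show ?thesis by simp
qed

lemma \<Phi>_class: "\<Phi> (grothendieck_class S x) = \<kappa> x" if "x \<in> carrier S"
  using that by (simp add: class_eq \<Phi>_cls one_mem \<kappa>_one \<kappa>_mem minus_eq)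

lemma \<Phi>_mult:
  assumes "X \<in> carrier G" "Y \<in> carrier G"
  shows "\<Phi> (X \<otimes>\<^bsub>G\<^esub> Y) = \<Phi> X \<oplus> \<Phi> Y"
proof -
  obtain x y z w where c: "x \<in> carrier S" "y \<in> carrier S" "z \<in> carrier S" "w \<in> carrier S"
    and XY: "X = cls x y" "Y = cls z w"
    using assms unfolding carrier_G by blast
  have "\<Phi> (X \<otimes>\<^bsub>G\<^esub> Y) = (\<kappa> x \<oplus> \<kappa> z) \<ominus> (\<kappa> y \<oplus> \<kappa> w)"
    using c by (simp add: XY mult_cls \<Phi>_cls mult_mem \<kappa>_mult)
  also have "\<dots> = (\<kappa> x \<ominus> \<kappa> y) \<oplus> (\<kappa> z \<ominus> \<kappa> w)"
    using c by (simp add: \<kappa>_mem minus_eq minus_add a_ac)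
  finally show ?thesis using c by (simp add: XY \<Phi>_cls)
qed

lemma mult_G_mem:
  assumes "X \<in> carrier G" "Y \<in> carrier G"
  shows "X \<otimes>\<^bsub>G\<^esub> Y \<in> carrier G"
proof -
  obtain x y z w where c: "x \<in> carrier S" "y \<in> carrier S" "z \<in> carrier S" "w \<in> carrier S"
    and XY: "X = cls x y" "Y = cls z w"
    using assms unfolding carrier_G by blast
  show ?thesis unfolding XY mult_cls[OF c] carrier_G using c mult_mem by blast
qed

lemma \<Phi>_bij: "bij_betw \<Phi> (carrier G) (carrier A)"
proof (rule bij_betw_imageI)
  show "inj_on \<Phi> (carrier G)" by (rule inj_onI) (clarsimp simp: carrier_G \<Phi>_cls cls_eq_iff)
  show "\<Phi> ` carrier G = carrier A"
  proof
    show "\<Phi> ` carrier G \<subseteq> carrier A" by (auto simp: carrier_G \<Phi>_cls \<kappa>_mem)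
    show "carrier A \<subseteq> \<Phi> ` carrier G"
    proof
      fix c assume "c \<in> carrier A"
      then obtain x y where "x \<in> carrier S" "y \<in> carrier S" "c = \<kappa> x \<ominus> \<kappa> y" using \<kappa>_diff by blast
      then show "c \<in> \<Phi> ` carrier G"
        by (intro image_eqI[of _ _ "cls x y"]) (auto simp: \<Phi>_cls carrier_G)
    qed
  qed
qed

lemma class_mem: "grothendieck_class S x \<in> carrier G" if "x \<in> carrier S"
  using that one_mem by (auto simp: class_eq carrier_G)

lemma one_G_mem: "\<one>\<^bsub>G\<^esub> \<in> carrier G"
  using one_mem by (auto simp: one_G carrier_G)

lemma \<Phi>_one: "\<Phi> \<one>\<^bsub>G\<^esub> = \<zero>"
  by (simp add: one_G \<Phi>_cls one_mem \<kappa>_one minus_eq)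

lemma \<Phi>_mem: "X \<in> carrier G \<Longrightarrow> \<Phi> X \<in> carrier A"
  using \<Phi>_bij bij_betwE by blast

lemma \<Phi>_eq_iff: "X \<in> carrier G \<Longrightarrow> Y \<in> carrier G \<Longrightarrow> \<Phi> X = \<Phi> Y \<longleftrightarrow> X = Y"
  using \<Phi>_bij by (metis bij_betw_def inj_on_eq_iff)

lemma \<Phi>_iso: "\<Phi> \<in> iso G (add_monoid A)"
  using \<Phi>_bij unfolding iso_def hom_def by (simp add: \<Phi>_mult \<Phi>_mem Pi_iff)

text \<open>For the class of a pair \<open>(x, y)\<close> this says that it is the class of
  \<open>x\<close> minus the class of \<open>y\<close>, written without inverses. It extends facts
  about classes of modules to the whole group by cancellation.\<close>

lemma generated:
  assumes "X \<in> carrier G"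
  shows "\<exists>x\<in>carrier S. \<exists>y\<in>carrier S. X \<otimes>\<^bsub>G\<^esub> grothendieck_class S y = grothendieck_class S x"
proof -
  obtain x y where xy: "x \<in> carrier S" "y \<in> carrier S" "X = cls x y"
    using assms by (auto simp: carrier_G)
  have "\<Phi> (X \<otimes>\<^bsub>G\<^esub> grothendieck_class S y) = \<Phi> (grothendieck_class S x)"
    using xy assms by (simp add: \<Phi>_mult class_mem \<Phi>_class \<Phi>_cls minus_eq a_assoc \<kappa>_mem l_neg)
  then show ?thesis using xy assms by (auto simp: \<Phi>_eq_iff mult_G_mem class_mem)
qed

end

section \<open>Coordinates in vector spaces\<close>

text \<open>A linear isomorphism onto the coordinate space over \<open>I\<close>. Functions in the
  target are fixed to \<open>undefined\<close> outside \<open>I\<close>, which is what makes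
  bijectivity possible.\<close>

definition coords :: "('k, 'x) ring_scheme \<Rightarrow> ('k, 'v, 'y) module_scheme \<Rightarrow> 'i set \<Rightarrow> ('v \<Rightarrow> 'i \<Rightarrow> 'k) \<Rightarrow> bool"
  where "coords K V I \<chi> \<longleftrightarrow> bij_betw \<chi> (carrier V) (I \<rightarrow>\<^sub>E carrier K) \<and>
    (\<forall>x\<in>carrier V. \<forall>y\<in>carrier V. \<chi> (x \<oplus>\<^bsub>V\<^esub> y) = (\<lambda>i\<in>I. \<chi> x i \<oplus>\<^bsub>K\<^esub> \<chi> y i)) \<and>
    (\<forall>c\<in>carrier K. \<forall>x\<in>carrier V. \<chi> (c \<odot>\<^bsub>V\<^esub> x) = (\<lambda>i\<in>I. c \<otimes>\<^bsub>K\<^esub> \<chi> x i))"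

lemma coords_reindex:
  assumes \<chi>: "coords K V I \<chi>" and \<pi>: "bij_betw \<pi> J I"
  shows "coords K V J (\<lambda>x. \<lambda>j\<in>J. \<chi> x (\<pi> j))"
proof -
  let ?g = "\<lambda>c. \<lambda>j\<in>J. c (\<pi> j)" and ?g' = "\<lambda>c. \<lambda>i\<in>I. c (inv_into J \<pi> i)"
  have \<pi>I: "\<pi> j \<in> I" "inv_into J \<pi> (\<pi> j) = j" if "j \<in> J" for j
    using \<pi> that by (auto simp: bij_betw_def)
  have \<pi>J: "inv_into J \<pi> i \<in> J" "\<pi> (inv_into J \<pi> i) = i" if "i \<in> I" for i
    using \<pi> that by (auto simp: bij_betw_def inv_into_into f_inv_into_f)
  have "bij_betw ?g (I \<rightarrow>\<^sub>E carrier K) (J \<rightarrow>\<^sub>E carrier K)"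
    by (rule bij_betw_byWitness[where f' = ?g'])
      (auto simp: \<pi>I \<pi>J PiE_iff extensional_def fun_eq_iff)
  then have "bij_betw (?g \<circ> \<chi>) (carrier V) (J \<rightarrow>\<^sub>E carrier K)"
    using \<chi> unfolding coords_def by (blast intro: bij_betw_trans)
  then show ?thesis using \<chi> \<pi>I unfolding coords_def by (auto simp: o_def fun_eq_iff)
qed

lemma coords_bij:
  assumes \<chi>: "coords K V I \<chi>" and f: "bij_betw f (carrier W) (carrier V)"
    and "\<And>x y. x \<in> carrier W \<Longrightarrow> y \<in> carrier W \<Longrightarrow> f (x \<oplus>\<^bsub>W\<^esub> y) = f x \<oplus>\<^bsub>V\<^esub> f y"
    and "\<And>c x. c \<in> carrier K \<Longrightarrow> x \<in> carrier W \<Longrightarrow> f (c \<odot>\<^bsub>W\<^esub> x) = c \<odot>\<^bsub>V\<^esub> f x"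
  shows "coords K W I (\<chi> \<circ> f)"
  using assms bij_betw_trans[OF f, of \<chi>] bij_betwE[OF f] unfolding coords_def by auto

context vectorspace
begin

text \<open>The preimages of the unit vectors form a basis. Dimensions are computed below by
  exhibiting coordinates instead of bases.\<close>

lemma coords_basis:
  assumes "finite I" and \<chi>: "coords K V I \<chi>"
  shows "fin_dim" "dim = card I"
proof -
  define \<psi> where "\<psi> = inv_into (carrier V) \<chi>"
  have bij: "bij_betw \<chi> (carrier V) (I \<rightarrow>\<^sub>E carrier K)" using \<chi> by (simp add: coords_def)
  have \<psi>: "\<psi> c \<in> carrier V" "\<chi> (\<psi> c) = c" if "c \<in> I \<rightarrow>\<^sub>E carrier K" for c
    using bij that unfolding \<psi>_def bij_betw_def by (auto simp: inv_into_into f_inv_into_f)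
  have \<chi>E: "\<chi> x \<in> I \<rightarrow>\<^sub>E carrier K" "\<psi> (\<chi> x) = x" if "x \<in> carrier V" for x
    using bij that unfolding \<psi>_def bij_betw_def by auto
  have eqI: "x = y" if "x \<in> carrier V" "y \<in> carrier V" "\<chi> x = \<chi> y" for x y
    using that \<chi>E(2) by metis
  have add: "\<chi> (x \<oplus>\<^bsub>V\<^esub> y) = (\<lambda>i\<in>I. \<chi> x i \<oplus>\<^bsub>K\<^esub> \<chi> y i)" if "x \<in> carrier V" "y \<in> carrier V" for x y
    using \<chi> that by (simp add: coords_def)
  have smult: "\<chi> (c \<odot>\<^bsub>V\<^esub> x) = (\<lambda>i\<in>I. c \<otimes>\<^bsub>K\<^esub> \<chi> x i)" if "c \<in> carrier K" "x \<in> carrier V" for c x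
    using \<chi> that by (simp add: coords_def)
  have zero: "\<chi> \<zero>\<^bsub>V\<^esub> = (\<lambda>i\<in>I. \<zero>\<^bsub>K\<^esub>)"
  proof -
    have "\<chi> \<zero>\<^bsub>V\<^esub> = \<chi> (\<zero>\<^bsub>K\<^esub> \<odot>\<^bsub>V\<^esub> \<zero>\<^bsub>V\<^esub>)" by simp
    also have "\<dots> = (\<lambda>i\<in>I. \<zero>\<^bsub>K\<^esub> \<otimes>\<^bsub>K\<^esub> \<chi> \<zero>\<^bsub>V\<^esub> i)" by (rule smult) simp_all
    also have "\<dots> = (\<lambda>i\<in>I. \<zero>\<^bsub>K\<^esub>)"
      using \<chi>E(1)[of "\<zero>\<^bsub>V\<^esub>"] by (intro restrict_ext) (auto simp: PiE_iff)
    finally show ?thesis .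
  qed
  \<comment> \<open>The vector whose coordinates are those of the \<open>i\<close>-th unit
    vector.\<close>
  define e where "e i = \<psi> (\<lambda>j\<in>I. if j = i then \<one>\<^bsub>K\<^esub> else \<zero>\<^bsub>K\<^esub>)" for i
  have e: "e i \<in> carrier V" "\<chi> (e i) = (\<lambda>j\<in>I. if j = i then \<one>\<^bsub>K\<^esub> else \<zero>\<^bsub>K\<^esub>)" for i
    unfolding e_def by (rule \<psi>, simp)+
  have inj: "inj_on e I"
  proof (rule inj_onI)
    fix i j assume ij: "i \<in> I" "j \<in> I" "e i = e j"
    then have "(\<lambda>l\<in>I. if l = i then \<one>\<^bsub>K\<^esub> else \<zero>\<^bsub>K\<^esub>) = (\<lambda>l\<in>I. if l = j then \<one>\<^bsub>K\<^esub> else \<zero>\<^bsub>K\<^esub>)"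
      using e(2)[of i] e(2)[of j] by simp
    from fun_cong[OF this, of i] show "i = j" using ij by (auto split: if_splits)
  qed
  have sum: "\<chi> (\<Oplus>\<^bsub>V\<^esub>i\<in>J. c i \<odot>\<^bsub>V\<^esub> e i) = (\<lambda>i\<in>I. if i \<in> J then c i else \<zero>\<^bsub>K\<^esub>)"
    if "finite J" "J \<subseteq> I" "c \<in> I \<rightarrow> carrier K" for J c
    using that
  proof (induction J)
    case empty
    then show ?case by (simp add: zero)
  next
    case (insert j J)
    have c: "c j \<in> carrier K" "c \<in> J \<rightarrow> carrier K" using insert by auto
    have "\<chi> (\<Oplus>\<^bsub>V\<^esub>i\<in>insert j J. c i \<odot>\<^bsub>V\<^esub> e i) = \<chi> (c j \<odot>\<^bsub>V\<^esub> e j \<oplus>\<^bsub>V\<^esub> (\<Oplus>\<^bsub>V\<^esub>i\<in>J. c i \<odot>\<^bsub>V\<^esub> e i))"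
      using insert.hyps c e(1) by (subst M.finsum_insert) auto
    also have "\<dots> = (\<lambda>i\<in>I. (if i = j then c j else \<zero>\<^bsub>K\<^esub>) \<oplus>\<^bsub>K\<^esub> (if i \<in> J then c i else \<zero>\<^bsub>K\<^esub>))"
      using insert c e by (subst add) (auto simp: smult intro!: M.finsum_closed restrict_ext)
    also have "\<dots> = (\<lambda>i\<in>I. if i \<in> insert j J then c i else \<zero>\<^bsub>K\<^esub>)"
      using insert.hyps insert.prems c by (intro restrict_ext) (auto simp: Pi_iff)
    finally show ?case .
  qed
  have lin: "lincomb a (e ` I) = (\<Oplus>\<^bsub>V\<^esub>i\<in>I. a (e i) \<odot>\<^bsub>V\<^esub> e i)" if "a \<in> e ` I \<rightarrow> carrier K" for a
    unfolding lincomb_def using that e inj by (subst M.finsum_reindex) auto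
  have \<chi>lin: "\<chi> (lincomb a (e ` I)) = (\<lambda>i\<in>I. a (e i))" if "a \<in> e ` I \<rightarrow> carrier K" for a
    unfolding lin[OF that] using that assms by (subst sum) (auto intro!: restrict_ext)
  have "basis (e ` I)"
    unfolding basis_criterion[OF finite_imageI[OF \<open>finite I\<close>] image_subsetI[OF e(1)]]
  proof (intro allI impI)
    fix v assume v: "v \<in> carrier V"
    let ?a = "\<lambda>x\<in>e ` I. \<chi> v (inv_into I e x)"
    have aE: "?a \<in> e ` I \<rightarrow>\<^sub>E carrier K" using \<chi>E(1)[OF v] inj by (auto simp: inv_into_f_f)
    have lv: "lincomb ?a (e ` I) = v"
    proof (rule eqI)
      show "lincomb ?a (e ` I) \<in> carrier V" using aE e(1) by (intro lincomb_closed) auto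
      show "\<chi> (lincomb ?a (e ` I)) = \<chi> v"
        using aE inj \<chi>E(1)[OF v] by (subst \<chi>lin) (auto simp: PiE_iff extensional_def fun_eq_iff)
    qed (rule v)
    have uni: "b = ?a" if "b \<in> e ` I \<rightarrow>\<^sub>E carrier K" "lincomb b (e ` I) = v" for b
    proof
      fix x
      show "b x = ?a x"
      proof (cases "x \<in> e ` I")
        case True
        then obtain i where i: "i \<in> I" "x = e i" by auto
        have "\<chi> (lincomb b (e ` I)) i = \<chi> (lincomb ?a (e ` I)) i" using that lv by simp
        moreover have "b \<in> e ` I \<rightarrow> carrier K" "?a \<in> e ` I \<rightarrow> carrier K" using that(1) aE by auto
        ultimately show ?thesis using i by (simp add: \<chi>lin)
      qed (use that(1) in \<open>auto simp: PiE_iff extensional_def\<close>)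
    qed
    show "\<exists>!a. a \<in> e ` I \<rightarrow>\<^sub>E carrier K \<and> lincomb a (e ` I) = v"
    proof (rule ex1I[of _ ?a])
      show "?a \<in> e ` I \<rightarrow>\<^sub>E carrier K \<and> lincomb ?a (e ` I) = v" using aE lv by (rule conjI)
    qed (elim conjE, rule uni)
  qed
  then show "fin_dim" "dim = card I"
    using dim_basis[of "e ` I"] \<open>finite I\<close> inj by (auto simp: card_image basis_def fin_dim_def)
qed

text \<open>The coefficients with respect to a basis, renumbered so that the index set depends on
  the dimension alone. The numbering by naturals is used later to place modules of any type inside
  one type.\<close>

lemma coords_exists:
  assumes fin_dim
  shows "\<exists>\<chi>. coords K V {..<dim} \<chi>"
proof -
  obtain B where B: "finite B" "basis B" using finite_basis_exists[OF assms] by auto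
  then have BV: "B \<subseteq> carrier V" by (simp add: basis_def)
  have ex1: "\<exists>!a. a \<in> B \<rightarrow>\<^sub>E carrier K \<and> lincomb a B = v" if "v \<in> carrier V" for v
    using B that basis_criterion[OF B(1) BV] by auto
  define \<chi> where "\<chi> v = (THE a. a \<in> B \<rightarrow>\<^sub>E carrier K \<and> lincomb a B = v)" for v
  have \<chi>: "\<chi> v \<in> B \<rightarrow>\<^sub>E carrier K" "lincomb (\<chi> v) B = v" if "v \<in> carrier V" for v
    using theI'[OF ex1[OF that]] unfolding \<chi>_def by auto
  have uni: "\<chi> v = a" if "v \<in> carrier V" "a \<in> B \<rightarrow>\<^sub>E carrier K" "lincomb a B = v" for v a
    using ex1[OF that(1)] \<chi>[OF that(1)] that by blast
  have Pi: "a \<in> B \<rightarrow> carrier K" if "a \<in> B \<rightarrow>\<^sub>E carrier K" for a using that by auto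
  have restr: "lincomb (restrict a B) B = lincomb a B" if "a \<in> B \<rightarrow> carrier K" for a
    using that BV by (intro lincomb_cong) auto
  have "coords K V B \<chi>"
    unfolding coords_def
  proof (intro conjI ballI)
    show "bij_betw \<chi> (carrier V) (B \<rightarrow>\<^sub>E carrier K)"
    proof (rule bij_betw_byWitness[where f' = "\<lambda>a. lincomb a B"])
      show "(\<lambda>a. lincomb a B) ` (B \<rightarrow>\<^sub>E carrier K) \<subseteq> carrier V"
        using BV Pi by (intro image_subsetI lincomb_closed) auto
      then show "\<forall>a\<in>B \<rightarrow>\<^sub>E carrier K. \<chi> (lincomb a B) = a" using uni by auto
    qed (use \<chi> in auto)
    fix x y assume x: "x \<in> carrier V" and y: "y \<in> carrier V"
    show "\<chi> (x \<oplus>\<^bsub>V\<^esub> y) = (\<lambda>i\<in>B. \<chi> x i \<oplus>\<^bsub>K\<^esub> \<chi> y i)"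
    proof (rule uni)
      have "lincomb (\<lambda>v. \<chi> x v \<oplus>\<^bsub>K\<^esub> \<chi> y v) B = x \<oplus>\<^bsub>V\<^esub> y"
        using lincomb_sum[OF B(1) BV Pi[OF \<chi>(1)[OF x]] Pi[OF \<chi>(1)[OF y]]] \<chi>(2) x y by simp
      then show "lincomb (\<lambda>i\<in>B. \<chi> x i \<oplus>\<^bsub>K\<^esub> \<chi> y i) B = x \<oplus>\<^bsub>V\<^esub> y"
        using \<chi>(1)[OF x] \<chi>(1)[OF y] by (subst restr) (auto simp: PiE_iff)
    qed (use x y \<chi>(1)[OF x] \<chi>(1)[OF y] in \<open>auto simp: PiE_iff\<close>)
  next
    fix c x assume c: "c \<in> carrier K" and x: "x \<in> carrier V"
    show "\<chi> (c \<odot>\<^bsub>V\<^esub> x) = (\<lambda>i\<in>B. c \<otimes>\<^bsub>K\<^esub> \<chi> x i)"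
    proof (rule uni)
      have "lincomb (\<lambda>v. c \<otimes>\<^bsub>K\<^esub> \<chi> x v) B = c \<odot>\<^bsub>V\<^esub> x"
        using lincomb_smult[OF BV Pi[OF \<chi>(1)[OF x]] c] \<chi>(2)[OF x] by simp
      then show "lincomb (\<lambda>i\<in>B. c \<otimes>\<^bsub>K\<^esub> \<chi> x i) B = c \<odot>\<^bsub>V\<^esub> x"
        using c \<chi>(1)[OF x] by (subst restr) (auto simp: PiE_iff)
    qed (use c x \<chi>(1)[OF x] in \<open>auto simp: PiE_iff\<close>)
  qed
  moreover have "card {..<dim} = card B" using dim_basis[OF B] by simp
  then obtain \<pi> where "bij_betw \<pi> {..<dim} B" using B(1) by (metis finite_lessThan finite_same_card_bij)
  ultimately show ?thesis using coords_reindex by blast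
qed

text \<open>A lifted basis of the quotient of \<open>V\<close> by \<open>D\<close>, stated without
  forming the quotient: \<open>B\<close> generates modulo \<open>D\<close> and is independent modulo
  \<open>D\<close>.\<close>

lemma complement_exists:
  assumes fd: fin_dim and D: "subspace K D V"
  shows "\<exists>B. finite B \<and> B \<subseteq> carrier V \<and>
    (\<forall>x\<in>carrier V. \<exists>c\<in>B \<rightarrow> carrier K. \<exists>y\<in>D. x = lincomb c B \<oplus>\<^bsub>V\<^esub> y) \<and>
    (\<forall>c\<in>B \<rightarrow> carrier K. lincomb c B \<in> D \<longrightarrow> (\<forall>b\<in>B. c b = \<zero>\<^bsub>K\<^esub>))"
proof -
  have Dsub: "D \<subseteq> carrier V" and D0: "\<zero>\<^bsub>V\<^esub> \<in> D"
    and Dsm: "\<And>c x. c \<in> carrier K \<Longrightarrow> x \<in> D \<Longrightarrow> c \<odot>\<^bsub>V\<^esub> x \<in> D"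
    using D unfolding subspace_def submodule_def by auto
  \<comment> \<open>Independence modulo \<open>D\<close> implies independence because
    \<open>D\<close> contains zero, so such sets have at most \<open>dim\<close> elements and a
    maximal one exists.\<close>
  define P where "P B \<longleftrightarrow> finite B \<and> B \<subseteq> carrier V \<and>
    (\<forall>c\<in>B \<rightarrow> carrier K. lincomb c B \<in> D \<longrightarrow> (\<forall>b\<in>B. c b = \<zero>\<^bsub>K\<^esub>))" for B
  have "P {}" by (simp add: P_def)
  moreover have "finite B \<and> card B \<le> dim" if "P B" for B
  proof -
    have "lin_indpt B"
      by (rule finite_lin_indpt2) (use that D0 in \<open>auto simp: P_def\<close>)
    then show ?thesis using that li_le_dim[OF fd] by (auto simp: P_def)
  qed
  ultimately obtain B where "maximal B P" using maximal_exists[of P dim] by metis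
  then have B: "P B" and max: "\<And>B'. B \<subseteq> B' \<Longrightarrow> P B' \<Longrightarrow> B' = B"
    unfolding maximal_def by auto
  have BV: "finite B" "B \<subseteq> carrier V" using B by (auto simp: P_def)
  have "\<exists>c\<in>B \<rightarrow> carrier K. \<exists>y\<in>D. x = lincomb c B \<oplus>\<^bsub>V\<^esub> y" if x: "x \<in> carrier V" for x
  proof (rule ccontr)
    assume no: "\<not> ?thesis"
    have xB: "x \<notin> B"
    proof
      assume "x \<in> B"
      then have "lincomb (\<lambda>b. if b = x then \<one>\<^bsub>K\<^esub> else \<zero>\<^bsub>K\<^esub>) B = x"
      proof -
        have "lincomb (\<lambda>b. if b = x then \<one>\<^bsub>K\<^esub> else \<zero>\<^bsub>K\<^esub>) B = (\<Oplus>\<^bsub>V\<^esub>b\<in>B. if x = b then b else \<zero>\<^bsub>V\<^esub>)"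
          unfolding lincomb_def using BV by (intro M.finsum_cong') auto
        also have "\<dots> = x" using M.finsum_singleton[OF \<open>x \<in> B\<close> BV(1), of "\<lambda>b. b"] BV by auto
        finally show ?thesis .
      qed
      then have "x = lincomb (\<lambda>b. if b = x then \<one>\<^bsub>K\<^esub> else \<zero>\<^bsub>K\<^esub>) B \<oplus>\<^bsub>V\<^esub> \<zero>\<^bsub>V\<^esub>" using x by simp
      moreover have "(\<lambda>b. if b = x then \<one>\<^bsub>K\<^esub> else \<zero>\<^bsub>K\<^esub>) \<in> B \<rightarrow> carrier K" by auto
      ultimately show False using no D0 by blast
    qed
    have "P (insert x B)"
      unfolding P_def
    proof (intro conjI ballI impI)
      fix c b assume c: "c \<in> insert x B \<rightarrow> carrier K" and cD: "lincomb c (insert x B) \<in> D" and b: "b \<in> insert x B"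
      have cx: "c x \<in> carrier K" and cB: "c \<in> B \<rightarrow> carrier K" using c by auto
      have l: "lincomb c B \<in> carrier V" using BV cB by blast
      have eq: "lincomb c (insert x B) = c x \<odot>\<^bsub>V\<^esub> x \<oplus>\<^bsub>V\<^esub> lincomb c B"
        unfolding lincomb_def using BV xB cx cB x by (subst M.finsum_insert) auto
      have "c x = \<zero>\<^bsub>K\<^esub>"
      proof (rule ccontr)
        assume nz: "c x \<noteq> \<zero>\<^bsub>K\<^esub>"
        then have u: "inv\<^bsub>K\<^esub> (c x) \<in> carrier K" "inv\<^bsub>K\<^esub> (c x) \<otimes>\<^bsub>K\<^esub> c x = \<one>\<^bsub>K\<^esub>"
          using cx field_Units by auto
        \<comment> \<open>Dividing by the coefficient of \<open>x\<close> solves the relation for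
          \<open>x\<close> modulo \<open>D\<close>, against the choice of \<open>x\<close>.\<close>
        let ?i = "inv\<^bsub>K\<^esub> (c x)" and ?y = "lincomb c (insert x B)"
        have y: "?y \<in> carrier V" using cD Dsub by auto
        have "?i \<odot>\<^bsub>V\<^esub> ?y = x \<oplus>\<^bsub>V\<^esub> ?i \<odot>\<^bsub>V\<^esub> lincomb c B"
          unfolding eq using u cx x l by (simp add: smult_r_distr smult_assoc1[symmetric])
        moreover have "lincomb (\<lambda>b. \<ominus>\<^bsub>K\<^esub> ?i \<otimes>\<^bsub>K\<^esub> c b) B = \<ominus>\<^bsub>V\<^esub> (?i \<odot>\<^bsub>V\<^esub> lincomb c B)"
          using lincomb_smult[OF BV(2) cB, of "\<ominus>\<^bsub>K\<^esub> ?i"] u l by (simp add: smult_l_minus)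
        ultimately have "x = lincomb (\<lambda>b. \<ominus>\<^bsub>K\<^esub> ?i \<otimes>\<^bsub>K\<^esub> c b) B \<oplus>\<^bsub>V\<^esub> ?i \<odot>\<^bsub>V\<^esub> ?y"
          using u l x by (simp add: M.a_ac M.l_neg M.r_neg M.r_neg1 M.r_neg2)
        moreover have "(\<lambda>b. \<ominus>\<^bsub>K\<^esub> ?i \<otimes>\<^bsub>K\<^esub> c b) \<in> B \<rightarrow> carrier K" using cB u by auto
        moreover have "?i \<odot>\<^bsub>V\<^esub> ?y \<in> D" using Dsm u cD by blast
        ultimately show False using no by blast
      qed
      moreover from this have "lincomb c B \<in> D" using cD eq x l by simp
      then have "\<forall>b\<in>B. c b = \<zero>\<^bsub>K\<^esub>" using B cB by (auto simp: P_def)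
      ultimately show "c b = \<zero>\<^bsub>K\<^esub>" using b by auto
    qed (use BV x in auto)
    then show False using max[of "insert x B"] xB by auto
  qed
  with B show ?thesis by (auto simp: P_def)
qed

end

section \<open>Homogeneous components\<close>

text \<open>Each axiom holds after applying the injective \<open>f\<close>; negatives come from
  surjectivity. With \<open>f\<close> the identity, the lemma passes between records that agree in
  carrier, zero, addition and scalar action.\<close>

lemma module_transport:
  assumes M: "module R M" and f: "bij_betw f (carrier N) (carrier M)"
    and z: "\<zero>\<^bsub>N\<^esub> \<in> carrier N" "f \<zero>\<^bsub>N\<^esub> = \<zero>\<^bsub>M\<^esub>"
    and ac: "\<And>x y. x \<in> carrier N \<Longrightarrow> y \<in> carrier N \<Longrightarrow> x \<oplus>\<^bsub>N\<^esub> y \<in> carrier N"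
    and a: "\<And>x y. x \<in> carrier N \<Longrightarrow> y \<in> carrier N \<Longrightarrow> f (x \<oplus>\<^bsub>N\<^esub> y) = f x \<oplus>\<^bsub>M\<^esub> f y"
    and sc: "\<And>r x. r \<in> carrier R \<Longrightarrow> x \<in> carrier N \<Longrightarrow> r \<odot>\<^bsub>N\<^esub> x \<in> carrier N"
    and s: "\<And>r x. r \<in> carrier R \<Longrightarrow> x \<in> carrier N \<Longrightarrow> f (r \<odot>\<^bsub>N\<^esub> x) = r \<odot>\<^bsub>M\<^esub> f x"
  shows "module R N"
proof -
  interpret M: module R M by fact
  have fc [simp]: "f x \<in> carrier M" if "x \<in> carrier N" for x using f that by (auto simp: bij_betw_def)
  have eqI: "x = y" if "f x = f y" "x \<in> carrier N" "y \<in> carrier N" for x y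
    using f that by (auto simp: bij_betw_def inj_on_def)
  show ?thesis
  proof (rule moduleI)
    show "abelian_group N"
    proof (rule abelian_groupI)
      fix x assume x: "x \<in> carrier N"
      have "\<ominus>\<^bsub>M\<^esub> f x \<in> f ` carrier N" using f x by (auto simp: bij_betw_def)
      then obtain y where "y \<in> carrier N" "f y = \<ominus>\<^bsub>M\<^esub> f x" by auto
      then show "\<exists>y\<in>carrier N. y \<oplus>\<^bsub>N\<^esub> x = \<zero>\<^bsub>N\<^esub>"
        using x z by (intro bexI[of _ y] eqI) (auto simp: a ac M.l_neg)
    qed (auto intro!: eqI simp: z ac a M.a_ac)
  qed (auto intro!: eqI simp: z ac a s sc M.smult_l_distr M.smult_r_distr M.smult_assoc1 M.R.is_cring)
qed

lemma hom_finsum: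
  assumes "module R M" "module R N" "f \<in> module_hom R M N" "g \<in> A \<rightarrow> carrier M"
  shows "f (finsum M g A) = finsum N (\<lambda>a. f (g a)) A"
proof -
  interpret mod_hom R M N f using assms by (auto simp: mod_hom_def mod_hom_axioms_def)
  show ?thesis using assms(4)
    by (induction A rule: infinite_finite_induct) (auto simp: Pi_iff)
qed

lemma finsum_cong_record:
  assumes "carrier M = carrier N" "\<zero>\<^bsub>M\<^esub> = \<zero>\<^bsub>N\<^esub>" "add M = add N"
  shows "finsum M = finsum N"
  using assms by (intro ext) (simp add: finsum_def finprod_def)

lemma module_homI:
  assumes "\<And>x. x \<in> carrier M \<Longrightarrow> f x \<in> carrier N"
    "\<And>x y. x \<in> carrier M \<Longrightarrow> y \<in> carrier M \<Longrightarrow> f (x \<oplus>\<^bsub>M\<^esub> y) = f x \<oplus>\<^bsub>N\<^esub> f y"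
    "\<And>r x. r \<in> carrier R \<Longrightarrow> x \<in> carrier M \<Longrightarrow> f (r \<odot>\<^bsub>M\<^esub> x) = r \<odot>\<^bsub>N\<^esub> f x"
  shows "f \<in> module_hom R M N"
  using assms by (auto simp: module_hom_def)

lemma module_hom_inv:
  assumes M: "module R M" and f: "f \<in> module_hom R M N" "bij_betw f (carrier M) (carrier N)"
  shows "inv_into (carrier M) f \<in> module_hom R N M"
proof (rule module_homI)
  interpret module R M by fact
  let ?f = "inv_into (carrier M) f"
  have im: "f ` carrier M = carrier N" and inj: "inj_on f (carrier M)" using f(2) by (auto simp: bij_betw_def)
  have i: "?f y \<in> carrier M" "f (?f y) = y" if "y \<in> carrier N" for y
    using that im by (auto simp: inv_into_into f_inv_into_f)
  fix x y assume xy: "x \<in> carrier N" "y \<in> carrier N"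
  show "?f x \<in> carrier M" using i xy by auto
  have "f (?f x \<oplus>\<^bsub>M\<^esub> ?f y) = x \<oplus>\<^bsub>N\<^esub> y" using module_hom_add[OF f(1)] i xy by auto
  then show "?f (x \<oplus>\<^bsub>N\<^esub> y) = ?f x \<oplus>\<^bsub>M\<^esub> ?f y"
    using i xy inj by (intro inv_into_f_eq) auto
next
  interpret module R M by fact
  let ?f = "inv_into (carrier M) f"
  fix r x assume rx: "r \<in> carrier R" "x \<in> carrier N"
  have i: "?f x \<in> carrier M" "f (?f x) = x"
    using f(2) rx by (auto simp: bij_betw_def inv_into_into f_inv_into_f)
  have "f (r \<odot>\<^bsub>M\<^esub> ?f x) = r \<odot>\<^bsub>N\<^esub> x" using module_hom_smult[OF f(1)] i rx by auto
  then show "?f (r \<odot>\<^bsub>N\<^esub> x) = r \<odot>\<^bsub>M\<^esub> ?f x"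
    using i rx f(2) by (intro inv_into_f_eq) (auto simp: bij_betw_def)
qed

text \<open>The homogeneous components of \<open>x\<close>. The description is determinate when
  \<open>M\<close> is graded and \<open>x\<close> lies in its carrier.\<close>

definition hcomp :: "('r, 'm, 'g) graded_module \<Rightarrow> 'm \<Rightarrow> 'g \<Rightarrow> 'm"
  where "hcomp M x = (THE f. (\<forall>g. f g \<in> gcomp M g) \<and> finite {g. f g \<noteq> \<zero>\<^bsub>M\<^esub>} \<and>
    x = finsum M f {g. f g \<noteq> \<zero>\<^bsub>M\<^esub>})"

locale pdcf_algebra =
  fixes k :: "'k ring" and R :: "('k, 'r, 'g::ab_group_add) graded_module"
  assumes field_k: "field k"
    and graded_algebra: "is_graded_algebra k R"
    and domain_R: "domain R"
    and pdcf: "pdcf k R"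
begin

lemma algebra_R: "algebra k R" using graded_algebra by (simp add: is_graded_algebra_def)

sublocale k: field k by (rule field_k)
sublocale R: domain R by (rule domain_R)
sublocale kR: algebra k R by (rule algebra_R)

lemma cring_R: "cring R" by (rule R.is_cring)

definition \<iota> :: "'k \<Rightarrow> 'r" where "\<iota> c = c \<odot>\<^bsub>R\<^esub> \<one>\<^bsub>R\<^esub>"

lemma \<iota>_closed [simp]: "c \<in> carrier k \<Longrightarrow> \<iota> c \<in> carrier R"
  by (simp add: \<iota>_def)

lemma \<iota>_mult_left: "c \<in> carrier k \<Longrightarrow> x \<in> carrier R \<Longrightarrow> \<iota> c \<otimes>\<^bsub>R\<^esub> x = c \<odot>\<^bsub>R\<^esub> x"
  by (simp add: \<iota>_def kR.smult_assoc2)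

lemma \<iota>_add: "c \<in> carrier k \<Longrightarrow> d \<in> carrier k \<Longrightarrow> \<iota> (c \<oplus>\<^bsub>k\<^esub> d) = \<iota> c \<oplus>\<^bsub>R\<^esub> \<iota> d"
  by (simp add: \<iota>_def kR.smult_l_distr)

lemma \<iota>_mult: "c \<in> carrier k \<Longrightarrow> d \<in> carrier k \<Longrightarrow> \<iota> (c \<otimes>\<^bsub>k\<^esub> d) = \<iota> c \<otimes>\<^bsub>R\<^esub> \<iota> d"
  by (simp add: \<iota>_mult_left) (simp add: \<iota>_def kR.smult_assoc1)

lemma \<iota>_one [simp]: "\<iota> \<one>\<^bsub>k\<^esub> = \<one>\<^bsub>R\<^esub>" by (simp add: \<iota>_def)

lemma \<iota>_zero [simp]: "\<iota> \<zero>\<^bsub>k\<^esub> = \<zero>\<^bsub>R\<^esub>" by (simp add: \<iota>_def)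

section \<open>Graded modules and their components over the base field\<close>

lemma restrict_simps [simp]:
  "carrier (restrict_scalars R M) = carrier M"
  "add (restrict_scalars R M) = add M"
  "\<zero>\<^bsub>restrict_scalars R M\<^esub> = \<zero>\<^bsub>M\<^esub>"
  "smult (restrict_scalars R M) c x = \<iota> c \<odot>\<^bsub>M\<^esub> x"
  by (simp_all add: restrict_scalars_def \<iota>_def)

lemma finsum_restrict_scalars [simp]: "finsum (restrict_scalars R M) = finsum M"
  by (rule finsum_cong_record) simp_all

lemma restrict_vectorspace: "vectorspace k (restrict_scalars R M)" if "module R M"
proof -
  interpret M: module R M by fact
  have "module k (restrict_scalars R M)"
  proof (rule moduleI)
    show "abelian_group (restrict_scalars R M)"
      by (rule abelian_groupI) (auto simp: M.a_ac intro: M.l_neg M.a_inv_closed)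
  qed (auto simp: \<iota>_add \<iota>_mult M.smult_l_distr M.smult_r_distr M.smult_assoc1 k.is_cring)
  then show ?thesis by (simp add: vectorspace_def field_k)
qed

lemma restrict_subspace_iff:
  assumes "module R M"
  shows "subspace k W (restrict_scalars R M) \<longleftrightarrow> W \<subseteq> carrier M \<and> \<zero>\<^bsub>M\<^esub> \<in> W \<and>
    (\<forall>x\<in>W. \<forall>y\<in>W. x \<oplus>\<^bsub>M\<^esub> y \<in> W) \<and> (\<forall>c\<in>carrier k. \<forall>x\<in>W. \<iota> c \<odot>\<^bsub>M\<^esub> x \<in> W)"
  using restrict_vectorspace[OF assms]
  by (auto simp: subspace_def submodule_def vectorspace_def)

lemma graded_moduleI:
  assumes "module R M"
    and "\<And>g. gcomp M g \<subseteq> carrier M" "\<And>g. \<zero>\<^bsub>M\<^esub> \<in> gcomp M g"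
    and "\<And>g x y. x \<in> gcomp M g \<Longrightarrow> y \<in> gcomp M g \<Longrightarrow> x \<oplus>\<^bsub>M\<^esub> y \<in> gcomp M g"
    and "\<And>g c x. c \<in> carrier k \<Longrightarrow> x \<in> gcomp M g \<Longrightarrow> \<iota> c \<odot>\<^bsub>M\<^esub> x \<in> gcomp M g"
    and "\<And>x. x \<in> carrier M \<Longrightarrow> \<exists>!f. (\<forall>g. f g \<in> gcomp M g) \<and> finite {g. f g \<noteq> \<zero>\<^bsub>M\<^esub>} \<and>
        x = finsum M f {g. f g \<noteq> \<zero>\<^bsub>M\<^esub>}"
    and "\<And>g h r x. r \<in> gcomp R g \<Longrightarrow> x \<in> gcomp M h \<Longrightarrow> r \<odot>\<^bsub>M\<^esub> x \<in> gcomp M (g + h)"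
  shows "is_graded_module k R M"
  using assms unfolding is_graded_module_def is_grading_def by (simp add: restrict_subspace_iff)

lemma graded_moduleD:
  assumes "is_graded_module k R M"
  shows "module R M"
    and "x \<in> gcomp M g \<Longrightarrow> x \<in> carrier M" "\<zero>\<^bsub>M\<^esub> \<in> gcomp M g"
    and "x \<in> gcomp M g \<Longrightarrow> y \<in> gcomp M g \<Longrightarrow> x \<oplus>\<^bsub>M\<^esub> y \<in> gcomp M g"
    and "c \<in> carrier k \<Longrightarrow> x \<in> gcomp M g \<Longrightarrow> \<iota> c \<odot>\<^bsub>M\<^esub> x \<in> gcomp M g"
    and "x \<in> carrier M \<Longrightarrow> \<exists>!f. (\<forall>g. f g \<in> gcomp M g) \<and> finite {g. f g \<noteq> \<zero>\<^bsub>M\<^esub>} \<and>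
        x = finsum M f {g. f g \<noteq> \<zero>\<^bsub>M\<^esub>}"
    and "r \<in> gcomp R g \<Longrightarrow> x \<in> gcomp M h \<Longrightarrow> r \<odot>\<^bsub>M\<^esub> x \<in> gcomp M (g + h)"
proof -
  show m: "module R M" using assms by (simp add: is_graded_module_def)
  show "r \<in> gcomp R g \<Longrightarrow> x \<in> gcomp M h \<Longrightarrow> r \<odot>\<^bsub>M\<^esub> x \<in> gcomp M (g + h)"
    using assms by (auto simp: is_graded_module_def)
  show "x \<in> carrier M \<Longrightarrow> \<exists>!f. (\<forall>g. f g \<in> gcomp M g) \<and> finite {g. f g \<noteq> \<zero>\<^bsub>M\<^esub>} \<and>
        x = finsum M f {g. f g \<noteq> \<zero>\<^bsub>M\<^esub>}"
    using assms unfolding is_graded_module_def is_grading_def by simp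
  have "subspace k (gcomp M g) (restrict_scalars R M)" for g
    using assms unfolding is_graded_module_def is_grading_def by simp
  then have sub: "gcomp M g \<subseteq> carrier M \<and> \<zero>\<^bsub>M\<^esub> \<in> gcomp M g \<and>
    (\<forall>x\<in>gcomp M g. \<forall>y\<in>gcomp M g. x \<oplus>\<^bsub>M\<^esub> y \<in> gcomp M g) \<and>
    (\<forall>c\<in>carrier k. \<forall>x\<in>gcomp M g. \<iota> c \<odot>\<^bsub>M\<^esub> x \<in> gcomp M g)" for g
    using m by (simp add: restrict_subspace_iff)
  show "x \<in> gcomp M g \<Longrightarrow> x \<in> carrier M" "\<zero>\<^bsub>M\<^esub> \<in> gcomp M g"
    "x \<in> gcomp M g \<Longrightarrow> y \<in> gcomp M g \<Longrightarrow> x \<oplus>\<^bsub>M\<^esub> y \<in> gcomp M g"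
    "c \<in> carrier k \<Longrightarrow> x \<in> gcomp M g \<Longrightarrow> \<iota> c \<odot>\<^bsub>M\<^esub> x \<in> gcomp M g"
    using sub[of g] by blast+
qed

lemma gcomp_subspace: "is_graded_module k R M \<Longrightarrow> subspace k (gcomp M g) (restrict_scalars R M)"
  by (simp add: is_graded_module_def is_grading_def)

lemma component_vectorspace: "is_graded_module k R M \<Longrightarrow> vectorspace k (component_space R M g)"
  unfolding component_space_def
  by (rule vectorspace.subspace_is_vs[OF restrict_vectorspace gcomp_subspace]) (auto dest: graded_moduleD)

lemma component_simps [simp]:
  "carrier (component_space R M g) = gcomp M g"
  "add (component_space R M g) = add M"
  "\<zero>\<^bsub>component_space R M g\<^esub> = \<zero>\<^bsub>M\<^esub>"
  "smult (component_space R M g) c x = \<iota> c \<odot>\<^bsub>M\<^esub> x"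
  by (simp_all add: component_space_def)

lemma gcomp_finsum:
  assumes M: "is_graded_module k R M" and "\<And>i. i \<in> I \<Longrightarrow> f i \<in> gcomp M g"
  shows "finsum M f I \<in> gcomp M g"
proof -
  interpret M: module R M using graded_moduleD(1)[OF M] .
  show ?thesis using assms(2)
  proof (induction I rule: infinite_finite_induct)
    case (insert i I)
    have "f i \<in> carrier M" "f \<in> I \<rightarrow> carrier M"
      using graded_moduleD(2)[OF M insert.prems] by auto
    then show ?case using insert by (simp add: graded_moduleD(4)[OF M])
  qed (simp_all add: graded_moduleD(3)[OF M])
qed

lemma hcomp_props:
  assumes "is_graded_module k R M" "x \<in> carrier M"
  shows "hcomp M x g \<in> gcomp M g" "finite {g. hcomp M x g \<noteq> \<zero>\<^bsub>M\<^esub>}"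
    "x = finsum M (hcomp M x) {g. hcomp M x g \<noteq> \<zero>\<^bsub>M\<^esub>}"
proof -
  have *: "(\<forall>g. hcomp M x g \<in> gcomp M g) \<and> finite {g. hcomp M x g \<noteq> \<zero>\<^bsub>M\<^esub>} \<and>
      x = finsum M (hcomp M x) {g. hcomp M x g \<noteq> \<zero>\<^bsub>M\<^esub>}"
    unfolding hcomp_def by (rule theI'[OF graded_moduleD(6)[OF assms]])
  show "hcomp M x g \<in> gcomp M g" using * by (elim conjE spec)
  show "finite {g. hcomp M x g \<noteq> \<zero>\<^bsub>M\<^esub>}" using * by (elim conjE)
  show "x = finsum M (hcomp M x) {g. hcomp M x g \<noteq> \<zero>\<^bsub>M\<^esub>}" using * by (elim conjE)
qed

lemma hcomp_carrier [simp]: "is_graded_module k R M \<Longrightarrow> x \<in> carrier M \<Longrightarrow> hcomp M x g \<in> carrier M"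
  by (rule graded_moduleD(2)[OF _ hcomp_props(1)])

text \<open>Summands that vanish may be included in \<open>A\<close>. So to find all components it
  is enough to exhibit one homogeneous decomposition over a convenient finite set.\<close>

lemma hcomp_eqI:
  assumes M: "is_graded_module k R M" and A: "finite A" and f: "\<And>g. f g \<in> gcomp M g"
    and 0: "\<And>g. g \<notin> A \<Longrightarrow> f g = \<zero>\<^bsub>M\<^esub>" and x: "x = finsum M f A"
  shows "hcomp M x = f"
proof -
  interpret M: module R M using graded_moduleD(1)[OF M] .
  have fc: "f g \<in> carrier M" for g using graded_moduleD(2)[OF M f] .
  have xc: "x \<in> carrier M" unfolding x using fc by (intro M.finsum_closed) auto
  have sub: "{g. f g \<noteq> \<zero>\<^bsub>M\<^esub>} \<subseteq> A" using 0 by auto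
  have "x = finsum M f {g. f g \<noteq> \<zero>\<^bsub>M\<^esub>}"
    unfolding x by (rule M.add.finprod_mono_neutral_cong_right[OF A sub]) (use fc in auto)
  moreover have "finite {g. f g \<noteq> \<zero>\<^bsub>M\<^esub>}" using sub A finite_subset by blast
  ultimately show ?thesis
    using graded_moduleD(6)[OF M xc] hcomp_props[OF M xc] f by blast
qed

lemma hcomp_sum:
  assumes M: "is_graded_module k R M" and x: "x \<in> carrier M" and A: "finite A" "{g. hcomp M x g \<noteq> \<zero>\<^bsub>M\<^esub>} \<subseteq> A"
  shows "x = finsum M (hcomp M x) A"
proof -
  interpret M: module R M using graded_moduleD(1)[OF M] .
  have "finsum M (hcomp M x) {g. hcomp M x g \<noteq> \<zero>\<^bsub>M\<^esub>} = finsum M (hcomp M x) A"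
    by (rule M.add.finprod_mono_neutral_cong_left[OF A]) (use M x in auto)
  then show ?thesis using hcomp_props(3)[OF M x] by simp
qed

lemma hcomp_homogeneous:
  assumes M: "is_graded_module k R M" and x: "x \<in> gcomp M g"
  shows "hcomp M x = (\<lambda>h. if h = g then x else \<zero>\<^bsub>M\<^esub>)"
proof -
  interpret M: module R M using graded_moduleD(1)[OF M] .
  show ?thesis
    by (rule hcomp_eqI[OF M, of "{g}"])
      (use graded_moduleD(2)[OF M x] in \<open>auto simp: x graded_moduleD(3)[OF M]\<close>)
qed

lemma hcomp_hom:
  assumes M: "is_graded_module k R M" and N: "is_graded_module k R N"
    and f: "f \<in> module_hom R M N" "\<And>g x. x \<in> gcomp M g \<Longrightarrow> f x \<in> gcomp N g"
    and x: "x \<in> carrier M"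
  shows "hcomp N (f x) g = f (hcomp M x g)"
proof -
  have MN: "module R M" "module R N" using M N by (auto dest: graded_moduleD)
  interpret mod_hom R M N f using MN f by (auto simp: mod_hom_def mod_hom_axioms_def)
  have "hcomp N (f x) = (\<lambda>g. f (hcomp M x g))"
  proof (rule hcomp_eqI[OF N hcomp_props(2)[OF M x]])
    have "f x = f (finsum M (hcomp M x) {g. hcomp M x g \<noteq> \<zero>\<^bsub>M\<^esub>})"
      using hcomp_props(3)[OF M x] by simp
    also have "\<dots> = finsum N (\<lambda>g. f (hcomp M x g)) {g. hcomp M x g \<noteq> \<zero>\<^bsub>M\<^esub>}"
      by (rule hom_finsum[OF MN f(1)]) (use M x in auto)
    finally show "f x = finsum N (\<lambda>g. f (hcomp M x g)) {g. hcomp M x g \<noteq> \<zero>\<^bsub>M\<^esub>}" .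
  qed (use f(2) hcomp_props(1)[OF M x] in auto)
  then show ?thesis by simp
qed

lemma hcomp_add:
  assumes M: "is_graded_module k R M" and x: "x \<in> carrier M" and y: "y \<in> carrier M"
  shows "hcomp M (x \<oplus>\<^bsub>M\<^esub> y) g = hcomp M x g \<oplus>\<^bsub>M\<^esub> hcomp M y g"
proof -
  interpret M: module R M using graded_moduleD(1)[OF M] .
  let ?A = "{g. hcomp M x g \<noteq> \<zero>\<^bsub>M\<^esub>} \<union> {g. hcomp M y g \<noteq> \<zero>\<^bsub>M\<^esub>}"
  have A: "finite ?A" using hcomp_props(2)[OF M] x y by simp
  have "hcomp M (x \<oplus>\<^bsub>M\<^esub> y) = (\<lambda>g. hcomp M x g \<oplus>\<^bsub>M\<^esub> hcomp M y g)"
  proof (rule hcomp_eqI[OF M A])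
    have "x \<oplus>\<^bsub>M\<^esub> y = finsum M (hcomp M x) ?A \<oplus>\<^bsub>M\<^esub> finsum M (hcomp M y) ?A"
      using hcomp_sum[OF M x A] hcomp_sum[OF M y A] by auto
    also have "\<dots> = finsum M (\<lambda>g. hcomp M x g \<oplus>\<^bsub>M\<^esub> hcomp M y g) ?A"
      using M x y by (intro M.finsum_addf[symmetric]) auto
    finally show "x \<oplus>\<^bsub>M\<^esub> y = \<dots>" .
  qed (use M x y hcomp_props(1)[OF M] graded_moduleD(4)[OF M] in auto)
  then show ?thesis by simp
qed

lemma hcomp_smult:
  assumes M: "is_graded_module k R M" and x: "x \<in> carrier M" and r: "r \<in> gcomp R h" "r \<in> carrier R"
  shows "hcomp M (r \<odot>\<^bsub>M\<^esub> x) g = r \<odot>\<^bsub>M\<^esub> hcomp M x (g - h)"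
proof -
  interpret M: module R M using graded_moduleD(1)[OF M] .
  let ?A = "{g. hcomp M x g \<noteq> \<zero>\<^bsub>M\<^esub>}"
  have A: "finite ?A" using hcomp_props(2)[OF M] x by simp
  have "hcomp M (r \<odot>\<^bsub>M\<^esub> x) = (\<lambda>g. r \<odot>\<^bsub>M\<^esub> hcomp M x (g - h))"
  proof (rule hcomp_eqI[OF M])
    show "finite ((\<lambda>g. g + h) ` ?A)" using A by simp
    show "r \<odot>\<^bsub>M\<^esub> hcomp M x (g - h) \<in> gcomp M g" for g
      using graded_moduleD(7)[OF M r(1) hcomp_props(1)[OF M x, of "g - h"]] by simp
    show "r \<odot>\<^bsub>M\<^esub> hcomp M x (g - h) = \<zero>\<^bsub>M\<^esub>" if "g \<notin> (\<lambda>g. g + h) ` ?A" for g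
    proof -
      have "hcomp M x (g - h) = \<zero>\<^bsub>M\<^esub>"
        using that by (rule contrapos_np) (auto intro!: image_eqI[of _ _ "g - h"])
      then show ?thesis using r by simp
    qed
    have "r \<odot>\<^bsub>M\<^esub> x = r \<odot>\<^bsub>M\<^esub> finsum M (hcomp M x) ?A" using hcomp_props(3)[OF M x] by simp
    also have "\<dots> = finsum M (\<lambda>g. r \<odot>\<^bsub>M\<^esub> hcomp M x g) ?A"
      using M x r A by (intro M.finsum_smult_ldistr) auto
    also have "\<dots> = finsum M (\<lambda>g. r \<odot>\<^bsub>M\<^esub> hcomp M x (g - h)) ((\<lambda>g. g + h) ` ?A)"
      using M x r by (subst M.finsum_reindex) (auto simp: inj_on_def)
    finally show "r \<odot>\<^bsub>M\<^esub> x = \<dots>" .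
  qed
  then show ?thesis by simp
qed

text \<open>Decompositions are unique and exist on the \<open>M\<close> side; both properties are
  pulled back through \<open>f\<close>, which matches the components exactly.\<close>

lemma graded_transport:
  assumes M: "is_graded_module k R M" and N: "module R N"
    and f: "f \<in> module_hom R N M" "bij_betw f (carrier N) (carrier M)"
    and sub: "\<And>g. gcomp N g \<subseteq> carrier N" and im: "\<And>g. f ` gcomp N g = gcomp M g"
  shows "is_graded_module k R N"
proof -
  have M': "module R M" using M by (rule graded_moduleD)
  interpret NN: module R N by fact
  interpret mod_hom R N M f using M' N f by (auto simp: mod_hom_def mod_hom_axioms_def)
  have inj: "inj_on f (carrier N)" using f(2) by (auto simp: bij_betw_def)
  have mem: "x \<in> gcomp N g \<longleftrightarrow> f x \<in> gcomp M g" if "x \<in> carrier N" for x g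
  proof
    assume "f x \<in> gcomp M g"
    then obtain y where y: "y \<in> gcomp N g" "f y = f x" using im by (metis imageE)
    then have "y = x" using inj sub[of g] that by (auto dest: inj_onD)
    then show "x \<in> gcomp N g" using y by simp
  qed (use im in blast)
  have c: "x \<in> carrier N" if "x \<in> gcomp N g" for x g using sub that by blast
  have zero_iff: "f x = \<zero>\<^bsub>M\<^esub> \<longleftrightarrow> x = \<zero>\<^bsub>N\<^esub>" if "x \<in> carrier N" for x
    using inj_on_eq_iff[OF inj that NN.zero_closed] by simp
  have gR: "gcomp R g \<subseteq> carrier R" for g
    using graded_algebra by (auto simp: is_graded_algebra_def is_grading_def subspace_def submodule_def)
  show ?thesis
  proof (rule graded_moduleI[OF N sub])
    show "\<zero>\<^bsub>N\<^esub> \<in> gcomp N g" for g by (simp add: mem graded_moduleD(3)[OF M])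
    show "x \<oplus>\<^bsub>N\<^esub> y \<in> gcomp N g" if "x \<in> gcomp N g" "y \<in> gcomp N g" for x y g
      using that c[OF that(1)] c[OF that(2)] by (simp add: mem graded_moduleD(4)[OF M])
    show "\<iota> a \<odot>\<^bsub>N\<^esub> x \<in> gcomp N g" if "a \<in> carrier k" "x \<in> gcomp N g" for x a g
      using that c[OF that(2)] by (simp add: mem graded_moduleD(5)[OF M])
    show "r \<odot>\<^bsub>N\<^esub> x \<in> gcomp N (g + h)" if "r \<in> gcomp R g" "x \<in> gcomp N h" for x r g h
      using that c[OF that(2)] gR[of g] by (simp add: mem graded_moduleD(7)[OF M] subset_iff)
    fix x assume x: "x \<in> carrier N"
    \<comment> \<open>The preimages of the components of \<open>f x\<close> are the candidates for
      the components of \<open>x\<close>.\<close>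
    define F where "F g = inv_into (carrier N) f (hcomp M (f x) g)" for g
    have fx: "f x \<in> carrier M" using x by simp
    have F: "F g \<in> carrier N" "f (F g) = hcomp M (f x) g" for g
      using f(2) hcomp_carrier[OF M fx, of g] unfolding F_def
      by (auto simp: bij_betw_def inv_into_into f_inv_into_f)
    have supp: "{g. F g \<noteq> \<zero>\<^bsub>N\<^esub>} = {g. hcomp M (f x) g \<noteq> \<zero>\<^bsub>M\<^esub>}"
      using zero_iff[OF F(1)] F(2) by auto
    have fs: "f (finsum N G A) = finsum M (\<lambda>g. f (G g)) A" if "G \<in> A \<rightarrow> carrier N" for G and A :: "'g set"
      by (rule hom_finsum[OF N M' f(1) that])
    show "\<exists>!F. (\<forall>g. F g \<in> gcomp N g) \<and> finite {g. F g \<noteq> \<zero>\<^bsub>N\<^esub>} \<and> x = finsum N F {g. F g \<noteq> \<zero>\<^bsub>N\<^esub>}"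
    proof (rule ex1I[of _ F], intro conjI allI)
      show "F g \<in> gcomp N g" for g using F hcomp_props(1)[OF M fx] by (simp add: mem)
      show "finite {g. F g \<noteq> \<zero>\<^bsub>N\<^esub>}" unfolding supp by (rule hcomp_props(2)[OF M fx])
      have "f (finsum N F {g. F g \<noteq> \<zero>\<^bsub>N\<^esub>}) = finsum M (\<lambda>g. f (F g)) {g. F g \<noteq> \<zero>\<^bsub>N\<^esub>}"
        using F(1) by (intro fs) auto
      then have "f (finsum N F {g. F g \<noteq> \<zero>\<^bsub>N\<^esub>}) =
          finsum M (hcomp M (f x)) {g. hcomp M (f x) g \<noteq> \<zero>\<^bsub>M\<^esub>}"
        by (simp only: supp F(2))
      then have "f (finsum N F {g. F g \<noteq> \<zero>\<^bsub>N\<^esub>}) = f x"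
        using hcomp_props(3)[OF M fx] by (rule trans[OF _ sym])
      from this[symmetric] show "x = finsum N F {g. F g \<noteq> \<zero>\<^bsub>N\<^esub>}"
        by (rule inj_onD[OF inj]) (use x F(1) in \<open>auto intro!: NN.finsum_closed\<close>)
    next
      fix G assume G: "(\<forall>g. G g \<in> gcomp N g) \<and> finite {g. G g \<noteq> \<zero>\<^bsub>N\<^esub>} \<and> x = finsum N G {g. G g \<noteq> \<zero>\<^bsub>N\<^esub>}"
      then have Gc: "G g \<in> carrier N" for g using c by blast
      have "hcomp M (f x) = (\<lambda>g. f (G g))"
      proof (rule hcomp_eqI[OF M])
        show "finite {g. G g \<noteq> \<zero>\<^bsub>N\<^esub>}" using G by simp
        show "f (G g) \<in> gcomp M g" for g using G mem[OF Gc] by blast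
        have "f x = f (finsum N G {g. G g \<noteq> \<zero>\<^bsub>N\<^esub>})" using G by simp
        also have "\<dots> = finsum M (\<lambda>g. f (G g)) {g. G g \<noteq> \<zero>\<^bsub>N\<^esub>}" using Gc by (intro fs) auto
        finally show "f x = \<dots>" .
      qed auto
      then have "f (G g) = f (F g)" for g by (simp add: F)
      then show "G = F" using inj Gc F(1) by (auto intro!: ext dest: inj_onD)
    qed
  qed
qed

section \<open>The algebra as a module over itself and its image monoid\<close>

abbreviation "Q \<equiv> gsupp R"
abbreviation "RR \<equiv> regular_module R"

lemma regular_simps [simp]:
  "carrier RR = carrier R" "add RR = add R" "\<zero>\<^bsub>RR\<^esub> = \<zero>\<^bsub>R\<^esub>" "smult RR = mult R" "gcomp RR = gcomp R"
  by (simp_all add: regular_module_def)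

lemma finsum_regular [simp]: "finsum RR = finsum R"
  by (rule finsum_cong_record) simp_all

lemma regular_is_module: "module R RR"
proof (rule moduleI)
  show "abelian_group RR"
    by (rule abelian_groupI) (auto simp: R.a_ac intro: R.l_neg R.a_inv_closed)
qed (auto simp: R.l_distr R.r_distr R.m_assoc cring_R)

lemma gcomp_R:
  shows gcomp_R_carrier: "x \<in> gcomp R g \<Longrightarrow> x \<in> carrier R"
    and gcomp_R_mult: "x \<in> gcomp R g \<Longrightarrow> y \<in> gcomp R h \<Longrightarrow> x \<otimes>\<^bsub>R\<^esub> y \<in> gcomp R (g + h)"
    and regular_graded: "is_graded_module k R RR"
proof -
  have sub: "subspace k (gcomp R g) R" for g
    using graded_algebra by (simp add: is_graded_algebra_def is_grading_def)
  have ex1: "\<exists>!f. (\<forall>g. f g \<in> gcomp R g) \<and> finite {g. f g \<noteq> \<zero>\<^bsub>R\<^esub>} \<and> x = finsum R f {g. f g \<noteq> \<zero>\<^bsub>R\<^esub>}"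
    if "x \<in> carrier R" for x
    using graded_algebra that unfolding is_graded_algebra_def is_grading_def by blast
  have mult: "x \<in> gcomp R g \<Longrightarrow> y \<in> gcomp R h \<Longrightarrow> x \<otimes>\<^bsub>R\<^esub> y \<in> gcomp R (g + h)" for g h x y
    using graded_algebra by (simp add: is_graded_algebra_def)
  have c: "gcomp R g \<subseteq> carrier R" for g using sub[of g] by (simp add: subspace_def submodule_def)
  show "x \<in> gcomp R g \<Longrightarrow> x \<in> carrier R" using c by blast
  show "x \<in> gcomp R g \<Longrightarrow> y \<in> gcomp R h \<Longrightarrow> x \<otimes>\<^bsub>R\<^esub> y \<in> gcomp R (g + h)" by (rule mult)
  show "is_graded_module k R RR"
  proof (rule graded_moduleI[OF regular_is_module])
    fix g a x assume "a \<in> carrier k" "x \<in> gcomp RR g"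
    then show "\<iota> a \<odot>\<^bsub>RR\<^esub> x \<in> gcomp RR g"
      using sub[of g] c[of g] by (auto simp: subspace_def submodule_def \<iota>_mult_left)
  qed (use sub c mult ex1 in \<open>auto simp: subspace_def submodule_def\<close>)
qed

lemmas gcomp_R_zero [simp] = graded_moduleD(3)[OF regular_graded, unfolded regular_simps]
lemmas gcomp_R_add = graded_moduleD(4)[OF regular_graded, unfolded regular_simps]
lemmas gcomp_R_\<iota> = graded_moduleD(5)[OF regular_graded, unfolded regular_simps]

lemma gcomp_R_0: "gcomp R 0 = \<iota> ` carrier k"
  using pdcf by (simp add: pdcf_def \<iota>_def fun_eq_iff image_def)

lemma one_gcomp: "\<one>\<^bsub>R\<^esub> \<in> gcomp R 0"
  using gcomp_R_0 \<iota>_one by (metis image_eqI k.one_closed)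

lemma mem_Q: "r \<in> gcomp R g \<Longrightarrow> r \<noteq> \<zero>\<^bsub>R\<^esub> \<Longrightarrow> g \<in> Q"
  by (auto simp: gsupp_def)

lemma Q_nonzero: "g \<in> Q \<Longrightarrow> \<exists>r\<in>gcomp R g. r \<noteq> \<zero>\<^bsub>R\<^esub>"
  using gcomp_R_zero[of g] by (auto simp: gsupp_def)

text \<open>Closure under addition is where the domain property enters: a product of nonzero
  homogeneous elements is nonzero and homogeneous of the sum of the degrees.\<close>

sublocale Q: pointed_monoid "gsupp R"
proof
  show "0 \<in> Q" using mem_Q[OF one_gcomp] by simp
  fix p q assume "p \<in> Q" "q \<in> Q"
  then obtain r s where "r \<in> gcomp R p" "r \<noteq> \<zero>\<^bsub>R\<^esub>" "s \<in> gcomp R q" "s \<noteq> \<zero>\<^bsub>R\<^esub>"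
    using Q_nonzero by metis
  then show "p + q \<in> Q"
    using mem_Q[OF gcomp_R_mult] gcomp_R_carrier R.integral by metis
qed (use pdcf in \<open>auto simp: pdcf_def\<close>)

section \<open>Graded free modules\<close>

text \<open>The generator \<open>s\<close> has degree \<open>d s\<close>, so a homogeneous element of degree \<open>g\<close> has its coefficient at \<open>s\<close> in degree \<open>g - d s\<close>.\<close>

definition gfree :: "'s set \<Rightarrow> ('s \<Rightarrow> 'g) \<Rightarrow> ('r, 's \<Rightarrow> 'r, 'g) graded_module"
  where "gfree S d = with_grading (free_module R S)
    (\<lambda>g. {f \<in> carrier (free_module R S). \<forall>s\<in>S. f s \<in> gcomp R (g - d s)})"

lemma gfree_simps [simp]:
  "carrier (gfree S d) = carrier (free_module R S)"
  "f \<oplus>\<^bsub>gfree S d\<^esub> f' = (\<lambda>s. f s \<oplus>\<^bsub>R\<^esub> f' s)"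
  "\<zero>\<^bsub>gfree S d\<^esub> = (\<lambda>_. \<zero>\<^bsub>R\<^esub>)"
  "r \<odot>\<^bsub>gfree S d\<^esub> f = (\<lambda>s. r \<otimes>\<^bsub>R\<^esub> f s)"
  by (simp_all add: gfree_def free_module_def)

lemma gcomp_gfree: "f \<in> gcomp (gfree S d) g \<longleftrightarrow> f \<in> carrier (free_module R S) \<and> (\<forall>s\<in>S. f s \<in> gcomp R (g - d s))"
  by (simp add: gfree_def)

lemma free_carrier:
  "f \<in> carrier (free_module R S) \<longleftrightarrow>
    (\<forall>s. f s \<in> carrier R) \<and> (\<forall>s. s \<notin> S \<longrightarrow> f s = \<zero>\<^bsub>R\<^esub>) \<and> finite {s. f s \<noteq> \<zero>\<^bsub>R\<^esub>}"
  by (simp add: free_module_def)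

lemma free_closed:
  "f \<in> carrier (free_module R S) \<Longrightarrow> f' \<in> carrier (free_module R S) \<Longrightarrow> (\<lambda>s. f s \<oplus>\<^bsub>R\<^esub> f' s) \<in> carrier (free_module R S)"
  "r \<in> carrier R \<Longrightarrow> f \<in> carrier (free_module R S) \<Longrightarrow> (\<lambda>s. r \<otimes>\<^bsub>R\<^esub> f s) \<in> carrier (free_module R S)"
  "(\<lambda>_. \<zero>\<^bsub>R\<^esub>) \<in> carrier (free_module R S)"
proof -
  interpret F: module R "free_module R S" by (rule free_module_is_module[OF cring_R])
  show "f \<in> carrier (free_module R S) \<Longrightarrow> f' \<in> carrier (free_module R S) \<Longrightarrow> (\<lambda>s. f s \<oplus>\<^bsub>R\<^esub> f' s) \<in> carrier (free_module R S)"
    using F.a_closed[of f f'] by (simp add: free_module_def)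
  show "r \<in> carrier R \<Longrightarrow> f \<in> carrier (free_module R S) \<Longrightarrow> (\<lambda>s. r \<otimes>\<^bsub>R\<^esub> f s) \<in> carrier (free_module R S)"
    using F.smult_closed[of r f] by (simp add: free_module_def)
  show "(\<lambda>_. \<zero>\<^bsub>R\<^esub>) \<in> carrier (free_module R S)" by (simp add: free_module_def)
qed

lemma gfree_hom_iff: "module_hom R (gfree S d) M = module_hom R (free_module R S) M"
  by (auto simp: module_hom_def free_module_def)

lemma gfree_module: "module R (gfree S d)"
  by (rule module_transport[OF free_module_is_module[OF cring_R, of S], where f = "\<lambda>f. f"])
    (auto simp: free_closed bij_betw_def, auto simp: free_module_def)

text \<open>Evaluation at \<open>s\<close> is a linear map to the regular module and so commutes
  with finite sums.\<close>

lemma gfree_finsum: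
  assumes "F \<in> A \<rightarrow> carrier (free_module R S)"
  shows "finsum (gfree S d) F A s = finsum R (\<lambda>a. F a s) A"
proof -
  have "(\<lambda>f. f s) \<in> module_hom R (gfree S d) RR"
    by (rule module_homI) (auto simp: free_carrier)
  from hom_finsum[OF gfree_module regular_is_module this, of F A] assms show ?thesis by simp
qed

text \<open>The coefficient at \<open>s\<close> is decomposed in \<open>R\<close> and its components
  are shifted by the degree of the generator \<open>s\<close>.\<close>

lemma gfree_decomposition:
  fixes d :: "'s \<Rightarrow> 'g"
  assumes f: "f \<in> carrier (free_module R S)"
  defines "F \<equiv> \<lambda>g s. if s \<in> S then hcomp RR (f s) (g - d s) else \<zero>\<^bsub>R\<^esub>"
  obtains A where "finite A" "\<And>g. F g \<in> gcomp (gfree S d) g" "\<And>g. g \<notin> A \<Longrightarrow> F g = \<zero>\<^bsub>gfree S d\<^esub>"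
    "f = finsum (gfree S d) F A"
proof
  have fs: "f s \<in> carrier RR" for s using f by (simp add: free_carrier)
  have fin: "finite {s. f s \<noteq> \<zero>\<^bsub>R\<^esub>}" using f by (simp add: free_carrier)
  have z: "hcomp RR \<zero>\<^bsub>R\<^esub> h = \<zero>\<^bsub>R\<^esub>" for h
    using hcomp_homogeneous[OF regular_graded, of "\<zero>\<^bsub>R\<^esub>" 0] by simp
  \<comment> \<open>All degrees that occur: finitely many nonzero coefficients, each with finitely
    many nonzero components, shifted by \<open>d s\<close>.\<close>
  define A where "A = (\<lambda>(s, h). h + d s) ` Sigma {s. f s \<noteq> \<zero>\<^bsub>R\<^esub>} (\<lambda>s. {h. hcomp RR (f s) h \<noteq> \<zero>\<^bsub>R\<^esub>})"
  show A: "finite A"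
    unfolding A_def using fin hcomp_props(2)[OF regular_graded fs] by (intro finite_imageI finite_SigmaI) auto
  have memA: "g \<in> A" if "hcomp RR (f s) (g - d s) \<noteq> \<zero>\<^bsub>R\<^esub>" for g s
    using that z unfolding A_def by (intro image_eqI[of _ _ "(s, g - d s)"]) auto
  show F: "F g \<in> gcomp (gfree S d) g" for g
  proof -
    have "finite {s. F g s \<noteq> \<zero>\<^bsub>R\<^esub>}"
      by (rule finite_subset[OF _ fin]) (use z in \<open>auto simp: F_def\<close>)
    then show ?thesis using hcomp_props(1)[OF regular_graded fs]
      by (auto simp: gcomp_gfree free_carrier F_def intro: gcomp_R_carrier)
  qed
  show "F g = \<zero>\<^bsub>gfree S d\<^esub>" if "g \<notin> A" for g
    using that memA by (auto simp: F_def fun_eq_iff)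
  show "f = finsum (gfree S d) F A"
  proof
    fix s
    have "finsum (gfree S d) F A s = finsum R (\<lambda>g. F g s) A"
      using F by (intro gfree_finsum) (auto simp: gcomp_gfree)
    also have "\<dots> = f s"
    proof (cases "s \<in> S")
      case True
      have "f s = finsum RR (hcomp RR (f s)) ((\<lambda>g. g - d s) ` A)"
        by (rule hcomp_sum[OF regular_graded fs]) (use A memA[of s "_ + d s"] in \<open>auto intro!: image_eqI[of _ _ "_ + d s"]\<close>)
      also have "\<dots> = finsum R (\<lambda>g. hcomp RR (f s) (g - d s)) A"
        using hcomp_carrier[OF regular_graded fs] by (simp add: R.finsum_reindex inj_on_def)
      finally show ?thesis using True by (simp add: F_def)
    next
      case False
      then show ?thesis using f by (simp add: F_def free_carrier)
    qed
    finally show "f s = finsum (gfree S d) F A s" by simp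
  qed
qed

lemma gfree_graded: "is_graded_module k R (gfree S d)"
proof (rule graded_moduleI[OF gfree_module])
  fix f assume "f \<in> carrier (gfree S d)"
  then have f: "f \<in> carrier (free_module R S)" by simp
  interpret F: module R "gfree S d" by (rule gfree_module)
  let ?F = "\<lambda>g s. if s \<in> S then hcomp RR (f s) (g - d s) else \<zero>\<^bsub>R\<^esub>"
  obtain A where A: "finite A" "\<And>g. ?F g \<in> gcomp (gfree S d) g" "\<And>g. g \<notin> A \<Longrightarrow> ?F g = \<zero>\<^bsub>gfree S d\<^esub>"
    "f = finsum (gfree S d) ?F A"
    using gfree_decomposition[OF f] by blast
  show "\<exists>!F. (\<forall>g. F g \<in> gcomp (gfree S d) g) \<and> finite {g. F g \<noteq> \<zero>\<^bsub>gfree S d\<^esub>} \<and>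
      f = finsum (gfree S d) F {g. F g \<noteq> \<zero>\<^bsub>gfree S d\<^esub>}"
  proof (rule ex1I[of _ ?F], intro conjI allI)
    have sub: "{g. ?F g \<noteq> \<zero>\<^bsub>gfree S d\<^esub>} \<subseteq> A" using A(3) by blast
    then show "finite {g. ?F g \<noteq> \<zero>\<^bsub>gfree S d\<^esub>}" using A(1) by (rule finite_subset)
    show "f = finsum (gfree S d) ?F {g. ?F g \<noteq> \<zero>\<^bsub>gfree S d\<^esub>}"
      by (rule trans[OF A(4) F.add.finprod_mono_neutral_cong_right[OF A(1) sub]])
        (use A(2) in \<open>auto simp: gcomp_gfree\<close>)
  next
    fix G assume G: "(\<forall>g. G g \<in> gcomp (gfree S d) g) \<and> finite {g. G g \<noteq> \<zero>\<^bsub>gfree S d\<^esub>} \<and>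
      f = finsum (gfree S d) G {g. G g \<noteq> \<zero>\<^bsub>gfree S d\<^esub>}"
    have Gc: "G g \<in> carrier (free_module R S)" for g using G by (simp add: gcomp_gfree)
    show "G = ?F"
    proof (intro ext)
      fix g s
      show "G g s = ?F g s"
      proof (cases "s \<in> S")
        case True
        let ?A = "{g. G g \<noteq> \<zero>\<^bsub>gfree S d\<^esub>}"
        \<comment> \<open>For a fixed coordinate \<open>s\<close>, any decomposition of
          \<open>f\<close> shifted back by \<open>d s\<close> decomposes \<open>f s\<close> in
          \<open>R\<close>, where uniqueness is known.\<close>
        have "hcomp RR (f s) = (\<lambda>h. G (h + d s) s)"
        proof (rule hcomp_eqI[OF regular_graded])
          show "finite ((\<lambda>g. g - d s) ` ?A)" using G by simp
          show "G (h + d s) s \<in> gcomp RR h" for h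
          proof -
            have "G (h + d s) s \<in> gcomp R (h + d s - d s)" using G True unfolding gcomp_gfree by blast
            then show ?thesis by simp
          qed
          show "G (h + d s) s = \<zero>\<^bsub>RR\<^esub>" if "h \<notin> (\<lambda>g. g - d s) ` ?A" for h
          proof -
            have "h + d s \<notin> ?A" using that by (metis add_diff_cancel image_eqI)
            then show ?thesis by simp
          qed
          have "f s = finsum (gfree S d) G ?A s" using G by (metis (no_types, lifting))
          also have "\<dots> = finsum R (\<lambda>g. G g s) ?A" using Gc by (intro gfree_finsum) auto
          also have "\<dots> = finsum R (\<lambda>h. G (h + d s) s) ((\<lambda>g. g - d s) ` ?A)"
            using Gc by (subst R.finsum_reindex) (auto simp: inj_on_def free_carrier)
          finally show "f s = finsum RR (\<lambda>h. G (h + d s) s) ((\<lambda>g. g - d s) ` ?A)" by simp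
        qed
        then show ?thesis using True by simp
      next
        case False
        then show ?thesis using Gc[of g] by (simp add: free_carrier)
      qed
    qed
  qed (use A(2) in blast)
next
  fix g h r x assume "r \<in> gcomp R g" "x \<in> gcomp (gfree S d) h"
  then show "r \<odot>\<^bsub>gfree S d\<^esub> x \<in> gcomp (gfree S d) (g + h)"
    using gcomp_R_mult[of r g "x _" "h - d _"] by (auto simp: gcomp_gfree free_closed gcomp_R_carrier add_diff_eq)
next
  fix g a x assume "a \<in> carrier k" "x \<in> gcomp (gfree S d) g"
  then show "\<iota> a \<odot>\<^bsub>gfree S d\<^esub> x \<in> gcomp (gfree S d) g"
    by (auto simp: gcomp_gfree free_closed gcomp_R_\<iota>)
qed (auto simp: gcomp_gfree free_closed gcomp_R_add)

definition \<delta> :: "'s \<Rightarrow> 's \<Rightarrow> 'r" where "\<delta> s = (\<lambda>t. if t = s then \<one>\<^bsub>R\<^esub> else \<zero>\<^bsub>R\<^esub>)"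

lemma \<delta>_carrier: "s \<in> S \<Longrightarrow> \<delta> s \<in> carrier (free_module R S)"
  by (auto simp: \<delta>_def free_carrier)

lemma \<delta>_gcomp: "s \<in> S \<Longrightarrow> \<delta> s \<in> gcomp (gfree S d) (d s)"
  using \<delta>_carrier[of s S] one_gcomp by (auto simp: gcomp_gfree \<delta>_def)

lemma eval_\<delta>:
  assumes f: "f \<in> carrier (free_module R S)"
  shows "free_module_eval R (gfree S d) \<delta> f = f"
proof
  fix s
  have fc: "f m \<in> carrier R" for m using f by (simp add: free_carrier)
  have fin: "finite {m. f m \<noteq> \<zero>\<^bsub>R\<^esub>}" using f by (simp add: free_carrier)
  have sub: "m \<in> S" if "f m \<noteq> \<zero>\<^bsub>R\<^esub>" for m using f that by (auto simp: free_carrier)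
  have "free_module_eval R (gfree S d) \<delta> f s = finsum R (\<lambda>m. f m \<otimes>\<^bsub>R\<^esub> \<delta> m s) {m. f m \<noteq> \<zero>\<^bsub>R\<^esub>}"
    unfolding free_module_eval_def
    by (subst gfree_finsum) (auto intro!: free_closed \<delta>_carrier fc sub)
  also have "\<dots> = finsum R (\<lambda>m. if s = m then f m else \<zero>\<^bsub>R\<^esub>) {m. f m \<noteq> \<zero>\<^bsub>R\<^esub>}"
    using fc by (intro R.finsum_cong') (auto simp: \<delta>_def)
  also have "\<dots> = f s"
  proof (cases "f s = \<zero>\<^bsub>R\<^esub>")
    case True
    then have "finsum R (\<lambda>m. if s = m then f m else \<zero>\<^bsub>R\<^esub>) {m. f m \<noteq> \<zero>\<^bsub>R\<^esub>} =
        finsum R (\<lambda>m. \<zero>\<^bsub>R\<^esub>) {m. f m \<noteq> \<zero>\<^bsub>R\<^esub>}"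
      by (intro R.finsum_cong') auto
    then show ?thesis using True by simp
  next
    case False
    then show ?thesis using fc fin by (intro R.finsum_singleton) auto
  qed
  finally show "free_module_eval R (gfree S d) \<delta> f s = f s" .
qed

text \<open>Every \<open>f\<close> is its own expansion in the generators \<open>\<delta> s\<close>,
  so a homomorphism is recovered from its values on them.\<close>

lemma gfree_hom_eval:
  assumes M: "module R M" and h: "h \<in> module_hom R (gfree S d) M" and f: "f \<in> carrier (free_module R S)"
  shows "h f = free_module_eval R M (\<lambda>s. h (\<delta> s)) f"
proof -
  have "h (free_module_eval R (gfree S d) \<delta> f) = free_module_eval R M (h \<circ> \<delta>) f"
    by (rule free_module_eval_comp[OF gfree_module M _ h f]) (auto intro: \<delta>_carrier)
  then show ?thesis by (simp add: eval_\<delta>[OF f] o_def)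
qed

lemma eval_at_\<delta>:
  assumes "module R M" "b s \<in> carrier M"
  shows "free_module_eval R M b (\<delta> s) = b s"
proof -
  interpret M: module R M by fact
  have "{m. \<delta> s m \<noteq> \<zero>\<^bsub>R\<^esub>} = {s}" by (auto simp: \<delta>_def)
  then show ?thesis using assms by (simp add: free_module_eval_def \<delta>_def)
qed

lemma eval_cong:
  assumes "module R M" "f \<in> carrier (free_module R S)" "\<And>s. s \<in> S \<Longrightarrow> b s = b' s" "b' \<in> S \<rightarrow> carrier M"
  shows "free_module_eval R M b f = free_module_eval R M b' f"
proof -
  interpret M: module R M by fact
  have "m \<in> S" "f m \<in> carrier R" if "f m \<noteq> \<zero>\<^bsub>R\<^esub>" for m using assms(2) that by (auto simp: free_carrier)
  then show ?thesis unfolding free_module_eval_def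
    using assms(3,4) by (intro M.finsum_cong') (auto simp: Pi_iff)
qed

text \<open>On a free module a lift is obtained by choosing preimages of the values on the
  generators; the isomorphism carries this lift over to \<open>M\<close>.\<close>

lemma projective_if_free:
  fixes M :: "('r, 'm, 'y) module_scheme"
  assumes M: "module R M" and \<phi>: "\<phi> \<in> module_hom R (gfree S d) M" "bij_betw \<phi> (carrier (gfree S d)) (carrier M)"
  shows "projective_module R M"
  unfolding projective_module_def
proof (intro conjI allI impI ballI)
  fix A :: "('r, 'm \<Rightarrow> 'r) module" and B :: "('r, 'm) module" and p f
  assume A: "module R A" and B: "module R B" and p: "p \<in> module_hom R A B"
    and f: "f \<in> module_hom R M B" and surj: "p ` carrier A = carrier B"
  let ?\<psi> = "inv_into (carrier (gfree S d)) \<phi>"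
  have \<psi>: "?\<psi> \<in> module_hom R M (gfree S d)" by (rule module_hom_inv[OF gfree_module \<phi>])
  have \<psi>c: "?\<psi> x \<in> carrier (free_module R S)" "\<phi> (?\<psi> x) = x" if "x \<in> carrier M" for x
    using \<phi>(2) that by (auto simp: bij_betw_def f_inv_into_f) (metis gfree_simps(1) inv_into_into)
  have \<phi>c: "\<phi> u \<in> carrier M" if "u \<in> carrier (free_module R S)" for u
    using module_hom_closed[OF \<phi>(1)] that by auto
  have fc: "f x \<in> carrier B" if "x \<in> carrier M" for x using module_hom_closed[OF f] that by auto
  have "\<exists>a\<in>carrier A. p a = f (\<phi> (\<delta> s))" if "s \<in> S" for s
    using fc[OF \<phi>c[OF \<delta>_carrier[OF that]]] surj by (metis imageE)
  then obtain a where a: "\<And>s. s \<in> S \<Longrightarrow> a s \<in> carrier A" "\<And>s. s \<in> S \<Longrightarrow> p (a s) = f (\<phi> (\<delta> s))" by metis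
  have aS: "a \<in> S \<rightarrow> carrier A" using a by auto
  let ?e = "free_module_eval R A a"
  have e: "?e \<in> module_hom R (free_module R S) A" by (rule free_module_eval_hom[OF A aS])
  have \<psi>': "?\<psi> \<in> module_hom R M (free_module R S)" using \<psi> by (auto simp: module_hom_def free_module_def)
  have f\<phi>: "(\<lambda>u. f (\<phi> u)) \<in> module_hom R (gfree S d) B"
    using f \<phi>(1) by (auto simp: module_hom_def Pi_iff)
  show "\<exists>h\<in>module_hom R M A. \<forall>x\<in>carrier M. p (h x) = f x"
  proof (rule bexI[of _ "\<lambda>x. ?e (?\<psi> x)"], rule ballI)
    show "(\<lambda>x. ?e (?\<psi> x)) \<in> module_hom R M A"
      using e \<psi>' by (auto simp: module_hom_def Pi_iff)
    fix x assume x: "x \<in> carrier M"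
    have "p (?e (?\<psi> x)) = free_module_eval R B (p \<circ> a) (?\<psi> x)"
      by (rule free_module_eval_comp[OF A B aS p \<psi>c(1)[OF x]])
    also have "\<dots> = free_module_eval R B (\<lambda>s. f (\<phi> (\<delta> s))) (?\<psi> x)"
      by (rule eval_cong[OF B \<psi>c(1)[OF x]]) (auto simp: a intro!: fc \<phi>c \<delta>_carrier)
    also have "\<dots> = f (\<phi> (?\<psi> x))" by (rule gfree_hom_eval[OF B f\<phi> \<psi>c(1)[OF x], symmetric])
    finally show "p (?e (?\<psi> x)) = f x" using \<psi>c(2)[OF x] by simp
  qed
qed (rule M)

section \<open>Graded isomorphisms and the invariants they preserve\<close>

lemma graded_isomorphic_sym: "graded_isomorphic R M N \<Longrightarrow> graded_isomorphic R N M"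
  unfolding graded_isomorphic_def by blast

lemma graded_isomorphic_refl: "graded_isomorphic R M M"
  unfolding graded_isomorphic_def graded_hom_def module_hom_def
  by (intro bexI[of _ "\<lambda>x. x"]) auto

lemma graded_isomorphic_trans:
  assumes "graded_isomorphic R M N" "graded_isomorphic R N P"
  shows "graded_isomorphic R M P"
proof -
  obtain f f' where f: "f \<in> graded_hom R M N" "f' \<in> graded_hom R N M"
    "\<forall>x\<in>carrier M. f' (f x) = x" "\<forall>x\<in>carrier N. f (f' x) = x"
    using assms(1) unfolding graded_isomorphic_def by blast
  obtain h h' where h: "h \<in> graded_hom R N P" "h' \<in> graded_hom R P N"
    "\<forall>x\<in>carrier N. h' (h x) = x" "\<forall>x\<in>carrier P. h (h' x) = x"
    using assms(2) unfolding graded_isomorphic_def by blast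
  have c: "\<And>x. x \<in> carrier M \<Longrightarrow> f x \<in> carrier N" "\<And>x. x \<in> carrier P \<Longrightarrow> h' x \<in> carrier N"
    using f h by (auto simp: graded_hom_def module_hom_def)
  have hom: "(\<lambda>x. h (f x)) \<in> graded_hom R M P" "(\<lambda>x. f' (h' x)) \<in> graded_hom R P M"
    using f(1,2) h(1,2) unfolding graded_hom_def module_hom_def
    by (auto simp: Pi_iff image_subset_iff)
  have "f' (h' (h (f x))) = x" if "x \<in> carrier M" for x
    using f(3) h(3) c(1) that by simp
  moreover have "h (f (f' (h' x))) = x" if "x \<in> carrier P" for x
    using f(4) h(4) c(2) that by simp
  ultimately show ?thesis unfolding graded_isomorphic_def
    by (intro bexI[OF _ hom(1)] bexI[OF _ hom(2)]) auto
qed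

lemma graded_isoI:
  assumes M: "module R M" and f: "f \<in> module_hom R M N" "bij_betw f (carrier M) (carrier N)"
    and sub: "\<And>g. gcomp M g \<subseteq> carrier M" and im: "\<And>g. f ` gcomp M g = gcomp N g"
  shows "graded_isomorphic R M N"
proof -
  let ?f = "inv_into (carrier M) f"
  have inj: "inj_on f (carrier M)" using f(2) by (simp add: bij_betw_def)
  have "?f (f x) = x" if "x \<in> carrier M" for x using inj that by simp
  moreover have "f (?f y) = y" if "y \<in> carrier N" for y
    using f(2) that by (auto simp: bij_betw_def f_inv_into_f)
  moreover have "f \<in> graded_hom R M N" using f im by (simp add: graded_hom_def)
  moreover have "?f ` gcomp N g \<subseteq> gcomp M g" for g
    using calculation(1) sub[of g] unfolding im[symmetric] by auto
  then have "?f \<in> graded_hom R N M" using module_hom_inv[OF M f] by (simp add: graded_hom_def)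
  ultimately show ?thesis unfolding graded_isomorphic_def
    by (intro bexI[of _ f] bexI[of _ ?f]) auto
qed

text \<open>A single bijection replaces the pair of inverse maps. Its equality on each component
  comes from the inverse being graded as well.\<close>

lemma graded_isoE:
  assumes "graded_isomorphic R M N" "\<And>g. gcomp M g \<subseteq> carrier M" "\<And>g. gcomp N g \<subseteq> carrier N"
  obtains f where "f \<in> module_hom R M N" "bij_betw f (carrier M) (carrier N)" "\<And>g. f ` gcomp M g = gcomp N g"
proof -
  obtain f f' where f: "f \<in> graded_hom R M N" "f' \<in> graded_hom R N M"
    "\<forall>x\<in>carrier M. f' (f x) = x" "\<forall>x\<in>carrier N. f (f' x) = x"
    using assms(1) unfolding graded_isomorphic_def by blast
  have hom: "f \<in> module_hom R M N" using f(1) by (simp add: graded_hom_def)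
  have bij: "bij_betw f (carrier M) (carrier N)"
    by (rule bij_betw_byWitness[where f' = f']) (use f in \<open>auto simp: graded_hom_def module_hom_def\<close>)
  have "f ` gcomp M g = gcomp N g" for g
  proof
    show "f ` gcomp M g \<subseteq> gcomp N g" using f(1) by (simp add: graded_hom_def)
    show "gcomp N g \<subseteq> f ` gcomp M g"
    proof
      fix y assume y: "y \<in> gcomp N g"
      then have "f' y \<in> gcomp M g" using f(2) by (auto simp: graded_hom_def)
      moreover have "y = f (f' y)" using f(4) y assms(3) by force
      ultimately show "y \<in> f ` gcomp M g" by (rule rev_image_eqI)
    qed
  qed
  with hom bij that show ?thesis by blast
qed

lemma graded_isoE':
  assumes "graded_isomorphic R M N" "is_graded_module k R M" "is_graded_module k R N"
  obtains f where "f \<in> module_hom R M N" "bij_betw f (carrier M) (carrier N)" "\<And>g. f ` gcomp M g = gcomp N g"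
  by (rule graded_isoE[OF assms(1)]) (use assms in \<open>auto intro: graded_moduleD(2)\<close>)

lemma iso_gsupp:
  assumes "is_graded_module k R M" "is_graded_module k R N" "graded_isomorphic R M N"
  shows "gsupp N = gsupp M"
proof -
  obtain f where f: "f \<in> module_hom R M N" "bij_betw f (carrier M) (carrier N)" "\<And>g. f ` gcomp M g = gcomp N g"
    using graded_isoE'[OF assms(3,1,2)] by blast
  have MN: "module R M" "module R N" using assms by (auto dest: graded_moduleD)
  interpret mod_hom R M N f using MN f by (auto simp: mod_hom_def mod_hom_axioms_def)
  have inj: "inj_on f (carrier M)" using f(2) by (simp add: bij_betw_def)
  have "gcomp N g = {\<zero>\<^bsub>N\<^esub>} \<longleftrightarrow> gcomp M g = {\<zero>\<^bsub>M\<^esub>}" for g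
  proof -
    have "gcomp N g = {\<zero>\<^bsub>N\<^esub>} \<longleftrightarrow> f ` gcomp M g = f ` {\<zero>\<^bsub>M\<^esub>}" by (simp add: f(3))
    also have "\<dots> \<longleftrightarrow> gcomp M g = {\<zero>\<^bsub>M\<^esub>}"
      using graded_moduleD(2)[OF assms(1)] by (intro inj_on_image_eq_iff[OF inj]) auto
    finally show ?thesis .
  qed
  then show ?thesis by (simp add: gsupp_def)
qed

text \<open>Coordinates on a component of \<open>M\<close> are composed with the inverse isomorphism
  to give coordinates on the component of \<open>N\<close>.\<close>

lemma iso_dim:
  assumes M: "is_graded_module k R M" and N: "is_graded_module k R N" and iso: "graded_isomorphic R M N"
    and fd: "vectorspace.fin_dim k (component_space R M g)"
  shows "vectorspace.fin_dim k (component_space R N g)"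
    "vectorspace.dim k (component_space R N g) = vectorspace.dim k (component_space R M g)"
proof -
  obtain f where f: "f \<in> module_hom R N M" "bij_betw f (carrier N) (carrier M)" "\<And>g. f ` gcomp N g = gcomp M g"
    using graded_isoE'[OF graded_isomorphic_sym[OF iso] N M] by blast
  have c: "x \<in> carrier N" if "x \<in> gcomp N g" for x using graded_moduleD(2)[OF N that] .
  interpret V: vectorspace k "component_space R M g" by (rule component_vectorspace[OF M])
  interpret W: vectorspace k "component_space R N g" by (rule component_vectorspace[OF N])
  obtain \<chi> where \<chi>: "coords k (component_space R M g) {..<V.dim} \<chi>" using V.coords_exists[OF fd] by blast
  have "bij_betw f (gcomp N g) (gcomp M g)"
    using f c by (auto simp: bij_betw_def intro: inj_on_subset)
  then have "coords k (component_space R N g) {..<V.dim} (\<chi> \<circ> f)"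
    by (intro coords_bij[OF \<chi>]) (auto simp: c module_hom_add[OF f(1)] module_hom_smult[OF f(1)])
  from W.coords_basis[OF _ this] show "W.fin_dim" "W.dim = V.dim" by auto
qed

lemma iso_bdf:
  assumes "is_graded_module k R M" "is_graded_module k R N" "graded_isomorphic R M N" "bdf k R M"
  shows "bdf k R N" "hilbert_series k R N = hilbert_series k R M" "K_series k R N = K_series k R M"
proof -
  have fd: "vectorspace.fin_dim k (component_space R M g)" for g using assms(4) by (simp add: bdf_def)
  show "bdf k R N" using assms(4) iso_gsupp[OF assms(1-3)] iso_dim[OF assms(1-3) fd] by (simp add: bdf_def)
  show h: "hilbert_series k R N = hilbert_series k R M"
    using iso_dim(2)[OF assms(1-3) fd] by (simp add: hilbert_series_def)
  show "K_series k R N = K_series k R M" by (simp add: K_series_def h)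
qed

section \<open>Hilbert series and counting series of graded free modules\<close>

definition rdim :: "'g \<Rightarrow> nat" where "rdim g = vectorspace.dim k (component_space R RR g)"

text \<open>The condition in \<open>pdcf\<close> concerns \<open>R\<close> with its own scalar
  action, while \<open>component_space\<close> acts through \<open>\<iota>\<close>. The two actions
  agree because \<open>R\<close> is an algebra.\<close>

lemma R_fin_dim: "vectorspace.fin_dim k (component_space R RR g)"
proof -
  have sub: "subspace k (gcomp R g) R"
    using graded_algebra by (simp add: is_graded_algebra_def is_grading_def)
  have "vectorspace k R" using sub by (simp add: subspace_def)
  then interpret V: vectorspace k "R\<lparr>carrier := gcomp R g\<rparr>" by (rule vectorspace.subspace_is_vs[OF _ sub])
  interpret W: vectorspace k "component_space R RR g" by (rule component_vectorspace[OF regular_graded])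
  have "V.fin_dim" using pdcf by (simp add: pdcf_def)
  then obtain \<chi> where \<chi>: "coords k (R\<lparr>carrier := gcomp R g\<rparr>) {..<V.dim} \<chi>" using V.coords_exists by blast
  have "coords k (component_space R RR g) {..<V.dim} (\<chi> \<circ> (\<lambda>x. x))"
    by (rule coords_bij[OF \<chi>]) (auto simp: bij_betw_def \<iota>_mult_left gcomp_R_carrier)
  from W.coords_basis(1)[OF _ this] show ?thesis by simp
qed

lemma R_coords: "\<exists>\<chi>. coords k (component_space R RR g) {..<rdim g} \<chi>"
  unfolding rdim_def by (rule vectorspace.coords_exists[OF component_vectorspace[OF regular_graded] R_fin_dim])

lemma rdim_zero: "rdim g = 0" if "g \<notin> Q"
proof -
  interpret W: vectorspace k "component_space R RR g" by (rule component_vectorspace[OF regular_graded])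
  have "gcomp R g = {\<zero>\<^bsub>R\<^esub>}" using that by (simp add: gsupp_def)
  \<comment> \<open>A zero component has coordinates over the empty index set: the only function in
    the target is constantly \<open>undefined\<close>.\<close>
  then have "coords k (component_space R RR g) {} (\<lambda>_ _. undefined)"
    by (simp add: coords_def bij_betw_def restrict_def)
  from W.coords_basis(2)[OF _ this] show ?thesis by (simp add: rdim_def)
qed

text \<open>Connectedness says that the component of degree 0 is spanned by the unit of
  \<open>R\<close>. This value is the constant term that makes the Hilbert series
  invertible.\<close>

lemma rdim_0: "rdim 0 = 1"
proof -
  interpret W: vectorspace k "component_space R RR 0" by (rule component_vectorspace[OF regular_graded])
  have "W.span {\<one>\<^bsub>R\<^esub>} = {W.lincomb a {\<one>\<^bsub>R\<^esub>} | a. a \<in> {\<one>\<^bsub>R\<^esub>} \<rightarrow> carrier k}"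
    by (rule W.finite_span) (auto simp: one_gcomp)
  also have "\<dots> = {\<iota> (a \<one>\<^bsub>R\<^esub>) | a. a \<one>\<^bsub>R\<^esub> \<in> carrier k}"
  proof -
    have l: "W.lincomb a {\<one>\<^bsub>R\<^esub>} = \<iota> (a \<one>\<^bsub>R\<^esub>)" if "a \<one>\<^bsub>R\<^esub> \<in> carrier k" for a
      unfolding W.lincomb_def using that by (subst W.M.finsum_insert) (auto simp: gcomp_R_0)
    show ?thesis by (intro Collect_cong ex_cong1) (auto simp: Pi_iff l)
  qed
  also have "\<dots> = \<iota> ` carrier k"
    by (auto simp: image_iff)
  finally have "W.span {\<one>\<^bsub>R\<^esub>} = carrier (component_space R RR 0)" by (simp add: gcomp_R_0)
  from W.dim1I[OF this] show ?thesis by (simp add: rdim_def one_gcomp)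
qed

definition HR :: "'g \<Rightarrow> int" where "HR = hilbert_series k R RR"

lemma HR_eq: "HR g = int (rdim g)" by (simp add: HR_def hilbert_series_def rdim_def)

lemma HR_Units: "HR \<in> Units Q.A"
proof (rule Q.series_Units)
  show "HR 0 = 1" by (simp add: HR_eq rdim_0)
  show "g \<in> Q" if "HR g \<noteq> 0" for g using that rdim_zero[of g] by (auto simp: HR_eq)
qed

text \<open>The coordinates of the coefficients \<open>f s\<close> in the components of degree
  \<open>g - d s\<close> are concatenated. A generator with \<open>g - d s\<close> outside
  \<open>Q\<close> has coefficient zero in this degree, and finiteness of the remaining ones
  guarantees that every coordinate vector comes from a function of finite support.\<close>

lemma gfree_coords:
  fixes d :: "'s \<Rightarrow> 'g"
  assumes fin: "finite {s \<in> S. g - d s \<in> Q}"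
  shows "\<exists>\<chi>. coords k (component_space R (gfree S d) g) (SIGMA s:{s \<in> S. g - d s \<in> Q}. {..<rdim (g - d s)}) \<chi>"
proof -
  let ?T = "{s \<in> S. g - d s \<in> Q}"
  let ?I = "SIGMA s:?T. {..<rdim (g - d s)}"
  obtain c where c: "\<And>h. coords k (component_space R RR h) {..<rdim h} (c h)" using R_coords by metis
  define ic where "ic h = inv_into (gcomp R h) (c h)" for h
  have cb: "bij_betw (c h) (gcomp R h) ({..<rdim h} \<rightarrow>\<^sub>E carrier k)" for h
    using c[of h] by (simp add: coords_def)
  have cm: "c h x \<in> {..<rdim h} \<rightarrow>\<^sub>E carrier k" "ic h (c h x) = x" if "x \<in> gcomp R h" for h x
    using cb[of h] that by (auto simp: bij_betw_def ic_def)
  have im: "ic h u \<in> gcomp R h" "c h (ic h u) = u" if "u \<in> {..<rdim h} \<rightarrow>\<^sub>E carrier k" for h u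
    using cb[of h] that by (auto simp: bij_betw_def ic_def inv_into_into f_inv_into_f)
  define \<chi> where "\<chi> f = (\<lambda>(s, i)\<in>?I. c (g - d s) (f s) i)" for f
  \<comment> \<open>The inverse of \<chi>. The value zero outside \<open>?T\<close> is forced, since
    the relevant component of \<open>R\<close> is zero there or \<open>s\<close> is no
    generator.\<close>
  define \<psi> where "\<psi> u s = (if s \<in> ?T then ic (g - d s) (\<lambda>i\<in>{..<rdim (g - d s)}. u (s, i)) else \<zero>\<^bsub>R\<^esub>)" for u s
  have z: "gcomp R (g - d s) = {\<zero>\<^bsub>R\<^esub>}" if "g - d s \<notin> Q" for s using that by (simp add: gsupp_def)
  have "coords k (component_space R (gfree S d) g) ?I \<chi>"
    unfolding coords_def
  proof (intro conjI ballI)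
    show "bij_betw \<chi> (carrier (component_space R (gfree S d) g)) (?I \<rightarrow>\<^sub>E carrier k)"
    proof (rule bij_betw_byWitness[where f' = \<psi>])
      show "\<forall>f\<in>carrier (component_space R (gfree S d) g). \<psi> (\<chi> f) = f"
      proof (intro ballI ext)
        fix f s assume "f \<in> carrier (component_space R (gfree S d) g)"
        then have f: "f \<in> carrier (free_module R S)" "\<And>s. s \<in> S \<Longrightarrow> f s \<in> gcomp R (g - d s)"
          by (auto simp: gcomp_gfree)
        show "\<psi> (\<chi> f) s = f s"
        proof (cases "s \<in> ?T")
          case True
          then have "(\<lambda>i\<in>{..<rdim (g - d s)}. \<chi> f (s, i)) = c (g - d s) (f s)"
            using cm(1)[OF f(2), of s] by (auto simp: \<chi>_def fun_eq_iff PiE_iff extensional_def)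
          then show ?thesis using True cm(2)[OF f(2), of s] by (simp add: \<psi>_def)
        next
          case False
          then have "f s = \<zero>\<^bsub>R\<^esub>" using f z[of s] by (cases "s \<in> S") (auto simp: free_carrier)
          then show ?thesis using False by (auto simp: \<psi>_def)
        qed
      qed
      have r: "(\<lambda>i\<in>{..<rdim (g - d s)}. u (s, i)) \<in> {..<rdim (g - d s)} \<rightarrow>\<^sub>E carrier k"
        if "u \<in> ?I \<rightarrow>\<^sub>E carrier k" "s \<in> ?T" for u s
        using that by (auto simp: PiE_iff)
      show "\<forall>u\<in>?I \<rightarrow>\<^sub>E carrier k. \<chi> (\<psi> u) = u"
      proof (intro ballI ext)
        fix u :: "'s \<times> nat \<Rightarrow> 'k" and p :: "'s \<times> nat" assume u: "u \<in> ?I \<rightarrow>\<^sub>E carrier k"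
        obtain s i where p: "p = (s, i)" by (cases p)
        show "\<chi> (\<psi> u) p = u p"
        proof (cases "p \<in> ?I")
          case True
          then show ?thesis using im(2)[OF r[OF u, of s]] p by (simp add: \<chi>_def \<psi>_def)
        next
          case False
          then have "u p = undefined" by (rule PiE_arb[OF u])
          then show ?thesis using False unfolding \<chi>_def by simp
        qed
      qed
      show "\<chi> ` carrier (component_space R (gfree S d) g) \<subseteq> ?I \<rightarrow>\<^sub>E carrier k"
      proof (rule image_subsetI)
        fix f assume "f \<in> carrier (component_space R (gfree S d) g)"
        then have "\<And>s. s \<in> S \<Longrightarrow> f s \<in> gcomp R (g - d s)" by (auto simp: gcomp_gfree)
        then have "c (g - d s) (f s) i \<in> carrier k" if "s \<in> ?T" "i < rdim (g - d s)" for s i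
          using cm(1)[of "f s" "g - d s"] that by (auto simp: PiE_iff)
        then show "\<chi> f \<in> ?I \<rightarrow>\<^sub>E carrier k" by (auto simp: \<chi>_def)
      qed
      show "\<psi> ` (?I \<rightarrow>\<^sub>E carrier k) \<subseteq> carrier (component_space R (gfree S d) g)"
      proof (rule image_subsetI)
        fix u assume u: "u \<in> ?I \<rightarrow>\<^sub>E carrier k"
        have g: "\<psi> u s \<in> gcomp R (g - d s)" for s
          using im(1)[OF r[OF u, of s]] by (simp add: \<psi>_def)
        moreover have "finite {s. \<psi> u s \<noteq> \<zero>\<^bsub>R\<^esub>}"
          by (rule finite_subset[OF _ fin]) (auto simp: \<psi>_def)
        moreover have "\<psi> u s \<in> carrier R" for s by (rule gcomp_R_carrier[OF g])
        ultimately show "\<psi> u \<in> carrier (component_space R (gfree S d) g)"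
          by (auto simp: gcomp_gfree free_carrier) (simp add: \<psi>_def)
      qed
    qed
  next
    fix x y assume "x \<in> carrier (component_space R (gfree S d) g)" "y \<in> carrier (component_space R (gfree S d) g)"
    then have xy: "\<And>s. s \<in> S \<Longrightarrow> x s \<in> gcomp R (g - d s)" "\<And>s. s \<in> S \<Longrightarrow> y s \<in> gcomp R (g - d s)"
      by (auto simp: gcomp_gfree)
    have "c h (a \<oplus>\<^bsub>R\<^esub> b) = (\<lambda>i\<in>{..<rdim h}. c h a i \<oplus>\<^bsub>k\<^esub> c h b i)" if "a \<in> gcomp R h" "b \<in> gcomp R h" for h a b
      using c[of h] that by (simp add: coords_def)
    then show "\<chi> (x \<oplus>\<^bsub>component_space R (gfree S d) g\<^esub> y) = (\<lambda>i\<in>?I. \<chi> x i \<oplus>\<^bsub>k\<^esub> \<chi> y i)"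
      unfolding \<chi>_def by (intro restrict_ext) (clarsimp simp: xy)
  next
    fix a x assume "a \<in> carrier k" "x \<in> carrier (component_space R (gfree S d) g)"
    then have x: "\<And>s. s \<in> S \<Longrightarrow> x s \<in> gcomp R (g - d s)" and a: "a \<in> carrier k"
      by (auto simp: gcomp_gfree)
    have "c h (\<iota> a \<otimes>\<^bsub>R\<^esub> b) = (\<lambda>i\<in>{..<rdim h}. a \<otimes>\<^bsub>k\<^esub> c h b i)" if "b \<in> gcomp R h" for h b
      using c[of h] that a by (simp add: coords_def)
    then show "\<chi> (a \<odot>\<^bsub>component_space R (gfree S d) g\<^esub> x) = (\<lambda>i\<in>?I. a \<otimes>\<^bsub>k\<^esub> \<chi> x i)"
      unfolding \<chi>_def by (intro restrict_ext) (clarsimp simp: x)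
  qed
  then show ?thesis by blast
qed

text \<open>The condition on generators and their degrees under which the graded free module is BDF:
  admissible set of degrees, and finitely many generators in each degree.\<close>

definition bdf_index :: "'s set \<Rightarrow> ('s \<Rightarrow> 'g) \<Rightarrow> bool"
  where "bdf_index S d \<longleftrightarrow> Q.bounded_support (d ` S) \<and> (\<forall>g. finite {s \<in> S. d s = g})"

text \<open>The series summing \<open>t^(d s)\<close> over the generators. For an infinite fibre
  \<open>card\<close> would return 0, a case that \<open>bdf_index\<close> excludes.\<close>

definition cnt :: "'s set \<Rightarrow> ('s \<Rightarrow> 'g) \<Rightarrow> 'g \<Rightarrow> int"
  where "cnt S d g = int (card {s \<in> S. d s = g})"

lemma bdf_index_finite: "finite {s \<in> S. g - d s \<in> Q}" if "bdf_index S d"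
proof (rule finite_subset)
  have "finite {h \<in> d ` S. monoid_le Q h g}"
    using that by (simp add: bdf_index_def Q.bounded_support_def downward_finite_def)
  then show "finite (\<Union>h\<in>{h \<in> d ` S. monoid_le Q h g}. {s \<in> S. d s = h})"
    using that by (simp add: bdf_index_def)
qed (auto simp: monoid_le_def)

lemma cnt_nonzero: "bdf_index S d \<Longrightarrow> cnt S d g \<noteq> 0 \<longleftrightarrow> g \<in> d ` S"
  by (auto simp: cnt_def bdf_index_def card_eq_0_iff)

lemma cnt_carrier: "cnt S d \<in> carrier Q.A" if "bdf_index S d"
  using that by (simp add: Q.series_carrier cnt_nonzero) (simp add: bdf_index_def)

lemma gfree_dim:
  assumes "bdf_index S d"
  shows "vectorspace.fin_dim k (component_space R (gfree S d) g)"
    "vectorspace.dim k (component_space R (gfree S d) g) = (\<Sum>s\<in>{s \<in> S. g - d s \<in> Q}. rdim (g - d s))"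
proof -
  let ?I = "SIGMA s:{s \<in> S. g - d s \<in> Q}. {..<rdim (g - d s)}"
  interpret V: vectorspace k "component_space R (gfree S d) g" by (rule component_vectorspace[OF gfree_graded])
  have fin: "finite {s \<in> S. g - d s \<in> Q}" by (rule bdf_index_finite[OF assms])
  then obtain \<chi> where "coords k (component_space R (gfree S d) g) ?I \<chi>" using gfree_coords by blast
  moreover have "finite ?I" using fin by blast
  ultimately show "V.fin_dim" "V.dim = (\<Sum>s\<in>{s \<in> S. g - d s \<in> Q}. rdim (g - d s))"
    using V.coords_basis[of ?I \<chi>] fin by auto
qed

text \<open>A generator \<open>s\<close> contributes the Hilbert series of \<open>R\<close> shifted
  by \<open>d s\<close>; grouping the generators by degree turns the sum into a product of
  series.\<close>

lemma gfree_hilbert: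
  assumes "bdf_index S d"
  shows "hilbert_series k R (gfree S d) = cnt S d \<otimes>\<^bsub>Q.A\<^esub> HR"
proof
  fix u
  let ?T = "{s \<in> S. u - d s \<in> Q}"
  have T: "finite ?T" by (rule bdf_index_finite[OF assms])
  have "(cnt S d \<otimes>\<^bsub>Q.A\<^esub> HR) u = (\<Sum>g\<in>d ` ?T. cnt S d g * HR (u - g))"
  proof (rule Q.series_mult_eq)
    fix g assume "cnt S d g \<noteq> 0" "HR (u - g) \<noteq> 0"
    then show "g \<in> d ` ?T" using cnt_nonzero[OF assms] rdim_zero[of "u - g"] by (auto simp: HR_eq)
  qed (use T in simp)
  also have "\<dots> = (\<Sum>g\<in>d ` ?T. \<Sum>s\<in>{s \<in> ?T. d s = g}. int (rdim (u - d s)))"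
  proof (rule sum.cong[OF refl])
    fix g assume "g \<in> d ` ?T"
    then have "{s \<in> ?T. d s = g} = {s \<in> S. d s = g}" by auto
    then show "cnt S d g * HR (u - g) = (\<Sum>s\<in>{s \<in> ?T. d s = g}. int (rdim (u - d s)))"
      by (simp add: cnt_def HR_eq)
  qed
  also have "\<dots> = (\<Sum>s\<in>?T. int (rdim (u - d s)))" by (rule sum.image_gen[OF T, symmetric])
  finally show "hilbert_series k R (gfree S d) u = (cnt S d \<otimes>\<^bsub>Q.A\<^esub> HR) u"
    by (simp add: hilbert_series_def gfree_dim(2)[OF assms])
qed

lemma K_gfree: "K_series k R (gfree S d) = cnt S d" if "bdf_index S d"
proof -
  interpret A: cring Q.A by (rule Q.series_ring_cring)
  have "K_series k R (gfree S d) = (cnt S d \<otimes>\<^bsub>Q.A\<^esub> HR) \<otimes>\<^bsub>Q.A\<^esub> inv\<^bsub>Q.A\<^esub> HR"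
    by (simp add: K_series_def gfree_hilbert[OF that] HR_def[symmetric])
  also have "\<dots> = cnt S d"
    using HR_Units cnt_carrier[OF that]
    by (simp only: A.m_assoc A.Units_closed A.Units_inv_closed A.Units_r_inv A.r_one)
  finally show ?thesis .
qed

text \<open>A nonzero element of degree \<open>g\<close> has a nonzero coefficient at some
  \<open>s\<close>, so \<open>g\<close> is the sum of \<open>d s\<close> and an element of
  \<open>Q\<close>.\<close>

lemma gfree_bdf: "bdf k R (gfree S d)" if "bdf_index S d"
proof -
  have "gsupp (gfree S d) \<subseteq> {g + h | g h. g \<in> d ` S \<and> h \<in> Q}"
  proof
    fix g assume "g \<in> gsupp (gfree S d)"
    moreover have "\<zero>\<^bsub>gfree S d\<^esub> \<in> gcomp (gfree S d) g" by (rule graded_moduleD(3)[OF gfree_graded])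
    ultimately obtain f where f: "f \<in> gcomp (gfree S d) g" "f \<noteq> \<zero>\<^bsub>gfree S d\<^esub>" by (auto simp: gsupp_def)
    then obtain s where "f s \<noteq> \<zero>\<^bsub>R\<^esub>" by (auto simp: fun_eq_iff)
    then have "s \<in> S" "g - d s \<in> Q"
      using f(1) mem_Q[of "f s" "g - d s"] by (auto simp: gcomp_gfree free_carrier)
    moreover have "g = d s + (g - d s)" by simp
    ultimately show "g \<in> {g + h | g h. g \<in> d ` S \<and> h \<in> Q}" by blast
  qed
  moreover have "Q.bounded_support {g + h | g h. g \<in> d ` S \<and> h \<in> Q}"
    using that by (intro Q.bounded_support_plus Q.bounded_support_Q) (simp add: bdf_index_def)
  ultimately have "Q.bounded_support (gsupp (gfree S d))" by (rule Q.bounded_support_subset[rotated])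
  then show ?thesis using gfree_dim(1)[OF that] by (simp add: bdf_def Q.bounded_support_def)
qed

text \<open>Equal counts give bijections between the generators of each degree. Together they form a
  degree-preserving bijection of index sets, and reindexing along it is the isomorphism.\<close>

lemma gfree_iso:
  assumes S: "bdf_index S d" and S': "bdf_index S' d'" and eq: "cnt S d = cnt S' d'"
  shows "graded_isomorphic R (gfree S d) (gfree S' d')"
proof -
  have "\<exists>\<pi>. bij_betw \<pi> {s \<in> S'. d' s = g} {s \<in> S. d s = g}" for g
    using S S' fun_cong[OF eq, of g] by (intro finite_same_card_bij) (auto simp: bdf_index_def cnt_def)
  then obtain \<pi> where \<pi>: "\<And>g. bij_betw (\<pi> g) {s \<in> S'. d' s = g} {s \<in> S. d s = g}" by metis
  \<comment> \<open>The bijections in the single degrees are glued to one map; it runs from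
    \<open>S'\<close> to \<open>S\<close> because functions are pulled back along it.\<close>
  define p where "p s = \<pi> (d' s) s" for s
  have pm: "p s \<in> S" "d (p s) = d' s" if "s \<in> S'" for s
    using bij_betwE[OF \<pi>[of "d' s"]] that by (auto simp: p_def)
  have "bij_betw p S' S"
  proof (rule bij_betw_imageI)
    show "inj_on p S'"
    proof (rule inj_onI)
      fix s t assume st: "s \<in> S'" "t \<in> S'" "p s = p t"
      then have "d' s = d' t" using pm by metis
      with st \<pi>[of "d' s"] show "s = t" by (auto simp: p_def bij_betw_def dest: inj_onD)
    qed
    show "p ` S' = S"
    proof
      show "S \<subseteq> p ` S'"
      proof
        fix s assume "s \<in> S"
        then have "s \<in> \<pi> (d s) ` {t \<in> S'. d' t = d s}" using \<pi>[of "d s"] by (auto simp: bij_betw_def)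
        then obtain t where "t \<in> S'" "d' t = d s" "s = \<pi> (d s) t" by auto
        then show "s \<in> p ` S'" by (intro image_eqI[of _ _ t]) (simp_all add: p_def)
      qed
    qed (use pm in auto)
  qed
  define q where "q = inv_into S' p"
  have q: "\<And>s. s \<in> S \<Longrightarrow> q s \<in> S'" "\<And>s. s \<in> S \<Longrightarrow> p (q s) = s" "\<And>s. s \<in> S' \<Longrightarrow> q (p s) = s"
    using \<open>bij_betw p S' S\<close> by (auto simp: bij_betw_def q_def inv_into_into f_inv_into_f)
  have qd: "d' (q s) = d s" if "s \<in> S" for s using pm(2)[OF q(1)[OF that]] q(2)[OF that] by simp
  define \<phi> where "\<phi> f s = (if s \<in> S' then f (p s) else \<zero>\<^bsub>R\<^esub>)" for f :: "'a \<Rightarrow> 'r" and s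
  define \<psi> where "\<psi> f s = (if s \<in> S then f (q s) else \<zero>\<^bsub>R\<^esub>)" for f :: "'b \<Rightarrow> 'r" and s
  have \<phi>: "\<phi> f \<in> carrier (free_module R S')" if "f \<in> carrier (free_module R S)" for f
  proof -
    have "{s. \<phi> f s \<noteq> \<zero>\<^bsub>R\<^esub>} \<subseteq> q ` {s. f s \<noteq> \<zero>\<^bsub>R\<^esub>}"
      using q(3) by (auto simp: \<phi>_def image_iff) metis
    then have "finite {s. \<phi> f s \<noteq> \<zero>\<^bsub>R\<^esub>}" by (rule finite_subset) (use that in \<open>simp add: free_carrier\<close>)
    then show ?thesis unfolding free_carrier
      by (intro conjI allI impI) (use that in \<open>auto simp: free_carrier \<phi>_def\<close>)
  qed
  have \<psi>: "\<psi> f \<in> carrier (free_module R S)" if "f \<in> carrier (free_module R S')" for f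
  proof -
    have "{s. \<psi> f s \<noteq> \<zero>\<^bsub>R\<^esub>} \<subseteq> p ` {s. f s \<noteq> \<zero>\<^bsub>R\<^esub>}"
      using q(2) by (auto simp: \<psi>_def image_iff) metis
    then have "finite {s. \<psi> f s \<noteq> \<zero>\<^bsub>R\<^esub>}" by (rule finite_subset) (use that in \<open>simp add: free_carrier\<close>)
    then show ?thesis unfolding free_carrier
      by (intro conjI allI impI) (use that in \<open>auto simp: free_carrier \<psi>_def\<close>)
  qed
  have \<phi>g: "\<phi> f \<in> gcomp (gfree S' d') g" if f: "f \<in> gcomp (gfree S d) g" for f g
  proof -
    have "f (p s) \<in> gcomp R (g - d (p s))" if "s \<in> S'" for s
      using f pm(1)[OF that] by (simp add: gcomp_gfree)
    then show ?thesis using f pm(2) \<phi> by (simp add: gcomp_gfree) (simp add: \<phi>_def)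
  qed
  have \<psi>g: "\<psi> f \<in> gcomp (gfree S d) g" if f: "f \<in> gcomp (gfree S' d') g" for f g
  proof -
    have "f (q s) \<in> gcomp R (g - d' (q s))" if "s \<in> S" for s
      using f q(1)[OF that] by (simp add: gcomp_gfree)
    then show ?thesis using f qd \<psi> by (simp add: gcomp_gfree) (simp add: \<psi>_def)
  qed
  have "\<phi> \<in> module_hom R (gfree S d) (gfree S' d')"
    by (rule module_homI) (simp_all add: \<phi>, simp_all add: \<phi>_def fun_eq_iff)
  then have "\<phi> \<in> graded_hom R (gfree S d) (gfree S' d')"
    unfolding graded_hom_def using \<phi>g by auto
  moreover have "\<psi> \<in> module_hom R (gfree S' d') (gfree S d)"
    by (rule module_homI) (simp_all add: \<psi>, simp_all add: \<psi>_def fun_eq_iff)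
  then have "\<psi> \<in> graded_hom R (gfree S' d') (gfree S d)"
    unfolding graded_hom_def using \<psi>g by auto
  moreover have "\<forall>f\<in>carrier (gfree S d). \<psi> (\<phi> f) = f" "\<forall>f\<in>carrier (gfree S' d'). \<phi> (\<psi> f) = f"
    using q pm by (auto simp: \<phi>_def[abs_def] \<psi>_def[abs_def] free_carrier fun_eq_iff)
  ultimately show ?thesis unfolding graded_isomorphic_def
    by (intro bexI[of _ \<phi>] bexI[of _ \<psi>]) auto
qed

text \<open>Once a construction is known to be graded free on an admissible index set, its
  membership in the monoid and its \<open>K_series\<close> are read off here.\<close>

lemma gfree_type:
  assumes M: "is_graded_module k R M" and iso: "graded_isomorphic R (gfree S d) M" and S: "bdf_index S d"
  shows "bdf_projective k R M" "K_series k R M = cnt S d"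
proof -
  obtain \<phi> where \<phi>: "\<phi> \<in> module_hom R (gfree S d) M" "bij_betw \<phi> (carrier (gfree S d)) (carrier M)"
    by (rule graded_isoE'[OF iso gfree_graded M])
  have "projective_module R M" by (rule projective_if_free[OF graded_moduleD(1)[OF M] \<phi>])
  then show "bdf_projective k R M"
    using M iso_bdf(1)[OF gfree_graded M iso gfree_bdf[OF S]] by (simp add: bdf_projective_def)
  show "K_series k R M = cnt S d"
    using iso_bdf(3)[OF gfree_graded M iso gfree_bdf[OF S]] K_gfree[OF S] by simp
qed

end

section \<open>Projective modules are graded free\<close>

lemma finsum_mem:
  assumes "module R M" "W \<subseteq> carrier M" "\<zero>\<^bsub>M\<^esub> \<in> W" "\<And>x y. x \<in> W \<Longrightarrow> y \<in> W \<Longrightarrow> x \<oplus>\<^bsub>M\<^esub> y \<in> W"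
    and "\<And>i. i \<in> I \<Longrightarrow> f i \<in> W"
  shows "finsum M f I \<in> W"
proof -
  interpret M: module R M by fact
  show ?thesis using assms(5)
  proof (induction I rule: infinite_finite_induct)
    case (insert i I)
    have "f i \<in> carrier M" "f \<in> I \<rightarrow> carrier M" using insert.prems assms(2) by blast+
    then show ?case using insert assms(4) by (simp add: insert.prems)
  qed (simp_all add: assms(3))
qed

context abelian_group begin

lemma diff_eq_zero_iff: "a \<ominus> b = \<zero> \<longleftrightarrow> a = b" if "a \<in> carrier G" "b \<in> carrier G"
proof
  assume "a \<ominus> b = \<zero>"
  then have "\<ominus> (\<ominus> b) = a" using that by (intro minus_equality) (simp_all add: minus_eq)
  then show "a = b" using that by simp
qed (use that in \<open>simp add: minus_eq r_neg\<close>)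

lemma diff_zero: "a \<ominus> \<zero> = a" if "a \<in> carrier G"
proof -
  have "\<ominus> \<zero> = \<zero>" by (rule minus_equality) simp_all
  then show ?thesis using that by (simp add: minus_eq)
qed

end

context pointed_monoid begin

text \<open>Induction on the number of elements of \<open>U\<close> below \<open>g\<close>, which is
  finite and drops strictly.\<close>

lemma degree_induct [consumes 2]:
  assumes U: "downward_finite Q U" and "g \<in> U"
    and step: "\<And>g. g \<in> U \<Longrightarrow> (\<And>h. h \<in> U \<Longrightarrow> monoid_le Q h g \<Longrightarrow> h \<noteq> g \<Longrightarrow> P h) \<Longrightarrow> P g"
  shows "P g"
  using \<open>g \<in> U\<close>
proof (induction "card {u \<in> U. monoid_le Q u g}" arbitrary: g rule: less_induct)
  case less
  show ?case
    by (rule step[OF less.prems]) (rule less.hyps[OF card_below_less[OF U less.prems]])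
qed

end

context pdcf_algebra begin

text \<open>\<open>decomposable M g\<close> is the degree \<open>g\<close> component of \<open>\<mm>M\<close>, for \<open>\<mm>\<close> the ideal spanned by the components of nonzero degree.\<close>

inductive_set decomposable :: "('r, 'm, 'g) graded_module \<Rightarrow> 'g \<Rightarrow> 'm set"
  for M :: "('r, 'm, 'g) graded_module" and g where
  zero: "\<zero>\<^bsub>M\<^esub> \<in> decomposable M g"
| gen: "h \<noteq> g \<Longrightarrow> r \<in> gcomp R (g - h) \<Longrightarrow> x \<in> gcomp M h \<Longrightarrow> r \<odot>\<^bsub>M\<^esub> x \<in> decomposable M g"
| add: "x \<in> decomposable M g \<Longrightarrow> y \<in> decomposable M g \<Longrightarrow> x \<oplus>\<^bsub>M\<^esub> y \<in> decomposable M g"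
| smult: "c \<in> carrier k \<Longrightarrow> x \<in> decomposable M g \<Longrightarrow> \<iota> c \<odot>\<^bsub>M\<^esub> x \<in> decomposable M g"

lemma decomposable_gcomp:
  assumes M: "is_graded_module k R M" and "x \<in> decomposable M g"
  shows "x \<in> gcomp M g"
  using assms(2)
proof induction
  case (gen h r x)
  then show ?case using graded_moduleD(7)[OF M, of r "g - h" x h] by simp
qed (simp_all add: graded_moduleD(3-5)[OF M])

lemma finsum_component:
  assumes M: "is_graded_module k R M" and f: "\<And>i. i \<in> I \<Longrightarrow> f i \<in> gcomp M g"
  shows "finsum (component_space R M g) f I = finsum M f I"
proof -
  interpret M: module R M using graded_moduleD(1)[OF M] .
  interpret V: vectorspace k "component_space R M g" by (rule component_vectorspace[OF M])
  show ?thesis using f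
  proof (induction I rule: infinite_finite_induct)
    case (insert i I)
    have "f \<in> insert i I \<rightarrow> gcomp M g" "f \<in> insert i I \<rightarrow> carrier M"
      using insert.prems graded_moduleD(2)[OF M insert.prems] by auto
    then show ?case using insert by (simp add: Pi_iff)
  qed simp_all
qed

text \<open>A lifted basis of the degree \<open>g\<close> part of the quotient of \<open>M\<close>
  by the decomposable elements, with linear combinations rewritten as sums in
  \<open>M\<close>.\<close>

lemma basis_mod_decomposable:
  assumes M: "is_graded_module k R M" and fd: "vectorspace.fin_dim k (component_space R M g)"
  shows "\<exists>B. finite B \<and> B \<subseteq> gcomp M g \<and>
    (\<forall>x\<in>gcomp M g. \<exists>c\<in>B \<rightarrow> carrier k. \<exists>y\<in>decomposable M g. x = finsum M (\<lambda>b. \<iota> (c b) \<odot>\<^bsub>M\<^esub> b) B \<oplus>\<^bsub>M\<^esub> y) \<and>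
    (\<forall>c\<in>B \<rightarrow> carrier k. finsum M (\<lambda>b. \<iota> (c b) \<odot>\<^bsub>M\<^esub> b) B \<in> decomposable M g \<longrightarrow> (\<forall>b\<in>B. c b = \<zero>\<^bsub>k\<^esub>))"
proof -
  interpret V: vectorspace k "component_space R M g" by (rule component_vectorspace[OF M])
  have "subspace k (decomposable M g) (component_space R M g)"
    unfolding subspace_def submodule_def
    using component_vectorspace[OF M, of g] decomposable_gcomp[OF M]
    by (auto simp: vectorspace_def intro: decomposable.intros)
  from V.complement_exists[OF fd this] obtain B where B: "finite B" "B \<subseteq> gcomp M g"
    "\<And>x. x \<in> gcomp M g \<Longrightarrow> \<exists>c\<in>B \<rightarrow> carrier k. \<exists>y\<in>decomposable M g. x = V.lincomb c B \<oplus>\<^bsub>M\<^esub> y"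
    "\<And>c. c \<in> B \<rightarrow> carrier k \<Longrightarrow> V.lincomb c B \<in> decomposable M g \<Longrightarrow> \<forall>b\<in>B. c b = \<zero>\<^bsub>k\<^esub>"
    by auto
  have l: "V.lincomb c B = finsum M (\<lambda>b. \<iota> (c b) \<odot>\<^bsub>M\<^esub> b) B" if "c \<in> B \<rightarrow> carrier k" for c
    unfolding V.lincomb_def component_simps
    by (rule finsum_component[OF M]) (use that B(2) graded_moduleD(5)[OF M] in blast)
  show ?thesis
  proof (intro exI[of _ B] conjI ballI impI)
    fix x assume "x \<in> gcomp M g"
    from B(3)[OF this] obtain c y where "c \<in> B \<rightarrow> carrier k" "y \<in> decomposable M g" "x = V.lincomb c B \<oplus>\<^bsub>M\<^esub> y"
      by blast
    then show "\<exists>c\<in>B \<rightarrow> carrier k. \<exists>y\<in>decomposable M g. x = finsum M (\<lambda>b. \<iota> (c b) \<odot>\<^bsub>M\<^esub> b) B \<oplus>\<^bsub>M\<^esub> y"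
      by (intro bexI[of _ c] bexI[of _ y]) (simp_all only: l)
  next
    fix c b assume "c \<in> B \<rightarrow> carrier k" "finsum M (\<lambda>b. \<iota> (c b) \<odot>\<^bsub>M\<^esub> b) B \<in> decomposable M g" "b \<in> B"
    then show "c b = \<zero>\<^bsub>k\<^esub>" using B(4)[of c] by (simp only: l)
  qed (use B in auto)
qed

lemma hcomp_finsum:
  assumes M: "is_graded_module k R M" and f: "f \<in> I \<rightarrow> carrier M"
  shows "hcomp M (finsum M f I) g = finsum M (\<lambda>i. hcomp M (f i) g) I"
proof -
  interpret M: module R M using graded_moduleD(1)[OF M] .
  have z: "hcomp M \<zero>\<^bsub>M\<^esub> g = \<zero>\<^bsub>M\<^esub>"
    using hcomp_homogeneous[OF M graded_moduleD(3)[OF M], of 0] by simp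
  show ?thesis using f
  proof (induction I rule: infinite_finite_induct)
    case (insert i I)
    then have "f i \<in> carrier M" "f \<in> I \<rightarrow> carrier M" by auto
    then show ?case using insert hcomp_carrier[OF M]
      by (subst M.finsum_insert, simp_all add: hcomp_add[OF M] Pi_iff)
  qed (simp_all add: z)
qed

text \<open>Lifted bases of the quotient by the decomposable elements generate \<open>M\<close> in
  all degrees. The last conclusion is minimality: in a homogeneous relation, the generators of the
  degree of the relation have coefficient zero.\<close>

lemma projective_cover:
  fixes M :: "('r, 'm, 'g) graded_module"
  assumes M: "is_graded_module k R M" and bdf: "bdf k R M"
  obtains S :: "('g \<times> 'm) set" where
    "\<And>s. s \<in> S \<Longrightarrow> snd s \<in> gcomp M (fst s)" "\<And>s. s \<in> S \<Longrightarrow> fst s \<in> gsupp M"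
    "bdf_index S fst"
    "\<And>x. x \<in> carrier M \<Longrightarrow> \<exists>f\<in>carrier (free_module R S). free_module_eval R M snd f = x"
    "\<And>f g s. f \<in> gcomp (gfree S fst) g \<Longrightarrow> free_module_eval R M snd f = \<zero>\<^bsub>M\<^esub> \<Longrightarrow> s \<in> S \<Longrightarrow> fst s = g \<Longrightarrow> f s = \<zero>\<^bsub>R\<^esub>"
proof -
  have Mm: "module R M" by (rule graded_moduleD(1)[OF M])
  interpret M: module R M by (rule Mm)
  have fd: "vectorspace.fin_dim k (component_space R M g)" for g using bdf by (simp add: bdf_def)
  define P where "P g B \<longleftrightarrow> finite B \<and> B \<subseteq> gcomp M g \<and>
    (\<forall>x\<in>gcomp M g. \<exists>c\<in>B \<rightarrow> carrier k. \<exists>y\<in>decomposable M g. x = finsum M (\<lambda>b. \<iota> (c b) \<odot>\<^bsub>M\<^esub> b) B \<oplus>\<^bsub>M\<^esub> y) \<and>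
    (\<forall>c\<in>B \<rightarrow> carrier k. finsum M (\<lambda>b. \<iota> (c b) \<odot>\<^bsub>M\<^esub> b) B \<in> decomposable M g \<longrightarrow> (\<forall>b\<in>B. c b = \<zero>\<^bsub>k\<^esub>))"
    for g B
  have "\<exists>B. P g B" for g unfolding P_def by (rule basis_mod_decomposable[OF M fd])
  then obtain B where BP: "\<And>g. P g (B g)" by metis
  note BP' = BP[unfolded P_def]
  have B1: "finite (B g)" for g by (rule conjunct1[OF BP'])
  have B2: "B g \<subseteq> gcomp M g" for g by (rule conjunct1[OF conjunct2[OF BP']])
  note B = B1 B2
  have span: "\<exists>c\<in>B g \<rightarrow> carrier k. \<exists>y\<in>decomposable M g. x = finsum M (\<lambda>b. \<iota> (c b) \<odot>\<^bsub>M\<^esub> b) (B g) \<oplus>\<^bsub>M\<^esub> y"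
    if "x \<in> gcomp M g" for g x
    by (rule bspec[OF conjunct1[OF conjunct2[OF conjunct2[OF BP']]] that])
  have ind: "c b = \<zero>\<^bsub>k\<^esub>"
    if c: "c \<in> B g \<rightarrow> carrier k" and D: "finsum M (\<lambda>b. \<iota> (c b) \<odot>\<^bsub>M\<^esub> b) (B g) \<in> decomposable M g" and b: "b \<in> B g" for g c b
    by (rule bspec[OF mp[OF bspec[OF conjunct2[OF conjunct2[OF conjunct2[OF BP']]] c] D] b])
  have gc: "x \<in> carrier M" if "x \<in> gcomp M g" for x g by (rule graded_moduleD(2)[OF M that])
  \<comment> \<open>A generator is stored together with its degree, so that \<open>fst\<close> is
    the degree function and \<open>snd\<close> the evaluation on generators.\<close>
  define S where "S = Sigma UNIV B"
  have Sg: "snd s \<in> gcomp M (fst s)" if "s \<in> S" for s using that B(2)[of "fst s"] by (auto simp: S_def)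
  have supp: "fst s \<in> gsupp M" if s: "s \<in> S" for s
  proof -
    obtain g b where gb: "s = (g, b)" "b \<in> B g" using s by (auto simp: S_def)
    have "b \<noteq> \<zero>\<^bsub>M\<^esub>"
    proof
      assume b0: "b = \<zero>\<^bsub>M\<^esub>"
      \<comment> \<open>If \<open>b\<close> were zero, the indicator of \<open>b\<close> would be a
        nontrivial relation with sum zero. Hence generators are nonzero and their degrees lie in the
        support of \<open>M\<close>.\<close>
      let ?c = "\<lambda>b'. if b' = b then \<one>\<^bsub>k\<^esub> else \<zero>\<^bsub>k\<^esub>"
      have "finsum M (\<lambda>b. \<iota> (?c b) \<odot>\<^bsub>M\<^esub> b) (B g) = finsum M (\<lambda>_. \<zero>\<^bsub>M\<^esub>) (B g)"
        using B(2)[of g] gc b0 by (intro M.finsum_cong') auto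
      then have "finsum M (\<lambda>b. \<iota> (?c b) \<odot>\<^bsub>M\<^esub> b) (B g) \<in> decomposable M g"
        by (simp add: decomposable.zero)
      from ind[OF _ this gb(2)] show False by simp
    qed
    then show ?thesis using Sg[OF s] gb by (auto simp: gsupp_def)
  qed
  have idx: "bdf_index S fst"
    unfolding bdf_index_def
  proof (intro conjI allI)
    have "Q.bounded_support (gsupp M)" using bdf by (simp add: bdf_def Q.bounded_support_def)
    then show "Q.bounded_support (fst ` S)" by (rule Q.bounded_support_subset) (use supp in auto)
    have "{s \<in> S. fst s = g} = Pair g ` B g" for g by (auto simp: S_def)
    then show "finite {s \<in> S. fst s = g}" for g using B(1) by simp
  qed
  have sS: "snd \<in> S \<rightarrow> carrier M" using Sg gc by blast
  let ?\<phi> = "free_module_eval R M snd"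
  have \<phi>: "?\<phi> \<in> module_hom R (free_module R S) M" by (rule free_module_eval_hom[OF Mm sS])
  interpret \<phi>: mod_hom R "free_module R S" M ?\<phi>
    using \<phi> Mm free_module_is_module[OF cring_R] by (simp add: mod_hom_def mod_hom_axioms_def)
  define im where "im = ?\<phi> ` carrier (free_module R S)"
  have im_add: "x \<oplus>\<^bsub>M\<^esub> y \<in> im" if "x \<in> im" "y \<in> im" for x y
    using that \<phi>.im_is_submodule unfolding \<phi>.im_def im_def submodule_def by blast
  have im_smult: "r \<odot>\<^bsub>M\<^esub> x \<in> im" if "r \<in> carrier R" "x \<in> im" for r x
    using that \<phi>.im_is_submodule unfolding \<phi>.im_def im_def submodule_def by blast
  have im_zero: "\<zero>\<^bsub>M\<^esub> \<in> im"
    using \<phi>.im_is_submodule unfolding \<phi>.im_def im_def submodule_def by blast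
  have im_sub: "im \<subseteq> carrier M"
    using \<phi>.im_is_submodule unfolding \<phi>.im_def im_def submodule_def by blast
  have im_sum: "finsum M f I \<in> im" if "\<And>i. i \<in> I \<Longrightarrow> f i \<in> im" for f and I :: "'i set"
    by (rule finsum_mem[OF Mm im_sub im_zero im_add that])
  have im_basis: "b \<in> im" if "b \<in> B g" for b g
  proof -
    have s: "(g, b) \<in> S" using that by (simp add: S_def)
    have "?\<phi> (\<delta> (g, b)) = b" using eval_at_\<delta>[OF Mm, of snd "(g, b)"] gc[OF Sg[OF s]] by simp
    then show ?thesis using \<delta>_carrier[OF s] unfolding im_def by (metis imageI)
  qed
  have im_supp: "gcomp M g \<subseteq> im" if "g \<in> gsupp M" for g
  proof -
    have "downward_finite Q (gsupp M)" using bdf by (simp add: bdf_def)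
    then show ?thesis using that
    proof (induction rule: Q.degree_induct)
      case (1 g)
      have D: "y \<in> im" if "y \<in> decomposable M g" for y
        using that
      proof induction
        case (gen h r x)
        have rc: "r \<in> carrier R" by (rule gcomp_R_carrier[OF gen(2)])
        show ?case
        proof (cases "r = \<zero>\<^bsub>R\<^esub> \<or> x = \<zero>\<^bsub>M\<^esub>")
          case True
          then show ?thesis using rc gc[OF gen(3)] im_zero by auto
        next
          case False
          \<comment> \<open>With both factors nonzero, \<open>h\<close> is in the support and
            \<open>g - h\<close> in \<open>Q\<close>. So \<open>h\<close> is strictly below
            \<open>g\<close>, and the induction hypothesis applies to \<open>x\<close>.\<close>
          then have "h \<in> gsupp M" "monoid_le Q h g"
            using gen mem_Q[OF gen(2)] by (auto simp: gsupp_def monoid_le_def)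
          then have "x \<in> im" using 1(2) gen by blast
          then show ?thesis using im_smult rc by blast
        qed
      qed (use im_zero im_add im_smult in auto)
      show ?case
      proof
        fix x assume "x \<in> gcomp M g"
        from span[OF this] obtain c y where c: "c \<in> B g \<rightarrow> carrier k" "y \<in> decomposable M g"
          "x = finsum M (\<lambda>b. \<iota> (c b) \<odot>\<^bsub>M\<^esub> b) (B g) \<oplus>\<^bsub>M\<^esub> y" by blast
        have "finsum M (\<lambda>b. \<iota> (c b) \<odot>\<^bsub>M\<^esub> b) (B g) \<in> im"
          using c(1) by (intro im_sum im_smult im_basis \<iota>_closed) auto
        then show "x \<in> im" unfolding c(3) using D[OF c(2)] by (rule im_add)
      qed
    qed
  qed
  have im_g: "gcomp M g \<subseteq> im" for g
    using im_supp[of g] im_zero by (cases "g \<in> gsupp M") (auto simp: gsupp_def)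
  have surj: "\<exists>f\<in>carrier (free_module R S). ?\<phi> f = x" if x: "x \<in> carrier M" for x
  proof -
    have "finsum M (hcomp M x) {g. hcomp M x g \<noteq> \<zero>\<^bsub>M\<^esub>} \<in> im"
      by (rule im_sum) (use im_g hcomp_props(1)[OF M x] in blast)
    then have "x \<in> im" using hcomp_props(3)[OF M x] by simp
    then show ?thesis by (auto simp: im_def)
  qed
  have min: "f s = \<zero>\<^bsub>R\<^esub>"
    if f: "f \<in> gcomp (gfree S fst) g" and f0: "?\<phi> f = \<zero>\<^bsub>M\<^esub>" and s: "s \<in> S" "fst s = g" for f g s
  proof -
    have fc: "f \<in> carrier (free_module R S)" and fg: "\<And>t. t \<in> S \<Longrightarrow> f t \<in> gcomp R (g - fst t)"
      using f by (auto simp: gcomp_gfree)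
    \<comment> \<open>The relation is split into the generators of degree \<open>g\<close>,
      collected in \<open>T\<close>, and the remaining ones, whose terms are decomposable. Therefore
      the sum over \<open>T\<close> is decomposable too.\<close>
    define Y where "Y = {t. f t \<noteq> \<zero>\<^bsub>R\<^esub> \<and> fst t \<noteq> g}"
    define T where "T = Pair g ` B g"
    have Y: "finite Y" "Y \<subseteq> S"
      using fc unfolding Y_def free_carrier by (auto intro: finite_subset[of _ "{s. f s \<noteq> \<zero>\<^bsub>R\<^esub>}"])
    have T: "finite T" "T \<subseteq> S" using B(1) by (auto simp: T_def S_def)
    have fR: "f t \<in> carrier R" for t using fc unfolding free_carrier by blast
    have trm: "f t \<odot>\<^bsub>M\<^esub> snd t \<in> carrier M" if "t \<in> S" for t using fR gc[OF Sg[OF that]] by simp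
    have "{t. f t \<noteq> \<zero>\<^bsub>R\<^esub>} \<subseteq> T \<union> Y"
    proof
      fix t assume "t \<in> {t. f t \<noteq> \<zero>\<^bsub>R\<^esub>}"
      then have nz: "f t \<noteq> \<zero>\<^bsub>R\<^esub>" by simp
      then have "t \<in> S" using fc unfolding free_carrier by blast
      then obtain a b where t: "t = (a, b)" "b \<in> B a" by (auto simp: S_def)
      show "t \<in> T \<union> Y"
      proof (cases "a = g")
        case True
        then show ?thesis using t by (simp add: T_def)
      next
        case False
        then show ?thesis using t nz by (simp add: Y_def)
      qed
    qed
    then have "?\<phi> f = finsum M (\<lambda>t. f t \<odot>\<^bsub>M\<^esub> snd t) (T \<union> Y)"
      using Y T by (intro free_module_eval_eq[OF Mm sS fc]) auto
    also have "\<dots> = finsum M (\<lambda>t. f t \<odot>\<^bsub>M\<^esub> snd t) T \<oplus>\<^bsub>M\<^esub> finsum M (\<lambda>t. f t \<odot>\<^bsub>M\<^esub> snd t) Y"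
    proof (rule M.finsum_Un_disjoint[OF T(1) Y(1)])
      show "T \<inter> Y = {}" by (auto simp: T_def Y_def)
      show "(\<lambda>t. f t \<odot>\<^bsub>M\<^esub> snd t) \<in> T \<rightarrow> carrier M" by (rule Pi_I, rule trm, rule subsetD[OF T(2)])
      show "(\<lambda>t. f t \<odot>\<^bsub>M\<^esub> snd t) \<in> Y \<rightarrow> carrier M" by (rule Pi_I, rule trm, rule subsetD[OF Y(2)])
    qed
    finally have sum0: "finsum M (\<lambda>t. f t \<odot>\<^bsub>M\<^esub> snd t) T \<oplus>\<^bsub>M\<^esub> finsum M (\<lambda>t. f t \<odot>\<^bsub>M\<^esub> snd t) Y = \<zero>\<^bsub>M\<^esub>"
      unfolding f0 by (rule sym)
    have Dsub: "decomposable M g \<subseteq> carrier M" using decomposable_gcomp[OF M] gc by blast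
    have YD: "finsum M (\<lambda>t. f t \<odot>\<^bsub>M\<^esub> snd t) Y \<in> decomposable M g"
    proof (rule finsum_mem[OF Mm Dsub decomposable.zero decomposable.add])
      fix t assume t: "t \<in> Y"
      then have "t \<in> S" "fst t \<noteq> g" using Y by (auto simp: Y_def)
      then show "f t \<odot>\<^bsub>M\<^esub> snd t \<in> decomposable M g"
        using fg Sg by (intro decomposable.gen[of "fst t"]) auto
    qed
    have Tc: "finsum M (\<lambda>t. f t \<odot>\<^bsub>M\<^esub> snd t) T \<in> carrier M" using T trm by (intro M.finsum_closed) auto
    have "finsum M (\<lambda>t. f t \<odot>\<^bsub>M\<^esub> snd t) T = \<ominus>\<^bsub>M\<^esub> finsum M (\<lambda>t. f t \<odot>\<^bsub>M\<^esub> snd t) Y"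
      using sum0 Tc YD Dsub by (intro M.minus_equality[symmetric]) auto
    \<comment> \<open>Decomposable elements are closed under scalars from the field, so the negative
      is written as multiplication by the scalar \<open>-1\<close>.\<close>
    also have "\<dots> = \<iota> (\<ominus>\<^bsub>k\<^esub> \<one>\<^bsub>k\<^esub>) \<odot>\<^bsub>M\<^esub> finsum M (\<lambda>t. f t \<odot>\<^bsub>M\<^esub> snd t) Y"
    proof -
      have "\<iota> (\<ominus>\<^bsub>k\<^esub> \<one>\<^bsub>k\<^esub>) = \<ominus>\<^bsub>R\<^esub> \<one>\<^bsub>R\<^esub>" by (simp add: \<iota>_def kR.smult_l_minus)
      then show ?thesis using YD Dsub by (simp add: M.smult_l_minus subset_iff)
    qed
    also have "\<dots> \<in> decomposable M g" using YD by (intro decomposable.smult) auto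
    finally have TD: "finsum M (\<lambda>t. f t \<odot>\<^bsub>M\<^esub> snd t) T \<in> decomposable M g" .
    \<comment> \<open>A generator of degree \<open>g\<close> has its coefficient in degree 0, hence
      in \<open>k\<close>. The sum over \<open>T\<close> becomes a linear combination of the basis,
      and independence applies.\<close>
    have "\<exists>c\<in>carrier k. f (g, b) = \<iota> c" if "b \<in> B g" for b
      using fg[of "(g, b)"] that gcomp_R_0 by (auto simp: S_def)
    then obtain c where c: "\<And>b. b \<in> B g \<Longrightarrow> c b \<in> carrier k" "\<And>b. b \<in> B g \<Longrightarrow> f (g, b) = \<iota> (c b)"
      by metis
    have "finsum M (\<lambda>t. f t \<odot>\<^bsub>M\<^esub> snd t) T = finsum M (\<lambda>b. f (g, b) \<odot>\<^bsub>M\<^esub> b) (B g)"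
      unfolding T_def using fR B(2)[of g] gc by (subst M.finsum_reindex) (auto simp: inj_on_def)
    also have "\<dots> = finsum M (\<lambda>b. \<iota> (c b) \<odot>\<^bsub>M\<^esub> b) (B g)"
      using c B(2)[of g] gc by (intro M.finsum_cong') auto
    finally have "finsum M (\<lambda>b. \<iota> (c b) \<odot>\<^bsub>M\<^esub> b) (B g) \<in> decomposable M g" using TD by simp
    moreover obtain b where b: "b \<in> B g" "s = (g, b)" using s by (auto simp: S_def)
    ultimately have "c b = \<zero>\<^bsub>k\<^esub>" using ind[of c g b] c(1) by blast
    then show ?thesis using b c(2) by simp
  qed
  show thesis
    by (rule that[of S], rule Sg, assumption, rule supp, assumption, rule idx, rule surj, assumption, rule min)
qed

lemma eval_gcomp:
  assumes M: "is_graded_module k R M" and b: "\<And>s. s \<in> S \<Longrightarrow> b s \<in> gcomp M (d s)"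
    and f: "f \<in> gcomp (gfree S d) g"
  shows "free_module_eval R M b f \<in> gcomp M g"
  unfolding free_module_eval_def
proof (rule gcomp_finsum[OF M])
  fix s assume "s \<in> {m. f m \<noteq> \<zero>\<^bsub>R\<^esub>}"
  then have "s \<in> S" "f s \<in> gcomp R (g - d s)" using f by (auto simp: gcomp_gfree free_carrier)
  then show "f s \<odot>\<^bsub>M\<^esub> b s \<in> gcomp M g" using graded_moduleD(7)[OF M _ b, of "f s" "g - d s" s] by simp
qed

text \<open>Evaluation on homogeneous generators is a graded map, so its kernel contains the
  components of its elements. Injectivity therefore needs to be known only for homogeneous
  elements.\<close>

lemma graded_iso_from_eval:
  assumes M: "is_graded_module k R M" and b: "\<And>s. s \<in> S \<Longrightarrow> b s \<in> gcomp M (d s)"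
    and surj: "\<And>x. x \<in> carrier M \<Longrightarrow> \<exists>f\<in>carrier (free_module R S). free_module_eval R M b f = x"
    and inj: "\<And>g f. f \<in> gcomp (gfree S d) g \<Longrightarrow> free_module_eval R M b f = \<zero>\<^bsub>M\<^esub> \<Longrightarrow> f = (\<lambda>_. \<zero>\<^bsub>R\<^esub>)"
  shows "graded_isomorphic R (gfree S d) M"
proof -
  let ?\<phi> = "free_module_eval R M b"
  have Mm: "module R M" by (rule graded_moduleD(1)[OF M])
  have bS: "b \<in> S \<rightarrow> carrier M" using graded_moduleD(2)[OF M b] by blast
  have \<phi>: "?\<phi> \<in> module_hom R (gfree S d) M"
    unfolding gfree_hom_iff by (rule free_module_eval_hom[OF Mm bS])
  interpret F: module R "gfree S d" by (rule gfree_module)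
  interpret M': module R M by (rule Mm)
  interpret \<phi>: mod_hom R "gfree S d" M ?\<phi>
    using \<phi> Mm gfree_module by (simp add: mod_hom_def mod_hom_axioms_def)
  have eg: "?\<phi> f \<in> gcomp M g" if "f \<in> gcomp (gfree S d) g" for f g
    by (rule eval_gcomp[OF M _ that]) (rule b)
  have hc: "hcomp M (?\<phi> u) g = ?\<phi> (hcomp (gfree S d) u g)" if "u \<in> carrier (gfree S d)" for u g
    by (rule hcomp_hom[OF gfree_graded M \<phi> eg that])
  have ker: "u = \<zero>\<^bsub>gfree S d\<^esub>" if u: "u \<in> carrier (gfree S d)" and u0: "?\<phi> u = \<zero>\<^bsub>M\<^esub>" for u
  proof -
    have "?\<phi> (hcomp (gfree S d) u g) = \<zero>\<^bsub>M\<^esub>" for g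
      using hc[OF u, of g] hcomp_homogeneous[OF M graded_moduleD(3)[OF M], of 0] u0 by simp
    then have z: "hcomp (gfree S d) u g = \<zero>\<^bsub>gfree S d\<^esub>" for g
      using inj[OF hcomp_props(1)[OF gfree_graded u]] by simp
    show ?thesis
      by (rule trans[OF hcomp_sum[OF gfree_graded u finite.emptyI]]) (simp_all add: z del: gfree_simps(3))
  qed
  have "inj_on ?\<phi> (carrier (gfree S d))"
  proof (rule inj_onI)
    fix u v assume uv: "u \<in> carrier (gfree S d)" "v \<in> carrier (gfree S d)" "?\<phi> u = ?\<phi> v"
    have "?\<phi> (u \<ominus>\<^bsub>gfree S d\<^esub> v) = ?\<phi> u \<ominus>\<^bsub>M\<^esub> ?\<phi> v" using uv(1,2) by (rule \<phi>.f_minus)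
    also have "\<dots> = \<zero>\<^bsub>M\<^esub>" using uv M'.diff_eq_zero_iff \<phi>.f_im by metis
    finally have "u \<ominus>\<^bsub>gfree S d\<^esub> v = \<zero>\<^bsub>gfree S d\<^esub>" using uv by (intro ker F.minus_closed)
    then show "u = v" using uv(1,2) by (simp only: F.diff_eq_zero_iff)
  qed
  moreover have "?\<phi> ` carrier (gfree S d) = carrier M"
  proof
    show "carrier M \<subseteq> ?\<phi> ` carrier (gfree S d)"
    proof
      fix x assume "x \<in> carrier M"
      from surj[OF this] obtain f where "f \<in> carrier (free_module R S)" "?\<phi> f = x" by blast
      then show "x \<in> ?\<phi> ` carrier (gfree S d)" by (intro image_eqI[of _ _ f]) simp_all
    qed
  qed (use \<phi>.f_im in blast)
  ultimately have bij: "bij_betw ?\<phi> (carrier (gfree S d)) (carrier M)" by (simp add: bij_betw_def)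
  have im: "?\<phi> ` gcomp (gfree S d) g = gcomp M g" for g
  proof
    show "?\<phi> ` gcomp (gfree S d) g \<subseteq> gcomp M g" using eg by blast
    show "gcomp M g \<subseteq> ?\<phi> ` gcomp (gfree S d) g"
    proof
      fix x assume x: "x \<in> gcomp M g"
      then obtain u where u: "u \<in> carrier (gfree S d)" "?\<phi> u = x"
        using surj graded_moduleD(2)[OF M x] by auto
      have "x = ?\<phi> (hcomp (gfree S d) u g)"
        using hc[OF u(1), of g] hcomp_homogeneous[OF M x] u(2) by simp
      then show "x \<in> ?\<phi> ` gcomp (gfree S d) g" using hcomp_props(1)[OF gfree_graded u(1)] by (rule image_eqI)
    qed
  qed
  show ?thesis by (rule graded_isoI[OF gfree_module \<phi> bij _ im]) (auto simp: gcomp_gfree)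
qed

text \<open>The splitting \<open>\<sigma>\<close> need not be graded. It is enough that \<open>\<pi> = id - \<sigma>\<phi>\<close> fixes the kernel and maps into it: a homogeneous \<open>f\<close> in the kernel is \<open>\<Sum> f s \<cdot> \<pi> (\<delta> s)\<close>, and in the degree of \<open>f\<close> only the components of \<open>\<pi> (\<delta> s)\<close> in the smaller degrees \<open>d s\<close> contribute, which lie in the kernel and vanish by induction.\<close>

lemma bdf_projective_free:
  fixes M :: "('r, 'm, 'g) graded_module"
  assumes P: "bdf_projective k R M"
  shows "\<exists>S :: ('g \<times> 'm) set. bdf_index S fst \<and> graded_isomorphic R (gfree S fst) M"
proof -
  have M: "is_graded_module k R M" and bdf: "bdf k R M" and proj: "projective_module R M"
    using P by (simp_all add: bdf_projective_def)
  obtain S where Sg: "\<And>s. s \<in> S \<Longrightarrow> snd s \<in> gcomp M (fst s)" and supp: "\<And>s. s \<in> S \<Longrightarrow> fst s \<in> gsupp M"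
    and idx: "bdf_index S fst"
    and surj: "\<And>x. x \<in> carrier M \<Longrightarrow> \<exists>f\<in>carrier (free_module R S). free_module_eval R M snd f = x"
    and min: "\<And>f g s. f \<in> gcomp (gfree S fst) g \<Longrightarrow> free_module_eval R M snd f = \<zero>\<^bsub>M\<^esub> \<Longrightarrow> s \<in> S \<Longrightarrow> fst s = g \<Longrightarrow> f s = \<zero>\<^bsub>R\<^esub>"
    by (rule projective_cover[OF M bdf]) blast
  let ?F = "gfree S fst"
  let ?\<phi> = "free_module_eval R M snd"
  have Mm: "module R M" by (rule graded_moduleD(1)[OF M])
  have bS: "snd \<in> S \<rightarrow> carrier M" using graded_moduleD(2)[OF M Sg] by blast
  have \<phi>: "?\<phi> \<in> module_hom R ?F M"
    unfolding gfree_hom_iff by (rule free_module_eval_hom[OF Mm bS])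
  interpret F: module R ?F by (rule gfree_module)
  interpret M': module R M by (rule Mm)
  interpret \<phi>: mod_hom R ?F M ?\<phi>
    using \<phi> Mm gfree_module by (simp add: mod_hom_def mod_hom_axioms_def)
  have "?\<phi> ` carrier ?F = carrier M"
  proof
    show "carrier M \<subseteq> ?\<phi> ` carrier ?F"
    proof
      fix x assume "x \<in> carrier M"
      from surj[OF this] obtain f where "f \<in> carrier (free_module R S)" "?\<phi> f = x" by blast
      then show "x \<in> ?\<phi> ` carrier ?F" by (intro image_eqI[of _ _ f]) simp_all
    qed
  qed (use \<phi>.f_im in blast)
  moreover have "(\<lambda>x. x) \<in> module_hom R M M" by (simp add: module_hom_def)
  \<comment> \<open>The free module has functions on pairs as elements, outside the types quantified
    over in \<open>projective_module\<close>; hence the lifting property for arbitrary types is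
    applied.\<close>
  ultimately obtain \<sigma> where \<sigma>: "\<sigma> \<in> module_hom R M ?F" and \<phi>\<sigma>: "\<And>x. x \<in> carrier M \<Longrightarrow> ?\<phi> (\<sigma> x) = x"
    using projective_module_lift[OF proj R.one_not_zero gfree_module Mm \<phi>] by blast
  interpret \<sigma>: mod_hom R M ?F \<sigma>
    using \<sigma> Mm gfree_module by (simp add: mod_hom_def mod_hom_axioms_def)
  define \<pi> where "\<pi> u = u \<ominus>\<^bsub>?F\<^esub> \<sigma> (?\<phi> u)" for u
  have cl: "?\<phi> u \<in> carrier M" "\<sigma> (?\<phi> u) \<in> carrier ?F" if "u \<in> carrier ?F" for u
    using \<phi>.f_im[OF that] \<sigma>.f_im[OF \<phi>.f_im[OF that]] by auto
  have \<pi>hom: "\<pi> \<in> module_hom R ?F ?F"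
  proof (rule module_homI)
    show "\<pi> u \<in> carrier ?F" if "u \<in> carrier ?F" for u
      unfolding \<pi>_def by (rule F.minus_closed[OF that cl(2)[OF that]])
    show "\<pi> (u \<oplus>\<^bsub>?F\<^esub> v) = \<pi> u \<oplus>\<^bsub>?F\<^esub> \<pi> v" if u: "u \<in> carrier ?F" and v: "v \<in> carrier ?F" for u v
      using u v cl[OF u] cl[OF v] F.a_inv_closed
      unfolding \<pi>_def module_hom_add[OF \<phi> u v] module_hom_add[OF \<sigma> cl(1)[OF u] cl(1)[OF v]]
      by (simp only: F.minus_eq F.minus_add F.a_ac F.a_closed)
    show "\<pi> (r \<odot>\<^bsub>?F\<^esub> u) = r \<odot>\<^bsub>?F\<^esub> \<pi> u" if r: "r \<in> carrier R" and u: "u \<in> carrier ?F" for r u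
      using r u cl[OF u] F.a_inv_closed
      unfolding \<pi>_def module_hom_smult[OF \<phi> r u] module_hom_smult[OF \<sigma> r cl(1)[OF u]]
      by (simp only: F.minus_eq F.smult_r_distr F.smult_r_minus)
  qed
  have \<phi>\<pi>: "?\<phi> (\<pi> u) = \<zero>\<^bsub>M\<^esub>" and \<pi>c: "\<pi> u \<in> carrier ?F" if u: "u \<in> carrier ?F" for u
  proof -
    show "\<pi> u \<in> carrier ?F" using module_hom_closed[OF \<pi>hom] u by blast
    have "?\<phi> (\<pi> u) = ?\<phi> u \<ominus>\<^bsub>M\<^esub> ?\<phi> (\<sigma> (?\<phi> u))"
      unfolding \<pi>_def by (rule \<phi>.f_minus[OF u cl(2)[OF u]])
    also have "\<dots> = \<zero>\<^bsub>M\<^esub>" unfolding \<phi>\<sigma>[OF cl(1)[OF u]] using cl(1)[OF u] M'.diff_eq_zero_iff by blast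
    finally show "?\<phi> (\<pi> u) = \<zero>\<^bsub>M\<^esub>" .
  qed
  have eg: "?\<phi> f \<in> gcomp M g" if "f \<in> gcomp ?F g" for f g
    by (rule eval_gcomp[OF M _ that]) (rule Sg)
  have hc: "hcomp M (?\<phi> u) g = ?\<phi> (hcomp ?F u g)" if "u \<in> carrier ?F" for u g
    by (rule hcomp_hom[OF gfree_graded M \<phi> eg that])
  have step: "f = (\<lambda>_. \<zero>\<^bsub>R\<^esub>)"
    if f: "f \<in> gcomp ?F g" and f0: "?\<phi> f = \<zero>\<^bsub>M\<^esub>"
      and IH: "\<And>h u. h \<in> gsupp M \<Longrightarrow> monoid_le Q h g \<Longrightarrow> h \<noteq> g \<Longrightarrow> u \<in> gcomp ?F h \<Longrightarrow> ?\<phi> u = \<zero>\<^bsub>M\<^esub> \<Longrightarrow> u = (\<lambda>_. \<zero>\<^bsub>R\<^esub>)"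
    for f g
  proof -
    have fc: "f \<in> carrier (free_module R S)" and fg: "\<And>t. t \<in> S \<Longrightarrow> f t \<in> gcomp R (g - fst t)"
      using f by (auto simp: gcomp_gfree)
    let ?T = "{s. f s \<noteq> \<zero>\<^bsub>R\<^esub>}"
    have TS: "s \<in> S" if "s \<in> ?T" for s using fc that unfolding free_carrier by blast
    have \<pi>\<delta>: "\<pi> (\<delta> s) \<in> carrier ?F" "?\<phi> (\<pi> (\<delta> s)) = \<zero>\<^bsub>M\<^esub>" if "s \<in> S" for s
      using \<pi>c \<phi>\<pi> \<delta>_carrier[OF that] by auto
    \<comment> \<open>A nonzero coefficient of \<open>f\<close> at \<open>s\<close> puts
      \<open>fst s\<close> below \<open>g\<close>, and minimality of the cover excludes equality; so
      the induction hypothesis covers the degree \<open>fst s\<close>.\<close>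
    have z: "hcomp ?F (\<pi> (\<delta> s)) (fst s) = \<zero>\<^bsub>?F\<^esub>" if s: "s \<in> ?T" for s
    proof -
      have "fst s \<noteq> g" using min[OF f f0 TS[OF s]] s by auto
      moreover have "monoid_le Q (fst s) g" using mem_Q[OF fg[OF TS[OF s]]] s by (simp add: monoid_le_def)
      moreover have "?\<phi> (hcomp ?F (\<pi> (\<delta> s)) (fst s)) = \<zero>\<^bsub>M\<^esub>"
        using hc[OF \<pi>\<delta>(1)[OF TS[OF s]], of "fst s"] \<pi>\<delta>(2)[OF TS[OF s]]
          hcomp_homogeneous[OF M graded_moduleD(3)[OF M], of 0] by simp
      ultimately show ?thesis
        using IH[OF supp[OF TS[OF s]] _ _ hcomp_props(1)[OF gfree_graded \<pi>\<delta>(1)[OF TS[OF s]]]] by simp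
    qed
    have fF: "f \<in> carrier ?F" using fc by simp
    have "\<pi> f = f \<ominus>\<^bsub>?F\<^esub> \<zero>\<^bsub>?F\<^esub>" unfolding \<pi>_def f0 \<sigma>.f0_is_0 ..
    also have "\<dots> = f" by (rule F.diff_zero[OF fF])
    finally have "f = free_module_eval R ?F (\<lambda>s. \<pi> (\<delta> s)) f"
      using gfree_hom_eval[OF gfree_module \<pi>hom fc] by simp
    then have fsum: "f = finsum ?F (\<lambda>s. f s \<odot>\<^bsub>?F\<^esub> \<pi> (\<delta> s)) ?T"
      unfolding free_module_eval_def .
    have fR: "f s \<in> carrier R" for s using fc unfolding free_carrier by blast
    have "hcomp ?F f g = hcomp ?F (finsum ?F (\<lambda>s. f s \<odot>\<^bsub>?F\<^esub> \<pi> (\<delta> s)) ?T) g"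
      using fsum by (rule arg_cong)
    also have "\<dots> = finsum ?F (\<lambda>s. hcomp ?F (f s \<odot>\<^bsub>?F\<^esub> \<pi> (\<delta> s)) g) ?T"
      by (rule hcomp_finsum[OF gfree_graded]) (use fR \<pi>\<delta> TS in \<open>blast intro: F.smult_closed\<close>)
    also have "\<dots> = finsum ?F (\<lambda>s. \<zero>\<^bsub>?F\<^esub>) ?T"
    proof (rule F.finsum_cong')
      fix s assume s: "s \<in> ?T"
      have "hcomp ?F (f s \<odot>\<^bsub>?F\<^esub> \<pi> (\<delta> s)) g = f s \<odot>\<^bsub>?F\<^esub> hcomp ?F (\<pi> (\<delta> s)) (g - (g - fst s))"
        by (rule hcomp_smult[OF gfree_graded \<pi>\<delta>(1)[OF TS[OF s]] fg[OF TS[OF s]] fR])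
      also have "\<dots> = f s \<odot>\<^bsub>?F\<^esub> \<zero>\<^bsub>?F\<^esub>" using z[OF s] by simp
      also have "\<dots> = \<zero>\<^bsub>?F\<^esub>" by (rule F.smult_r_null[OF fR])
      finally show "hcomp ?F (f s \<odot>\<^bsub>?F\<^esub> \<pi> (\<delta> s)) g = \<zero>\<^bsub>?F\<^esub>" .
    qed (use F.zero_closed in auto)
    also have "\<dots> = \<zero>\<^bsub>?F\<^esub>" by (rule F.finsum_zero)
    finally show ?thesis using hcomp_homogeneous[OF gfree_graded f] by simp
  qed
  have df: "downward_finite Q (gsupp M)" using bdf by (simp add: bdf_def)
  have supp0: "\<forall>f. f \<in> gcomp ?F g \<longrightarrow> ?\<phi> f = \<zero>\<^bsub>M\<^esub> \<longrightarrow> f = (\<lambda>_. \<zero>\<^bsub>R\<^esub>)" if "g \<in> gsupp M" for g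
    using df that
  proof (induction rule: Q.degree_induct)
    case (1 g)
    then show ?case using step by metis
  qed
  \<comment> \<open>The induction runs over the support of \<open>M\<close> only. For other degrees
    one further application of \<open>step\<close> suffices, since its hypothesis concerns degrees
    in the support.\<close>
  have inj: "f = (\<lambda>_. \<zero>\<^bsub>R\<^esub>)" if "f \<in> gcomp ?F g" "?\<phi> f = \<zero>\<^bsub>M\<^esub>" for f g
    using step[OF that] supp0 by metis
  have "graded_isomorphic R ?F M"
    by (rule graded_iso_from_eval[OF M, where b = snd], rule Sg, assumption, rule surj, assumption, rule inj)
  with idx show ?thesis by blast
qed

end

section \<open>Tensor products\<close>

locale two_modules = M: module R M + N: module R N
  for R :: "('r, 'x) ring_scheme" and M :: "('r, 'm, 'y) module_scheme" and N :: "('r, 'n, 'z) module_scheme"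
begin

abbreviation "FG \<equiv> free_Abelian_group (carrier M \<times> carrier N)"
abbreviation "TK \<equiv> tensor_kernel R M N"
abbreviation "T \<equiv> tensor_module R M N"
abbreviation "coset \<equiv> tensor_coset R M N"

text \<open>The scalar action on formal sums, before passing to cosets.\<close>

definition act :: "'r \<Rightarrow> ('m \<times> 'n \<Rightarrow>\<^sub>0 int) \<Rightarrow> ('m \<times> 'n \<Rightarrow>\<^sub>0 int)"
  where "act r = frag_extend (\<lambda>(x, y). frag_of (r \<odot>\<^bsub>M\<^esub> x, y))"

definition tens :: "'m \<Rightarrow> 'n \<Rightarrow> ('m \<times> 'n \<Rightarrow>\<^sub>0 int) set"
  where "tens x y = coset (frag_of (x, y))"

lemma FG_comm: "comm_group FG" by (rule abelian_free_Abelian_group)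

lemma rel_carrier: "tensor_relations R M N \<subseteq> carrier FG"
proof -
  have f: "frag_of p \<in> carrier FG" if "p \<in> carrier M \<times> carrier N" for p using that by simp
  have d: "a - b \<in> carrier FG" if "a \<in> carrier FG" "b \<in> carrier FG" for a b
    using that keys_diff[of a b] by auto
  show ?thesis
    unfolding tensor_relations_def by (intro Un_least subsetI; elim CollectE exE conjE; hypsubst; intro d f) auto
qed

lemma TK_subgroup: "subgroup TK FG"
  unfolding tensor_kernel_def by (rule group.generate_is_subgroup[OF group_free_Abelian_group rel_carrier])

lemma TK_normal: "TK \<lhd> FG"
  by (rule comm_group.subgroup_imp_normal[OF FG_comm TK_subgroup])

lemma TK_add: "a \<in> TK \<Longrightarrow> b \<in> TK \<Longrightarrow> a + b \<in> TK"
  using subgroup.m_closed[OF TK_subgroup] by simp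

lemma TK_carrier: "a \<in> TK \<Longrightarrow> Poly_Mapping.keys a \<subseteq> carrier M \<times> carrier N"
  using subsetD[OF subgroup.subset[OF TK_subgroup], of a] by simp

lemma FG_induct [consumes 1, case_names zero diff gen]:
  assumes "Poly_Mapping.keys c \<subseteq> carrier M \<times> carrier N" and "P 0"
    and "\<And>a b. Poly_Mapping.keys a \<subseteq> carrier M \<times> carrier N \<Longrightarrow> Poly_Mapping.keys b \<subseteq> carrier M \<times> carrier N \<Longrightarrow>
      P a \<Longrightarrow> P b \<Longrightarrow> P (a - b)"
    and "\<And>x y. x \<in> carrier M \<Longrightarrow> y \<in> carrier N \<Longrightarrow> P (frag_of (x, y))"
  shows "P c"
  by (rule free_Abelian_group_induct[OF assms(1)]) (use assms(2-4) in auto)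

lemma TK_minus: "a \<in> TK \<Longrightarrow> - a \<in> TK"
  using subgroup.m_inv_closed[OF TK_subgroup, of a] TK_carrier[of a] by simp

lemma TK_diff: "a \<in> TK \<Longrightarrow> b \<in> TK \<Longrightarrow> a - b \<in> TK"
  using TK_add[of a "- b"] TK_minus by simp

lemma TK_zero: "0 \<in> TK"
  using subgroup.one_closed[OF TK_subgroup] by simp

lemma rel_TK: "c \<in> tensor_relations R M N \<Longrightarrow> c \<in> TK"
  unfolding tensor_kernel_def by (rule generate.incl)

lemma TK_induct [consumes 1, case_names zero rel minus add]:
  assumes "c \<in> TK" and "P 0" and "\<And>c. c \<in> tensor_relations R M N \<Longrightarrow> P c"
    and minus: "\<And>c. Poly_Mapping.keys c \<subseteq> carrier M \<times> carrier N \<Longrightarrow> P c \<Longrightarrow> P (- c)"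
    and add: "\<And>a b. Poly_Mapping.keys a \<subseteq> carrier M \<times> carrier N \<Longrightarrow> Poly_Mapping.keys b \<subseteq> carrier M \<times> carrier N \<Longrightarrow>
      P a \<Longrightarrow> P b \<Longrightarrow> P (a + b)"
  shows "P c"
  using assms(1) unfolding tensor_kernel_def
proof (induction rule: generate.induct)
  case one
  then show ?case using assms(2) by simp
next
  case (incl h)
  then show ?case by (rule assms(3))
next
  case (inv h)
  then have "Poly_Mapping.keys h \<subseteq> carrier M \<times> carrier N" using subsetD[OF rel_carrier, of h] by simp
  then show ?case using minus assms(3)[OF inv] by simp
next
  case (eng a b)
  then have "Poly_Mapping.keys a \<subseteq> carrier M \<times> carrier N" "Poly_Mapping.keys b \<subseteq> carrier M \<times> carrier N"
    using TK_carrier unfolding tensor_kernel_def by auto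
  then show ?case using add eng by simp
qed

lemma coset_eq: "coset c = {h + c | h. h \<in> TK}"
  by (auto simp: tensor_coset_def r_coset_def)

lemma coset_eq_iff: "coset a = coset b \<longleftrightarrow> a - b \<in> TK"
proof
  assume "coset a = coset b"
  moreover have "a \<in> coset a" using TK_zero by (auto simp: coset_eq intro: exI[of _ 0])
  ultimately obtain h where "h \<in> TK" "a = h + b" by (auto simp: coset_eq)
  then show "a - b \<in> TK" by simp
next
  assume *: "a - b \<in> TK"
  have "h + a \<in> coset b" if "h \<in> TK" for h
    using TK_add[OF that *] unfolding coset_eq by (auto intro!: exI[of _ "h + (a - b)"])
  moreover have "h + b \<in> coset a" if "h \<in> TK" for h
    using TK_diff[OF that *] unfolding coset_eq by (auto intro!: exI[of _ "h - (a - b)"])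
  ultimately show "coset a = coset b" unfolding coset_eq[of a] coset_eq[of b] by (auto simp: coset_eq)
qed

lemma T_carrier: "carrier T = coset ` {c. Poly_Mapping.keys c \<subseteq> carrier M \<times> carrier N}"
  by (auto simp: tensor_module_def Let_def FactGroup_def RCOSETS_def tensor_coset_def)

lemma T_zero: "\<zero>\<^bsub>T\<^esub> = coset 0"
  by (auto simp: tensor_module_def Let_def FactGroup_def coset_eq)

lemma T_add: "coset a \<oplus>\<^bsub>T\<^esub> coset b = coset (a + b)"
  if "Poly_Mapping.keys a \<subseteq> carrier M \<times> carrier N" "Poly_Mapping.keys b \<subseteq> carrier M \<times> carrier N"
  using normal.rcos_sum[OF TK_normal, of a b] that
  by (simp add: tensor_module_def Let_def FactGroup_def tensor_coset_def)

lemma act_zero [simp]: "act r 0 = 0" by (simp add: act_def)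
lemma act_add: "act r (a + b) = act r a + act r b" by (simp add: act_def frag_extend_add)
lemma act_diff: "act r (a - b) = act r a - act r b" by (simp add: act_def frag_extend_diff)
lemma act_minus: "act r (- a) = - act r a" by (simp add: act_def frag_extend_minus)
lemma act_of [simp]: "act r (frag_of (x, y)) = frag_of (r \<odot>\<^bsub>M\<^esub> x, y)" by (simp add: act_def)

lemma act_keys: "Poly_Mapping.keys (act r c) \<subseteq> carrier M \<times> carrier N"
  if "r \<in> carrier R" "Poly_Mapping.keys c \<subseteq> carrier M \<times> carrier N"
  using that(2)
proof (induction rule: FG_induct)
  case (diff a b)
  then show ?case using keys_diff[of "act r a" "act r b"] unfolding act_diff by blast
qed (use that(1) in auto)

lemma rel_intros:
  "x \<in> carrier M \<Longrightarrow> x' \<in> carrier M \<Longrightarrow> y \<in> carrier N \<Longrightarrow>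
    frag_of (x \<oplus>\<^bsub>M\<^esub> x', y) - frag_of (x, y) - frag_of (x', y) \<in> TK"
  "x \<in> carrier M \<Longrightarrow> y \<in> carrier N \<Longrightarrow> y' \<in> carrier N \<Longrightarrow>
    frag_of (x, y \<oplus>\<^bsub>N\<^esub> y') - frag_of (x, y) - frag_of (x, y') \<in> TK"
  "r \<in> carrier R \<Longrightarrow> x \<in> carrier M \<Longrightarrow> y \<in> carrier N \<Longrightarrow>
    frag_of (r \<odot>\<^bsub>M\<^esub> x, y) - frag_of (x, r \<odot>\<^bsub>N\<^esub> y) \<in> TK"
  by (rule rel_TK, unfold tensor_relations_def, rule UnI1, rule UnI1, rule CollectI, intro exI conjI, rule refl, assumption+)
    (rule rel_TK, unfold tensor_relations_def, rule UnI1, rule UnI2, rule CollectI, intro exI conjI, rule refl, assumption+,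
     rule rel_TK, unfold tensor_relations_def, rule UnI2, rule CollectI, intro exI conjI, rule refl, assumption+)

lemma rel_cases:
  assumes "c \<in> tensor_relations R M N"
  obtains
    (add_left) x x' y where "c = frag_of (x \<oplus>\<^bsub>M\<^esub> x', y) - frag_of (x, y) - frag_of (x', y)"
        "x \<in> carrier M" "x' \<in> carrier M" "y \<in> carrier N"
    | (add_right) x y y' where "c = frag_of (x, y \<oplus>\<^bsub>N\<^esub> y') - frag_of (x, y) - frag_of (x, y')"
        "x \<in> carrier M" "y \<in> carrier N" "y' \<in> carrier N"
    | (smult) s x y where "c = frag_of (s \<odot>\<^bsub>M\<^esub> x, y) - frag_of (x, s \<odot>\<^bsub>N\<^esub> y)"
        "s \<in> carrier R" "x \<in> carrier M" "y \<in> carrier N"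
  using assms unfolding tensor_relations_def
  by (elim UnE CollectE exE conjE)
    ((rule that(1), assumption+) | (rule that(2), assumption+) | (rule that(3), assumption+))+

text \<open>The action maps each defining relation to another one. For the balancing relation this
  rests on commutativity of \<open>R\<close>, which allows \<open>r\<close> and \<open>s\<close> to
  be exchanged.\<close>

lemma act_TK:
  assumes r: "r \<in> carrier R" and "c \<in> TK"
  shows "act r c \<in> TK"
  using assms(2)
proof (induction rule: TK_induct)
  case (rel c)
  then show ?case
  proof (cases rule: rel_cases)
    case 1: (add_left x x' y)
    then show ?thesis using r rel_intros(1)[of "r \<odot>\<^bsub>M\<^esub> x" "r \<odot>\<^bsub>M\<^esub> x'" y]
      by (simp add: act_diff M.smult_r_distr)
  next
    case 2: (add_right x y y')
    then show ?thesis using r rel_intros(2)[of "r \<odot>\<^bsub>M\<^esub> x" y y'] by (simp add: act_diff)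
  next
    case 3: (smult s x y)
    have "r \<odot>\<^bsub>M\<^esub> (s \<odot>\<^bsub>M\<^esub> x) = s \<odot>\<^bsub>M\<^esub> (r \<odot>\<^bsub>M\<^esub> x)"
      using 3 r M.smult_assoc1[of r s x] M.smult_assoc1[of s r x] M.R.m_comm[of r s] by simp
    then show ?thesis using 3 r rel_intros(3)[of s "r \<odot>\<^bsub>M\<^esub> x" y] by (simp add: act_diff)
  qed
qed (auto simp: act_minus act_add TK_zero TK_minus TK_add)

text \<open>The action is defined as a union over the representatives of a coset; it takes one value
  because \<open>act\<close> preserves the relations.\<close>

lemma T_smult: "r \<odot>\<^bsub>T\<^esub> coset c = coset (act r c)" if r: "r \<in> carrier R"
proof -
  have "coset (act r c') = coset (act r c)" if "c' \<in> coset c" for c'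
  proof -
    obtain h where "h \<in> TK" "c' = h + c" using \<open>c' \<in> coset c\<close> by (auto simp: coset_eq)
    then show ?thesis using act_TK[OF r] by (simp add: coset_eq_iff act_add)
  qed
  moreover have "coset c \<noteq> {}" using TK_zero by (auto simp: coset_eq)
  ultimately have "(\<Union>c'\<in>coset c. coset (act r c')) = coset (act r c)" by (intro SUP_eq_const) auto
  then show ?thesis by (simp add: tensor_module_def Let_def act_def)
qed

lemma act_one: "act \<one>\<^bsub>R\<^esub> c = c" if "Poly_Mapping.keys c \<subseteq> carrier M \<times> carrier N"
  using that by (induction rule: FG_induct) (simp_all add: act_diff)

lemma act_mult: "act (r \<otimes>\<^bsub>R\<^esub> s) c = act r (act s c)"
  if "r \<in> carrier R" "s \<in> carrier R" "Poly_Mapping.keys c \<subseteq> carrier M \<times> carrier N"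
  using that(3) by (induction rule: FG_induct) (simp_all add: act_diff that M.smult_assoc1)

text \<open>This law holds only modulo the relations, since the formal generator at
  \<open>(r + s) x\<close> differs from the sum of two generators.\<close>

lemma act_add_left: "act (r \<oplus>\<^bsub>R\<^esub> s) c - (act r c + act s c) \<in> TK"
  if "r \<in> carrier R" "s \<in> carrier R" "Poly_Mapping.keys c \<subseteq> carrier M \<times> carrier N"
  using that(3)
proof (induction rule: FG_induct)
  case (diff a b)
  have "act (r \<oplus>\<^bsub>R\<^esub> s) (a - b) - (act r (a - b) + act s (a - b)) =
      (act (r \<oplus>\<^bsub>R\<^esub> s) a - (act r a + act s a)) - (act (r \<oplus>\<^bsub>R\<^esub> s) b - (act r b + act s b))"
    by (simp add: act_diff)
  also have "\<dots> \<in> TK" by (rule TK_diff[OF diff.IH])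
  finally show ?case .
next
  case (gen x y)
  then show ?case using that rel_intros(1)[of "r \<odot>\<^bsub>M\<^esub> x" "s \<odot>\<^bsub>M\<^esub> x" y]
    by (simp add: M.smult_l_distr diff_diff_eq)
qed (simp add: TK_zero)

lemma T_cases [elim]:
  assumes "X \<in> carrier T"
  obtains c where "Poly_Mapping.keys c \<subseteq> carrier M \<times> carrier N" "X = coset c"
  using assms by (auto simp: T_carrier)

lemma coset_mem: "Poly_Mapping.keys c \<subseteq> carrier M \<times> carrier N \<Longrightarrow> coset c \<in> carrier T"
  by (auto simp: T_carrier)

lemma keys_add_sub: "Poly_Mapping.keys a \<subseteq> A \<Longrightarrow> Poly_Mapping.keys b \<subseteq> A \<Longrightarrow> Poly_Mapping.keys (a + b) \<subseteq> A"
  for a b :: "('m \<times> 'n) \<Rightarrow>\<^sub>0 int"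
  using keys_add[of a b] by blast

lemma T_module: "module R T"
proof (rule moduleI)
  show "cring R" by (rule M.R.is_cring)
  show "abelian_group T"
  proof (rule abelian_groupI)
    show "\<zero>\<^bsub>T\<^esub> \<in> carrier T" by (auto simp: T_zero intro: coset_mem)
  next
    fix X Y assume "X \<in> carrier T" "Y \<in> carrier T"
    then show "X \<oplus>\<^bsub>T\<^esub> Y \<in> carrier T" by (elim T_cases) (simp add: T_add coset_mem keys_add_sub)
  next
    fix X Y Z assume "X \<in> carrier T" "Y \<in> carrier T" "Z \<in> carrier T"
    then show "X \<oplus>\<^bsub>T\<^esub> Y \<oplus>\<^bsub>T\<^esub> Z = X \<oplus>\<^bsub>T\<^esub> (Y \<oplus>\<^bsub>T\<^esub> Z)"
      by (elim T_cases) (simp add: T_add keys_add_sub add.assoc)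
  next
    fix X Y assume "X \<in> carrier T" "Y \<in> carrier T"
    then show "X \<oplus>\<^bsub>T\<^esub> Y = Y \<oplus>\<^bsub>T\<^esub> X" by (elim T_cases) (simp add: T_add add.commute)
  next
    fix X assume "X \<in> carrier T"
    then show "\<zero>\<^bsub>T\<^esub> \<oplus>\<^bsub>T\<^esub> X = X" by (elim T_cases) (simp add: T_add T_zero)
  next
    fix X assume "X \<in> carrier T"
    then obtain c where c: "Poly_Mapping.keys c \<subseteq> carrier M \<times> carrier N" "X = coset c" by (rule T_cases)
    then show "\<exists>Y\<in>carrier T. Y \<oplus>\<^bsub>T\<^esub> X = \<zero>\<^bsub>T\<^esub>"
      by (intro bexI[of _ "coset (- c)"]) (simp_all add: T_add T_zero coset_mem)
  qed
next
  fix r X assume "r \<in> carrier R" "X \<in> carrier T"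
  then show "r \<odot>\<^bsub>T\<^esub> X \<in> carrier T" by (elim T_cases) (simp add: T_smult coset_mem act_keys)
next
  fix r s X assume "r \<in> carrier R" "s \<in> carrier R" "X \<in> carrier T"
  then show "(r \<oplus>\<^bsub>R\<^esub> s) \<odot>\<^bsub>T\<^esub> X = r \<odot>\<^bsub>T\<^esub> X \<oplus>\<^bsub>T\<^esub> s \<odot>\<^bsub>T\<^esub> X"
    by (elim T_cases) (simp add: T_smult T_add act_keys coset_eq_iff act_add_left)
next
  fix r X Y assume "r \<in> carrier R" "X \<in> carrier T" "Y \<in> carrier T"
  then show "r \<odot>\<^bsub>T\<^esub> (X \<oplus>\<^bsub>T\<^esub> Y) = r \<odot>\<^bsub>T\<^esub> X \<oplus>\<^bsub>T\<^esub> r \<odot>\<^bsub>T\<^esub> Y"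
    by (elim T_cases) (simp add: T_smult T_add act_keys act_add)
next
  fix r s X assume "r \<in> carrier R" "s \<in> carrier R" "X \<in> carrier T"
  then show "(r \<otimes>\<^bsub>R\<^esub> s) \<odot>\<^bsub>T\<^esub> X = r \<odot>\<^bsub>T\<^esub> (s \<odot>\<^bsub>T\<^esub> X)"
    by (elim T_cases) (simp add: T_smult act_mult)
next
  fix X assume "X \<in> carrier T"
  then show "\<one>\<^bsub>R\<^esub> \<odot>\<^bsub>T\<^esub> X = X" by (elim T_cases) (simp add: T_smult act_one)
qed

sublocale T: module R T by (rule T_module)

lemma tens_closed [simp]: "x \<in> carrier M \<Longrightarrow> y \<in> carrier N \<Longrightarrow> tens x y \<in> carrier T"
  by (simp add: tens_def coset_mem)

lemma tens_add_left: "x \<in> carrier M \<Longrightarrow> x' \<in> carrier M \<Longrightarrow> y \<in> carrier N \<Longrightarrow>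
    tens (x \<oplus>\<^bsub>M\<^esub> x') y = tens x y \<oplus>\<^bsub>T\<^esub> tens x' y"
  by (simp add: tens_def T_add coset_eq_iff rel_intros diff_diff_eq[symmetric])

lemma tens_add_right: "x \<in> carrier M \<Longrightarrow> y \<in> carrier N \<Longrightarrow> y' \<in> carrier N \<Longrightarrow>
    tens x (y \<oplus>\<^bsub>N\<^esub> y') = tens x y \<oplus>\<^bsub>T\<^esub> tens x y'"
  by (simp add: tens_def T_add coset_eq_iff rel_intros diff_diff_eq[symmetric])

lemma tens_smult_left: "r \<in> carrier R \<Longrightarrow> tens (r \<odot>\<^bsub>M\<^esub> x) y = r \<odot>\<^bsub>T\<^esub> tens x y"
  by (simp add: tens_def T_smult)

lemma tens_smult_right: "r \<in> carrier R \<Longrightarrow> x \<in> carrier M \<Longrightarrow> y \<in> carrier N \<Longrightarrow> tens x (r \<odot>\<^bsub>N\<^esub> y) = r \<odot>\<^bsub>T\<^esub> tens x y"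
  using rel_intros(3)[of r x y] by (simp add: tens_smult_left[symmetric]) (simp add: tens_def coset_eq_iff[symmetric])

lemma tens_zero_left: "y \<in> carrier N \<Longrightarrow> tens \<zero>\<^bsub>M\<^esub> y = \<zero>\<^bsub>T\<^esub>"
  using tens_smult_left[of "\<zero>\<^bsub>R\<^esub>" "\<zero>\<^bsub>M\<^esub>" y] by simp

lemma tens_zero_right: "x \<in> carrier M \<Longrightarrow> tens x \<zero>\<^bsub>N\<^esub> = \<zero>\<^bsub>T\<^esub>"
  using tens_smult_right[of "\<zero>\<^bsub>R\<^esub>" x "\<zero>\<^bsub>N\<^esub>"] by simp

text \<open>Every element is represented by a formal sum, and the induction on formal sums builds
  these by differences. Negatives stay in \<open>W\<close> because they are multiples by
  \<open>-1\<close>.\<close>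

lemma tens_generate:
  assumes X: "X \<in> carrier T" and W: "\<And>x y. x \<in> carrier M \<Longrightarrow> y \<in> carrier N \<Longrightarrow> tens x y \<in> W"
    and z: "\<zero>\<^bsub>T\<^esub> \<in> W" and a: "\<And>X Y. X \<in> W \<Longrightarrow> Y \<in> W \<Longrightarrow> X \<oplus>\<^bsub>T\<^esub> Y \<in> W"
    and s: "\<And>r X. r \<in> carrier R \<Longrightarrow> X \<in> W \<Longrightarrow> r \<odot>\<^bsub>T\<^esub> X \<in> W"
  shows "X \<in> W"
proof -
  obtain c where c: "Poly_Mapping.keys c \<subseteq> carrier M \<times> carrier N" "X = coset c" using X by (rule T_cases)
  have "coset c \<in> W" using c(1)
  proof (induction rule: FG_induct)
    case zero
    then show ?case using z by (simp add: T_zero)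
  next
    case (diff a b)
    note 2 = diff
    have k: "Poly_Mapping.keys (- b) \<subseteq> carrier M \<times> carrier N" using 2 by simp
    have "coset b \<oplus>\<^bsub>T\<^esub> coset (- b) = \<zero>\<^bsub>T\<^esub>" using 2 k by (simp add: T_add T_zero)
    then have "coset (- b) = \<ominus>\<^bsub>T\<^esub> coset b"
      using coset_mem[OF k] coset_mem[OF 2(2)] by (metis T.M.a_comm T.M.minus_equality)
    also have "\<dots> = (\<ominus>\<^bsub>R\<^esub> \<one>\<^bsub>R\<^esub>) \<odot>\<^bsub>T\<^esub> coset b" using coset_mem[OF 2(2)] by (simp add: T.smult_l_minus)
    also have "\<dots> \<in> W" using 2 by (intro s) auto
    finally have "coset a \<oplus>\<^bsub>T\<^esub> coset (- b) \<in> W" using 2 a by blast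
    then show ?case using 2 k by (simp add: T_add)
  next
    case (gen x y)
    then show ?case using W[of x y] by (simp add: tens_def)
  qed
  then show ?thesis using c by simp
qed

text \<open>The map extends additively to formal sums, and bilinearity makes it vanish on the
  relations, so it descends to cosets. Linearity over \<open>R\<close> is then verified on pure
  tensors.\<close>

lemma tens_universal:
  fixes P :: "('r, 'p, 'w) module_scheme"
  assumes P: "module R P" and b: "\<And>x y. x \<in> carrier M \<Longrightarrow> y \<in> carrier N \<Longrightarrow> \<beta> x y \<in> carrier P"
    and al: "\<And>x x' y. x \<in> carrier M \<Longrightarrow> x' \<in> carrier M \<Longrightarrow> y \<in> carrier N \<Longrightarrow> \<beta> (x \<oplus>\<^bsub>M\<^esub> x') y = \<beta> x y \<oplus>\<^bsub>P\<^esub> \<beta> x' y"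
    and ar: "\<And>x y y'. x \<in> carrier M \<Longrightarrow> y \<in> carrier N \<Longrightarrow> y' \<in> carrier N \<Longrightarrow> \<beta> x (y \<oplus>\<^bsub>N\<^esub> y') = \<beta> x y \<oplus>\<^bsub>P\<^esub> \<beta> x y'"
    and sl: "\<And>r x y. r \<in> carrier R \<Longrightarrow> x \<in> carrier M \<Longrightarrow> y \<in> carrier N \<Longrightarrow> \<beta> (r \<odot>\<^bsub>M\<^esub> x) y = r \<odot>\<^bsub>P\<^esub> \<beta> x y"
    and sr: "\<And>r x y. r \<in> carrier R \<Longrightarrow> x \<in> carrier M \<Longrightarrow> y \<in> carrier N \<Longrightarrow> \<beta> x (r \<odot>\<^bsub>N\<^esub> y) = r \<odot>\<^bsub>P\<^esub> \<beta> x y"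
  obtains \<Phi> where "\<Phi> \<in> module_hom R T P"
    "\<And>x y. x \<in> carrier M \<Longrightarrow> y \<in> carrier N \<Longrightarrow> \<Phi> (tens x y) = \<beta> x y"
proof -
  interpret P: module R P by fact
  have "(\<lambda>(x, y). \<beta> x y) ` (carrier M \<times> carrier N) \<subseteq> carrier (add_monoid P)" using b by auto
  from comm_group.free_Abelian_group_universal[OF P.a_comm_group this]
  obtain h where h: "h \<in> hom FG (add_monoid P)"
    and hof: "\<And>p. p \<in> carrier M \<times> carrier N \<Longrightarrow> h (frag_of p) = (\<lambda>(x, y). \<beta> x y) p" by blast
  interpret h: group_hom FG "add_monoid P" h
    using h P.a_group by (simp add: group_hom_def group_hom_axioms_def)
  have hc: "h c \<in> carrier P" if "Poly_Mapping.keys c \<subseteq> carrier M \<times> carrier N" for c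
    using h.hom_closed[of c] that by simp
  have hadd: "h (a + b) = h a \<oplus>\<^bsub>P\<^esub> h b"
    if "Poly_Mapping.keys a \<subseteq> carrier M \<times> carrier N" "Poly_Mapping.keys b \<subseteq> carrier M \<times> carrier N" for a b
    using h.hom_mult[of a b] that by simp
  have hmin: "h (- a) = \<ominus>\<^bsub>P\<^esub> h a" if "Poly_Mapping.keys a \<subseteq> carrier M \<times> carrier N" for a
    using h.hom_inv[of a] that by (simp add: a_inv_def)
  have h0: "h 0 = \<zero>\<^bsub>P\<^esub>" using h.hom_one by simp
  have hdiff: "h (a - b) = h a \<ominus>\<^bsub>P\<^esub> h b"
    if "Poly_Mapping.keys a \<subseteq> carrier M \<times> carrier N" "Poly_Mapping.keys b \<subseteq> carrier M \<times> carrier N" for a b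
    using hadd[of a "- b"] that by (simp add: hmin P.minus_eq)
  have kd: "Poly_Mapping.keys (a - b) \<subseteq> carrier M \<times> carrier N"
    if "Poly_Mapping.keys a \<subseteq> carrier M \<times> carrier N" "Poly_Mapping.keys b \<subseteq> carrier M \<times> carrier N"
    for a b :: "('m \<times> 'n) \<Rightarrow>\<^sub>0 int"
    using keys_diff[of a b] that by blast
  have pm: "(u \<oplus>\<^bsub>P\<^esub> v) \<ominus>\<^bsub>P\<^esub> u \<ominus>\<^bsub>P\<^esub> v = \<zero>\<^bsub>P\<^esub>" if "u \<in> carrier P" "v \<in> carrier P" for u v
  proof -
    have "(u \<oplus>\<^bsub>P\<^esub> v) \<ominus>\<^bsub>P\<^esub> u \<ominus>\<^bsub>P\<^esub> v = (u \<ominus>\<^bsub>P\<^esub> u) \<oplus>\<^bsub>P\<^esub> (v \<ominus>\<^bsub>P\<^esub> v)"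
      using that by (simp add: P.minus_eq P.a_ac)
    then show ?thesis using that by (simp add: P.minus_eq P.r_neg)
  qed
  have hTK: "h c = \<zero>\<^bsub>P\<^esub>" if "c \<in> TK" for c
    using that
  proof (induction rule: TK_induct)
    case (rel c)
    then show ?case
    proof (cases rule: rel_cases)
      case 1: (add_left x x' y)
      then show ?thesis using kd[of "frag_of (x \<oplus>\<^bsub>M\<^esub> x', y)" "frag_of (x, y)"] b
        by (simp add: hdiff hof al pm)
    next
      case 2: (add_right x y y')
      then show ?thesis using kd[of "frag_of (x, y \<oplus>\<^bsub>N\<^esub> y')" "frag_of (x, y)"] b
        by (simp add: hdiff hof ar pm)
    next
      case 3: (smult s x y)
      then show ?thesis using b by (simp add: hdiff hof sl sr P.minus_eq P.r_neg)
    qed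
  qed (simp_all add: h0 hmin hadd P.minus_equality)
  \<comment> \<open>The chosen representative does not matter on a coset, because \<open>h\<close>
    vanishes on the relations.\<close>
  define \<Phi> where "\<Phi> X = h (SOME c. c \<in> X)" for X
  have \<Phi>: "\<Phi> (coset c) = h c" if "Poly_Mapping.keys c \<subseteq> carrier M \<times> carrier N" for c
  proof -
    have "c \<in> coset c" using TK_zero by (auto simp: coset_eq intro: exI[of _ 0])
    then have "(SOME c'. c' \<in> coset c) \<in> coset c" by (rule someI)
    then obtain k where k: "k \<in> TK" "(SOME c'. c' \<in> coset c) = k + c" by (auto simp: coset_eq)
    then show ?thesis using hadd[OF TK_carrier[OF k(1)] that] hTK[OF k(1)] hc[OF that] by (simp add: \<Phi>_def)
  qed
  have \<Phi>t: "\<Phi> (tens x y) = \<beta> x y" if "x \<in> carrier M" "y \<in> carrier N" for x y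
    using that by (simp add: tens_def \<Phi> hof)
  have \<Phi>c: "\<Phi> X \<in> carrier P" if "X \<in> carrier T" for X
    using that by (elim T_cases) (simp add: \<Phi> hc)
  have \<Phi>a: "\<Phi> (X \<oplus>\<^bsub>T\<^esub> Y) = \<Phi> X \<oplus>\<^bsub>P\<^esub> \<Phi> Y" if "X \<in> carrier T" "Y \<in> carrier T" for X Y
    using that by (elim T_cases) (simp add: T_add \<Phi> hadd keys_add_sub)
  have \<Phi>s: "\<Phi> (r \<odot>\<^bsub>T\<^esub> X) = r \<odot>\<^bsub>P\<^esub> \<Phi> X" if r: "r \<in> carrier R" and X: "X \<in> carrier T" for r X
  proof -
    \<comment> \<open>The set quantifies over all scalars at once; this makes it closed under scalar
      multiplication, as \<open>tens_generate\<close> requires.\<close>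
    define W where "W = {X \<in> carrier T. \<forall>r\<in>carrier R. \<Phi> (r \<odot>\<^bsub>T\<^esub> X) = r \<odot>\<^bsub>P\<^esub> \<Phi> X}"
    have "X \<in> W"
    proof (rule tens_generate[OF X])
      show "tens x y \<in> W" if "x \<in> carrier M" "y \<in> carrier N" for x y
        using that by (simp add: W_def tens_smult_left[symmetric] \<Phi>t sl)
      have "\<Phi> \<zero>\<^bsub>T\<^esub> = \<zero>\<^bsub>P\<^esub>" by (simp add: T_zero \<Phi> h0)
      then show "\<zero>\<^bsub>T\<^esub> \<in> W" by (simp add: W_def)
      show "X \<oplus>\<^bsub>T\<^esub> Y \<in> W" if "X \<in> W" "Y \<in> W" for X Y
        using that by (simp add: W_def T.smult_r_distr \<Phi>a \<Phi>c P.smult_r_distr)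
      show "r \<odot>\<^bsub>T\<^esub> X \<in> W" if "r \<in> carrier R" "X \<in> W" for r X
        using that by (auto simp: W_def T.smult_assoc1[symmetric] P.smult_assoc1[symmetric] \<Phi>c)
    qed
    then show ?thesis using r by (simp add: W_def)
  qed
  have "\<Phi> \<in> module_hom R T P" by (rule module_homI) (auto intro: \<Phi>c \<Phi>a \<Phi>s)
  from this \<Phi>t show thesis by (rule that)
qed

end

context pdcf_algebra begin

text \<open>For direct sums and tensor products the grading axioms are not checked directly: a
  bijection that matches the proposed components with those of a free module yields them.\<close>

lemma graded_of_iso:
  assumes M: "is_graded_module k R M" and N: "module R N" and sub: "\<And>g. gcomp N g \<subseteq> carrier N"
    and iso: "graded_isomorphic R M N"
  shows "is_graded_module k R N"
proof -
  obtain f where f: "f \<in> module_hom R N M" "bij_betw f (carrier N) (carrier M)" "\<And>g. f ` gcomp N g = gcomp M g"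
    by (rule graded_isoE[OF graded_isomorphic_sym[OF iso] sub]) (use graded_moduleD(2)[OF M] in auto)
  show ?thesis by (rule graded_transport[OF M N f(1,2) sub f(3)])
qed

section \<open>Direct sums, tensor products and representatives\<close>

lemma bdf_index_Plus:
  fixes d :: "'s \<Rightarrow> 'g" and d' :: "'t \<Rightarrow> 'g"
  assumes S: "bdf_index S d" and S': "bdf_index S' d'"
  shows "bdf_index (S <+> S') (case_sum d d')"
    "cnt (S <+> S') (case_sum d d') g = cnt S d g + cnt S' d' g"
proof -
  have fib: "{p \<in> S <+> S'. case_sum d d' p = g} = Inl ` {s \<in> S. d s = g} \<union> Inr ` {t \<in> S'. d' t = g}" for g
    by auto
  have fin: "finite {s \<in> S. d s = g}" "finite {t \<in> S'. d' t = g}" for g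
    using S S' by (auto simp: bdf_index_def)
  have "case_sum d d' ` (S <+> S') = d ` S \<union> d' ` S'" by (simp add: Plus_def image_Un image_image)
  then show "bdf_index (S <+> S') (case_sum d d')"
    using S S' Q.bounded_support_Un fin unfolding bdf_index_def fib by simp
  have "card (Inl ` {s \<in> S. d s = g} \<union> Inr ` {t \<in> S'. d' t = g}) = card {s \<in> S. d s = g} + card {t \<in> S'. d' t = g}"
    using fin by (subst card_Un_disjoint) (auto simp: card_image)
  then show "cnt (S <+> S') (case_sum d d') g = cnt S d g + cnt S' d' g"
    by (simp add: cnt_def fib)
qed

text \<open>Pairs of total degree \<open>u\<close> split by the degree \<open>g\<close> of the first
  entry into products of two finite fibres. Only finitely many \<open>g\<close> give nonempty
  fibres, and counting yields the coefficient of the product series.\<close>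

lemma bdf_index_times:
  fixes d :: "'s \<Rightarrow> 'g" and d' :: "'t \<Rightarrow> 'g"
  assumes S: "bdf_index S d" and S': "bdf_index S' d'"
  shows "bdf_index (S \<times> S') (\<lambda>(s, t). d s + d' t)"
    "cnt (S \<times> S') (\<lambda>(s, t). d s + d' t) = cnt S d \<otimes>\<^bsub>Q.A\<^esub> cnt S' d'"
proof -
  let ?D = "\<lambda>(s, t). d s + d' t"
  have fin: "finite {s \<in> S. d s = g}" "finite {t \<in> S'. d' t = g}" for g
    using S S' by (auto simp: bdf_index_def)
  define X where "X u = {g. cnt S d g \<noteq> 0 \<and> cnt S' d' (u - g) \<noteq> 0}" for u
  have X: "finite (X u)" for u
    unfolding X_def by (rule Q.finite_mult_support[OF cnt_carrier[OF S] cnt_carrier[OF S']])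
  have fib: "{p \<in> S \<times> S'. ?D p = u} = (\<Union>g\<in>X u. {s \<in> S. d s = g} \<times> {t \<in> S'. d' t = u - g})" for u
    by (auto simp: X_def cnt_nonzero[OF S] cnt_nonzero[OF S'] algebra_simps)
  have "bdf_index (S \<times> S') ?D"
    unfolding bdf_index_def
  proof (intro conjI allI)
    have "Q.bounded_support {g + h | g h. g \<in> d ` S \<and> h \<in> d' ` S'}"
      using S S' by (intro Q.bounded_support_plus) (auto simp: bdf_index_def)
    then show "Q.bounded_support (?D ` (S \<times> S'))" by (rule Q.bounded_support_subset) auto
    show "finite {p \<in> S \<times> S'. ?D p = u}" for u
      unfolding fib using X fin by blast
  qed
  then show "bdf_index (S \<times> S') ?D" .
  show "cnt (S \<times> S') ?D = cnt S d \<otimes>\<^bsub>Q.A\<^esub> cnt S' d'"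
  proof
    fix u
    have "card {p \<in> S \<times> S'. ?D p = u} = (\<Sum>g\<in>X u. card ({s \<in> S. d s = g} \<times> {t \<in> S'. d' t = u - g}))"
      unfolding fib using X fin by (intro card_UN_disjoint) auto
    then have "cnt (S \<times> S') ?D u = (\<Sum>g\<in>X u. cnt S d g * cnt S' d' (u - g))"
      by (simp add: cnt_def card_cartesian_product)
    also have "\<dots> = (cnt S d \<otimes>\<^bsub>Q.A\<^esub> cnt S' d') u"
      by (rule Q.series_mult_eq[OF X, symmetric]) (simp add: X_def)
    finally show "cnt (S \<times> S') ?D u = (cnt S d \<otimes>\<^bsub>Q.A\<^esub> cnt S' d') u" .
  qed
qed

lemma direct_sum_simps [simp]:
  "carrier (graded_direct_sum M N) = carrier M \<times> carrier N"
  "gcomp (graded_direct_sum M N) g = gcomp M g \<times> gcomp N g"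
  "p \<oplus>\<^bsub>graded_direct_sum M N\<^esub> q = (fst p \<oplus>\<^bsub>M\<^esub> fst q, snd p \<oplus>\<^bsub>N\<^esub> snd q)"
  "\<zero>\<^bsub>graded_direct_sum M N\<^esub> = (\<zero>\<^bsub>M\<^esub>, \<zero>\<^bsub>N\<^esub>)"
  "r \<odot>\<^bsub>graded_direct_sum M N\<^esub> p = (r \<odot>\<^bsub>M\<^esub> fst p, r \<odot>\<^bsub>N\<^esub> snd p)"
  by (simp_all add: graded_direct_sum_def direct_sum_def)

lemma direct_sum_module: "module R M \<Longrightarrow> module R N \<Longrightarrow> module R (graded_direct_sum M N)"
proof -
  assume M: "module R M" and N: "module R N"
  interpret M: module R M by fact
  interpret N: module R N by fact
  show ?thesis
    by (rule module_transport[OF direct_sum_is_module[OF M N], where f = "\<lambda>x. x"])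
      (auto simp: bij_betw_def direct_sum_def)
qed

text \<open>A function on the disjoint union of the index sets is a pair of functions, and the two
  given isomorphisms act on its halves.\<close>

lemma direct_sum_type:
  fixes M :: "('r, 'm, 'g) graded_module" and N :: "('r, 'n, 'g) graded_module"
    and d :: "'s \<Rightarrow> 'g" and d' :: "'t \<Rightarrow> 'g"
  assumes M: "is_graded_module k R M" "graded_isomorphic R (gfree S d) M"
    and N: "is_graded_module k R N" "graded_isomorphic R (gfree S' d') N"
  shows "graded_isomorphic R (gfree (S <+> S') (case_sum d d')) (graded_direct_sum M N)"
    "is_graded_module k R (graded_direct_sum M N)"
proof -
  obtain f f' where f: "f \<in> graded_hom R (gfree S d) M" and f': "f' \<in> graded_hom R M (gfree S d)"
    and ff: "\<forall>x\<in>carrier (gfree S d). f' (f x) = x" "\<forall>x\<in>carrier M. f (f' x) = x"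
    using M(2) unfolding graded_isomorphic_def by blast
  obtain h h' where h: "h \<in> graded_hom R (gfree S' d') N" and h': "h' \<in> graded_hom R N (gfree S' d')"
    and hh: "\<forall>x\<in>carrier (gfree S' d'). h' (h x) = x" "\<forall>x\<in>carrier N. h (h' x) = x"
    using N(2) unfolding graded_isomorphic_def by blast
  have fm: "f \<in> module_hom R (gfree S d) M" "f' \<in> module_hom R M (gfree S d)"
    "h \<in> module_hom R (gfree S' d') N" "h' \<in> module_hom R N (gfree S' d')"
    using f f' h h' by (simp_all add: graded_hom_def)
  have fc: "f u \<in> carrier M" if "u \<in> carrier (free_module R S)" for u
    using module_hom_closed[OF fm(1)] that by auto
  have hc: "h u \<in> carrier N" if "u \<in> carrier (free_module R S')" for u
    using module_hom_closed[OF fm(3)] that by auto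
  have f'c: "f' x \<in> carrier (free_module R S)" if "x \<in> carrier M" for x
    using module_hom_closed[OF fm(2)] that by auto
  have h'c: "h' x \<in> carrier (free_module R S')" if "x \<in> carrier N" for x
    using module_hom_closed[OF fm(4)] that by auto
  let ?F = "gfree (S <+> S') (case_sum d d')" and ?D = "graded_direct_sum M N"
  define l where "l u = (\<lambda>s. u (Inl s))" for u :: "'s + 't \<Rightarrow> 'r"
  define r where "r u = (\<lambda>s. u (Inr s))" for u :: "'s + 't \<Rightarrow> 'r"
  have l: "l u \<in> carrier (free_module R S)" and r: "r u \<in> carrier (free_module R S')"
    if u: "u \<in> carrier (free_module R (S <+> S'))" for u
  proof -
    have fin: "finite {p. u p \<noteq> \<zero>\<^bsub>R\<^esub>}" and uc: "\<And>p. u p \<in> carrier R"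
      and u0: "\<And>p. p \<notin> S <+> S' \<Longrightarrow> u p = \<zero>\<^bsub>R\<^esub>"
      using u unfolding free_carrier by blast+
    have "finite (Inl -` {p. u p \<noteq> \<zero>\<^bsub>R\<^esub>})" "finite (Inr -` {p. u p \<noteq> \<zero>\<^bsub>R\<^esub>})"
      by (rule finite_vimageI[OF fin], simp)+
    then show "l u \<in> carrier (free_module R S)" "r u \<in> carrier (free_module R S')"
      using uc u0 by (auto simp: free_carrier l_def r_def vimage_def)
  qed
  have cs: "case_sum u v \<in> carrier (free_module R (S <+> S'))"
    if u: "u \<in> carrier (free_module R S)" and v: "v \<in> carrier (free_module R S')" for u v
  proof -
    have "{p. case_sum u v p \<noteq> \<zero>\<^bsub>R\<^esub>} \<subseteq> Inl ` {s. u s \<noteq> \<zero>\<^bsub>R\<^esub>} \<union> Inr ` {s. v s \<noteq> \<zero>\<^bsub>R\<^esub>}"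
    proof
      fix p assume "p \<in> {p. case_sum u v p \<noteq> \<zero>\<^bsub>R\<^esub>}"
      then show "p \<in> Inl ` {s. u s \<noteq> \<zero>\<^bsub>R\<^esub>} \<union> Inr ` {s. v s \<noteq> \<zero>\<^bsub>R\<^esub>}" by (cases p) auto
    qed
    moreover have "finite (Inl ` {s. u s \<noteq> \<zero>\<^bsub>R\<^esub>} \<union> Inr ` {s. v s \<noteq> \<zero>\<^bsub>R\<^esub>})"
      using u v by (simp add: free_carrier)
    ultimately have "finite {p. case_sum u v p \<noteq> \<zero>\<^bsub>R\<^esub>}" by (rule finite_subset)
    moreover have "case_sum u v p \<in> carrier R" for p using u v by (simp add: free_carrier split: sum.split)
    moreover have "case_sum u v p = \<zero>\<^bsub>R\<^esub>" if "p \<notin> S <+> S'" for p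
      using u v that by (cases p) (auto simp: free_carrier)
    ultimately show ?thesis unfolding free_carrier by blast
  qed
  have lg: "l u \<in> gcomp (gfree S d) g" and rg: "r u \<in> gcomp (gfree S' d') g" if "u \<in> gcomp ?F g" for u g
  proof -
    have u: "u \<in> carrier (free_module R (S <+> S'))"
      and ug: "\<And>p. p \<in> S <+> S' \<Longrightarrow> u p \<in> gcomp R (g - case_sum d d' p)"
      using that by (auto simp: gcomp_gfree)
    show "l u \<in> gcomp (gfree S d) g" using l[OF u] ug[of "Inl _"] by (auto simp: gcomp_gfree l_def)
    show "r u \<in> gcomp (gfree S' d') g" using r[OF u] ug[of "Inr _"] by (auto simp: gcomp_gfree r_def)
  qed
  have fg: "f u \<in> gcomp M g" if "u \<in> gcomp (gfree S d) g" for u g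
    using f that unfolding graded_hom_def by blast
  have hg: "h u \<in> gcomp N g" if "u \<in> gcomp (gfree S' d') g" for u g
    using h that unfolding graded_hom_def by blast
  have f'g: "f' x \<in> gcomp (gfree S d) g" if "x \<in> gcomp M g" for x g
    using f' that unfolding graded_hom_def by blast
  have h'g: "h' x \<in> gcomp (gfree S' d') g" if "x \<in> gcomp N g" for x g
    using h' that unfolding graded_hom_def by blast
  have "(\<lambda>u. (f (l u), h (r u))) \<in> module_hom R ?F ?D"
  proof (rule module_homI)
    fix u v assume u: "u \<in> carrier ?F" and v: "v \<in> carrier ?F"
    have "l (u \<oplus>\<^bsub>?F\<^esub> v) = l u \<oplus>\<^bsub>gfree S d\<^esub> l v" "r (u \<oplus>\<^bsub>?F\<^esub> v) = r u \<oplus>\<^bsub>gfree S' d'\<^esub> r v"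
      by (simp_all add: l_def r_def)
    then show "(f (l (u \<oplus>\<^bsub>?F\<^esub> v)), h (r (u \<oplus>\<^bsub>?F\<^esub> v))) = (f (l u), h (r u)) \<oplus>\<^bsub>?D\<^esub> (f (l v), h (r v))"
      using u v l r by (simp only: module_hom_add[OF fm(1)] module_hom_add[OF fm(3)] gfree_simps(1) direct_sum_simps fst_conv snd_conv)
  next
    fix a u assume a: "a \<in> carrier R" and u: "u \<in> carrier ?F"
    have "l (a \<odot>\<^bsub>?F\<^esub> u) = a \<odot>\<^bsub>gfree S d\<^esub> l u" "r (a \<odot>\<^bsub>?F\<^esub> u) = a \<odot>\<^bsub>gfree S' d'\<^esub> r u"
      by (simp_all add: l_def r_def)
    then show "(f (l (a \<odot>\<^bsub>?F\<^esub> u)), h (r (a \<odot>\<^bsub>?F\<^esub> u))) = a \<odot>\<^bsub>?D\<^esub> (f (l u), h (r u))"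
      using a u l r by (simp only: module_hom_smult[OF fm(1)] module_hom_smult[OF fm(3)] gfree_simps(1) direct_sum_simps fst_conv snd_conv)
  qed (simp add: fc hc l r)
  then have 1: "(\<lambda>u. (f (l u), h (r u))) \<in> graded_hom R ?F ?D"
    unfolding graded_hom_def by (simp add: image_subset_iff fg hg lg rg)
  have "(\<lambda>p. case_sum (f' (fst p)) (h' (snd p))) \<in> module_hom R ?D ?F"
  proof (rule module_homI)
    fix p q assume "p \<in> carrier ?D" "q \<in> carrier ?D"
    then have "fst p \<in> carrier M" "snd p \<in> carrier N" "fst q \<in> carrier M" "snd q \<in> carrier N" by auto
    then show "case_sum (f' (fst (p \<oplus>\<^bsub>?D\<^esub> q))) (h' (snd (p \<oplus>\<^bsub>?D\<^esub> q))) =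
        case_sum (f' (fst p)) (h' (snd p)) \<oplus>\<^bsub>?F\<^esub> case_sum (f' (fst q)) (h' (snd q))"
      by (auto simp: module_hom_add[OF fm(2)] module_hom_add[OF fm(4)] fun_eq_iff split: sum.split)
  next
    fix a p assume "a \<in> carrier R" "p \<in> carrier ?D"
    then have "a \<in> carrier R" "fst p \<in> carrier M" "snd p \<in> carrier N" by auto
    then show "case_sum (f' (fst (a \<odot>\<^bsub>?D\<^esub> p))) (h' (snd (a \<odot>\<^bsub>?D\<^esub> p))) =
        a \<odot>\<^bsub>?F\<^esub> case_sum (f' (fst p)) (h' (snd p))"
      by (auto simp: module_hom_smult[OF fm(2)] module_hom_smult[OF fm(4)] fun_eq_iff split: sum.split)
  qed (auto intro!: cs f'c h'c)
  moreover have "case_sum (f' (fst p)) (h' (snd p)) \<in> gcomp ?F g" if "p \<in> gcomp ?D g" for p g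
  proof -
    have "f' (fst p) \<in> gcomp (gfree S d) g" "h' (snd p) \<in> gcomp (gfree S' d') g"
      using f'g h'g that by auto
    then show ?thesis by (auto simp: gcomp_gfree intro!: cs)
  qed
  ultimately have 2: "(\<lambda>p. case_sum (f' (fst p)) (h' (snd p))) \<in> graded_hom R ?D ?F"
    by (auto simp: graded_hom_def)
  have inv1: "case_sum (f' (fst (f (l u), h (r u)))) (h' (snd (f (l u), h (r u)))) = u" if "u \<in> carrier ?F" for u
    using that ff(1) hh(1) l[of u] r[of u] by (auto simp: l_def r_def fun_eq_iff split: sum.split)
  have inv2: "(f (l (case_sum (f' (fst p)) (h' (snd p)))), h (r (case_sum (f' (fst p)) (h' (snd p))))) = p"
    if "p \<in> carrier ?D" for p
    using that ff(2) hh(2) by (auto simp: l_def r_def)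
  show iso: "graded_isomorphic R ?F ?D"
    unfolding graded_isomorphic_def using inv1 inv2 by (intro bexI[OF _ 1] bexI[OF _ 2]) blast
  show "is_graded_module k R ?D"
    by (rule graded_of_iso[OF gfree_graded direct_sum_module _ iso])
      (use M(1) N(1) graded_moduleD(1)[OF M(1)] graded_moduleD(1)[OF N(1)] graded_moduleD(2)[OF M(1)] graded_moduleD(2)[OF N(1)] in auto)
qed

text \<open>The algebra is free on one generator of degree 0, so its class has the series 1 and
  becomes the identity of the ring.\<close>

lemma regular_type:
  "graded_isomorphic R (gfree {()} (\<lambda>_. 0)) RR" "bdf_index {()} (\<lambda>_. 0)" "cnt {()} (\<lambda>_. 0) = \<one>\<^bsub>Q.A\<^esub>"
proof -
  have "(\<lambda>u. u ()) \<in> graded_hom R (gfree {()} (\<lambda>_. 0)) RR" "(\<lambda>r _. r) \<in> graded_hom R RR (gfree {()} (\<lambda>_. 0))"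
    unfolding graded_hom_def by (auto intro!: module_homI simp: gcomp_gfree free_carrier gcomp_R_carrier)
  then show "graded_isomorphic R (gfree {()} (\<lambda>_. 0)) RR"
    unfolding graded_isomorphic_def by (intro bexI[of _ "\<lambda>u. u ()"] bexI[of _ "\<lambda>r _. r"]) auto
  show "bdf_index {()} (\<lambda>_. 0)" using Q.bounded_support_zero by (simp add: bdf_index_def)
  show "cnt {()} (\<lambda>_. 0) = \<one>\<^bsub>Q.A\<^esub>"
  proof
    fix g :: 'g
    have "{s \<in> {()}. 0 = g} = (if g = 0 then {()} else {})" by auto
    then show "cnt {()} (\<lambda>_. 0) g = \<one>\<^bsub>Q.A\<^esub> g" by (simp add: cnt_def)
  qed
qed

lemma zero_type:
  "graded_isomorphic R (gfree ({} :: unit set) (\<lambda>_. 0)) (zero_graded_module :: ('r, unit, 'g) graded_module)"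
  "is_graded_module k R (zero_graded_module :: ('r, unit, 'g) graded_module)"
  "bdf_index ({} :: unit set) (\<lambda>_. 0)" "cnt ({} :: unit set) (\<lambda>_. 0) = (\<lambda>_. 0)"
proof -
  let ?Z = "zero_graded_module :: ('r, unit, 'g) graded_module"
  have "(\<lambda>_. ()) \<in> graded_hom R (gfree ({} :: unit set) (\<lambda>_. 0)) ?Z"
    "(\<lambda>_ _. \<zero>\<^bsub>R\<^esub>) \<in> graded_hom R ?Z (gfree ({} :: unit set) (\<lambda>_. 0))"
    unfolding graded_hom_def by (auto intro!: module_homI simp: gcomp_gfree free_carrier zero_graded_module_def)
  then show iso: "graded_isomorphic R (gfree ({} :: unit set) (\<lambda>_. 0)) ?Z"
    unfolding graded_isomorphic_def
    by (intro bexI[of _ "\<lambda>_. ()"] bexI[of _ "\<lambda>_ _. \<zero>\<^bsub>R\<^esub>"]) (auto simp: free_carrier)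
  have "module R ?Z"
  proof (rule moduleI)
    show "abelian_group ?Z" by (rule abelian_groupI) (auto simp: zero_graded_module_def)
  qed (auto simp: zero_graded_module_def cring_R)
  then show "is_graded_module k R ?Z"
    by (rule graded_of_iso[OF gfree_graded _ _ iso]) (simp add: zero_graded_module_def)
  have "Q.bounded_support {}" by (rule Q.bounded_support_subset[OF Q.bounded_support_Q]) simp
  then show "bdf_index ({} :: unit set) (\<lambda>_. 0)" by (simp add: bdf_index_def)
  show "cnt ({} :: unit set) (\<lambda>_. 0) = (\<lambda>_. 0)" by (simp add: cnt_def fun_eq_iff)
qed

section \<open>Representatives of isomorphism classes in one fixed type\<close>

lemma image_module:
  fixes M :: "('r, 'm, 'g) graded_module" and j :: "'m \<Rightarrow> 'p"
  assumes M: "is_graded_module k R M" and j: "inj_on j (carrier M)"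
  shows "\<exists>P :: ('r, 'p, 'g) graded_module. is_graded_module k R P \<and> graded_isomorphic R M P"
proof -
  have Mm: "module R M" by (rule graded_moduleD(1)[OF M])
  interpret M: module R M by (rule Mm)
  define i where "i = inv_into (carrier M) j"
  have ij: "i (j x) = x" if "x \<in> carrier M" for x using that j by (simp add: i_def)
  define P :: "('r, 'p, 'g) graded_module" where
    "P = \<lparr>carrier = j ` carrier M, mult = (\<lambda>_ _. j \<zero>\<^bsub>M\<^esub>), one = j \<zero>\<^bsub>M\<^esub>, ring.zero = j \<zero>\<^bsub>M\<^esub>,
      add = (\<lambda>u v. j (i u \<oplus>\<^bsub>M\<^esub> i v)), smult = (\<lambda>r u. j (r \<odot>\<^bsub>M\<^esub> i u)), gcomp = (\<lambda>g. j ` gcomp M g)\<rparr>"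
  have [simp]: "carrier P = j ` carrier M" "\<zero>\<^bsub>P\<^esub> = j \<zero>\<^bsub>M\<^esub>" "u \<oplus>\<^bsub>P\<^esub> v = j (i u \<oplus>\<^bsub>M\<^esub> i v)"
    "r \<odot>\<^bsub>P\<^esub> u = j (r \<odot>\<^bsub>M\<^esub> i u)" "gcomp P g = j ` gcomp M g" for u v r g
    by (simp_all add: P_def)
  have bij: "bij_betw i (carrier P) (carrier M)"
    by (rule bij_betw_byWitness[where f' = j]) (auto simp: ij)
  have gc: "x \<in> carrier M" if "x \<in> gcomp M g" for x g by (rule graded_moduleD(2)[OF M that])
  have P: "module R P"
    by (rule module_transport[OF Mm bij]) (auto simp: ij)
  have hom: "i \<in> module_hom R P M" by (rule module_homI) (auto simp: ij)
  have sub: "gcomp P g \<subseteq> carrier P" for g using gc by auto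
  have im: "i ` gcomp P g = gcomp M g" for g using gc ij by (force simp: image_image)
  have "is_graded_module k R P" by (rule graded_transport[OF M P hom bij sub im])
  moreover have "graded_isomorphic R M P"
    by (rule graded_isomorphic_sym[OF graded_isoI[OF P hom bij sub im]])
  ultimately show ?thesis by blast
qed

text \<open>Listing the coordinates of all homogeneous components embeds the module into functions
  on pairs of a degree and a number. The map is injective because an element is the sum of its
  components; the module structure is copied to the image.\<close>

lemma exists_rep:
  fixes M :: "('r, 'm, 'g) graded_module"
  assumes M: "is_graded_module k R M" and bdf: "bdf k R M"
  shows "\<exists>P :: ('k, 'r, 'g) gmodule_rep. is_graded_module k R P \<and> graded_isomorphic R M P"
proof -
  have fd: "vectorspace.fin_dim k (component_space R M g)" for g using bdf by (simp add: bdf_def)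
  have "\<forall>g. \<exists>\<chi>. coords k (component_space R M g) {..<vectorspace.dim k (component_space R M g)} \<chi>"
    using vectorspace.coords_exists[OF component_vectorspace[OF M] fd] by blast
  then obtain \<chi> where \<chi>: "\<And>g. coords k (component_space R M g) {..<vectorspace.dim k (component_space R M g)} (\<chi> g)"
    by metis
  have inj: "inj_on (\<chi> g) (gcomp M g)" for g using \<chi>[of g] by (simp add: coords_def bij_betw_def)
  define j :: "'m \<Rightarrow> 'g \<times> nat \<Rightarrow> 'k" where "j x = (\<lambda>(g, i). \<chi> g (hcomp M x g) i)" for x
  have "inj_on j (carrier M)"
  proof (rule inj_onI)
    fix x y assume xy: "x \<in> carrier M" "y \<in> carrier M" "j x = j y"
    have "hcomp M x g = hcomp M y g" for g
    proof (rule inj_onD[OF inj])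
      show "\<chi> g (hcomp M x g) = \<chi> g (hcomp M y g)"
      proof
        fix i show "\<chi> g (hcomp M x g) i = \<chi> g (hcomp M y g) i"
          using fun_cong[OF xy(3), of "(g, i)"] by (simp add: j_def)
      qed
    qed (rule hcomp_props(1)[OF M xy(1)], rule hcomp_props(1)[OF M xy(2)])
    then have eq: "hcomp M x = hcomp M y" by blast
    show "x = y"
      by (rule trans[OF hcomp_props(3)[OF M xy(1)] hcomp_props(3)[OF M xy(2), folded eq, symmetric]])
  qed
  from image_module[OF M this] show ?thesis by blast
qed

text \<open>A canonical index set with \<open>a g\<close> generators of degree \<open>g\<close>; it
  realises every series with nonnegative coefficients.\<close>

lemma series_index:
  assumes a: "a \<in> carrier Q.A" and pos: "\<And>g. a g \<ge> 0"
  shows "bdf_index {(g, i). i < nat (a g)} fst" "cnt {(g, i). i < nat (a g)} fst = a"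
proof -
  let ?S = "{(g, i). i < nat (a g)}"
  have fib: "{s \<in> ?S. fst s = g} = Pair g ` {..<nat (a g)}" for g by auto
  have "Q.bounded_support {g. a g \<noteq> 0}" using a by (simp add: Q.series_carrier)
  then have "Q.bounded_support (fst ` ?S)" by (rule Q.bounded_support_subset) auto
  then show "bdf_index ?S fst" unfolding bdf_index_def fib by simp
  show "cnt ?S fst = a"
    unfolding cnt_def fib using pos by (auto simp: card_image inj_on_def fun_eq_iff)
qed

text \<open>The map from the free module is injective because the bilinear map of coordinates inverts it on the generators, and surjective because both arguments of a pure tensor can be expanded in generators.\<close>

lemma tensor_type:
  fixes M :: "('r, 'm, 'g) graded_module" and N :: "('r, 'n, 'g) graded_module"
    and d :: "'s \<Rightarrow> 'g" and d' :: "'t \<Rightarrow> 'g"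
  assumes M: "is_graded_module k R M" "graded_isomorphic R (gfree S d) M"
    and N: "is_graded_module k R N" "graded_isomorphic R (gfree S' d') N"
  shows "graded_isomorphic R (gfree (S \<times> S') (\<lambda>(s, t). d s + d' t)) (graded_tensor k R M N)"
    "is_graded_module k R (graded_tensor k R M N)"
proof -
  have Mm: "module R M" and Nm: "module R N"
    by (rule graded_moduleD(1)[OF M(1)], rule graded_moduleD(1)[OF N(1)])
  interpret X: two_modules R M N using Mm Nm by (simp add: two_modules_def)
  let ?D = "\<lambda>(s, t). d s + d' t"
  let ?F = "gfree (S \<times> S') ?D"
  let ?T = "tensor_module R M N"
  let ?GT = "graded_tensor k R M N"
  have Fm: "module R ?F" by (rule gfree_module)
  obtain f f' where f: "f \<in> graded_hom R (gfree S d) M" and f': "f' \<in> graded_hom R M (gfree S d)"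
    and ff: "\<forall>x\<in>carrier (gfree S d). f' (f x) = x" "\<forall>x\<in>carrier M. f (f' x) = x"
    using M(2) unfolding graded_isomorphic_def by blast
  obtain h h' where h: "h \<in> graded_hom R (gfree S' d') N" and h': "h' \<in> graded_hom R N (gfree S' d')"
    and hh: "\<forall>x\<in>carrier (gfree S' d'). h' (h x) = x" "\<forall>x\<in>carrier N. h (h' x) = x"
    using N(2) unfolding graded_isomorphic_def by blast
  have fm: "f \<in> module_hom R (gfree S d) M" "f' \<in> module_hom R M (gfree S d)"
    "h \<in> module_hom R (gfree S' d') N" "h' \<in> module_hom R N (gfree S' d')"
    using f f' h h' by (simp_all add: graded_hom_def)
  have f'c: "f' x \<in> carrier (free_module R S)" if "x \<in> carrier M" for x
    using module_hom_closed[OF fm(2)] that by auto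
  have h'c: "h' x \<in> carrier (free_module R S')" if "x \<in> carrier N" for x
    using module_hom_closed[OF fm(4)] that by auto
  have fg: "f u \<in> gcomp M g" if "u \<in> gcomp (gfree S d) g" for u g
    using f that unfolding graded_hom_def by blast
  have hg: "h u \<in> gcomp N g" if "u \<in> gcomp (gfree S' d') g" for u g
    using h that unfolding graded_hom_def by blast
  have f'g: "f' x \<in> gcomp (gfree S d) g" if "x \<in> gcomp M g" for x g
    using f' that unfolding graded_hom_def by blast
  have h'g: "h' x \<in> gcomp (gfree S' d') g" if "x \<in> gcomp N g" for x g
    using h' that unfolding graded_hom_def by blast
  define b where "b = (\<lambda>s. f (\<delta> s))"
  define c where "c = (\<lambda>t. h (\<delta> t))"
  have bg: "b s \<in> gcomp M (d s)" if "s \<in> S" for s unfolding b_def by (rule fg[OF \<delta>_gcomp[OF that]])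
  have cg: "c t \<in> gcomp N (d' t)" if "t \<in> S'" for t unfolding c_def by (rule hg[OF \<delta>_gcomp[OF that]])
  have bc: "b s \<in> carrier M" if "s \<in> S" for s by (rule graded_moduleD(2)[OF M(1) bg[OF that]])
  have cc: "c t \<in> carrier N" if "t \<in> S'" for t by (rule graded_moduleD(2)[OF N(1) cg[OF that]])
  define e where "e = (\<lambda>(s, t). X.tens (b s) (c t))"
  have ec: "e \<in> S \<times> S' \<rightarrow> carrier ?T" by (auto simp: e_def bc cc)
  let ?\<Psi> = "free_module_eval R ?T e"
  have \<Psi>: "?\<Psi> \<in> module_hom R ?F ?T"
    unfolding gfree_hom_iff by (rule free_module_eval_hom[OF X.T_module ec])
  have \<Psi>\<delta>: "?\<Psi> (\<delta> p) = e p" if "p \<in> S \<times> S'" for p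
    by (rule eval_at_\<delta>[OF X.T_module]) (use ec that in blast)
  \<comment> \<open>The coordinates of a pure tensor with respect to the pairs of generators are the
    products of the coordinates of its factors.\<close>
  define \<beta> where "\<beta> x y = (\<lambda>(s, t). f' x s \<otimes>\<^bsub>R\<^esub> h' y t)" for x y
  have \<beta>c: "\<beta> x y \<in> carrier ?F" if "x \<in> carrier M" "y \<in> carrier N" for x y
  proof -
    note x = f'c[OF that(1), unfolded free_carrier] and y = h'c[OF that(2), unfolded free_carrier]
    have "{p. \<beta> x y p \<noteq> \<zero>\<^bsub>R\<^esub>} \<subseteq> {s. f' x s \<noteq> \<zero>\<^bsub>R\<^esub>} \<times> {t. h' y t \<noteq> \<zero>\<^bsub>R\<^esub>}"
      using x y by (auto simp: \<beta>_def)
    moreover have "finite ({s. f' x s \<noteq> \<zero>\<^bsub>R\<^esub>} \<times> {t. h' y t \<noteq> \<zero>\<^bsub>R\<^esub>})" using x y by blast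
    ultimately have "finite {p. \<beta> x y p \<noteq> \<zero>\<^bsub>R\<^esub>}" by (rule finite_subset)
    moreover have "\<beta> x y p \<in> carrier R" for p using x y by (simp add: \<beta>_def split: prod.split)
    moreover have "\<beta> x y p = \<zero>\<^bsub>R\<^esub>" if "p \<notin> S \<times> S'" for p
    proof -
      obtain s t where p: "p = (s, t)" by (cases p)
      with that have "f' x s = \<zero>\<^bsub>R\<^esub> \<or> h' y t = \<zero>\<^bsub>R\<^esub>" using x y by blast
      then show ?thesis using p x y by (auto simp: \<beta>_def)
    qed
    ultimately show ?thesis unfolding gfree_simps(1) free_carrier by blast
  qed
  have f'R: "f' x s \<in> carrier R" if "x \<in> carrier M" for x s using f'c[OF that] unfolding free_carrier by blast
  have h'R: "h' y t \<in> carrier R" if "y \<in> carrier N" for y t using h'c[OF that] unfolding free_carrier by blast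
  obtain \<Phi> where \<Phi>: "\<Phi> \<in> module_hom R ?T ?F"
    and \<Phi>t: "\<And>x y. x \<in> carrier M \<Longrightarrow> y \<in> carrier N \<Longrightarrow> \<Phi> (X.tens x y) = \<beta> x y"
  proof (rule X.tens_universal[OF Fm, of \<beta>])
    show "\<beta> (x \<oplus>\<^bsub>M\<^esub> x') y = \<beta> x y \<oplus>\<^bsub>?F\<^esub> \<beta> x' y"
      if "x \<in> carrier M" "x' \<in> carrier M" "y \<in> carrier N" for x x' y
      using that by (simp add: \<beta>_def module_hom_add[OF fm(2)] fun_eq_iff R.l_distr f'R h'R)
    show "\<beta> x (y \<oplus>\<^bsub>N\<^esub> y') = \<beta> x y \<oplus>\<^bsub>?F\<^esub> \<beta> x y'"
      if "x \<in> carrier M" "y \<in> carrier N" "y' \<in> carrier N" for x y y'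
      using that by (simp add: \<beta>_def module_hom_add[OF fm(4)] fun_eq_iff R.r_distr f'R h'R)
    show "\<beta> (r \<odot>\<^bsub>M\<^esub> x) y = r \<odot>\<^bsub>?F\<^esub> \<beta> x y" if "r \<in> carrier R" "x \<in> carrier M" "y \<in> carrier N" for r x y
      using that by (simp add: \<beta>_def module_hom_smult[OF fm(2)] fun_eq_iff R.m_assoc f'R h'R)
    show "\<beta> x (r \<odot>\<^bsub>N\<^esub> y) = r \<odot>\<^bsub>?F\<^esub> \<beta> x y" if "r \<in> carrier R" "x \<in> carrier M" "y \<in> carrier N" for r x y
      using that by (simp add: \<beta>_def module_hom_smult[OF fm(4)] fun_eq_iff R.m_lcomm f'R h'R)
  qed (use \<beta>c in auto)
  have \<beta>\<delta>: "\<beta> (b s) (c t) = \<delta> (s, t)" if "s \<in> S" "t \<in> S'" for s t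
    using ff(1) hh(1) that by (auto simp: \<beta>_def b_def c_def \<delta>_carrier) (auto simp: \<delta>_def fun_eq_iff)
  have \<Phi>\<Psi>: "\<Phi> (?\<Psi> u) = u" if u: "u \<in> carrier (free_module R (S \<times> S'))" for u
  proof -
    have "(\<lambda>u. \<Phi> (?\<Psi> u)) \<in> module_hom R ?F ?F"
      using \<Phi> \<Psi> by (auto simp: module_hom_def Pi_iff)
    from gfree_hom_eval[OF Fm this u]
    have "\<Phi> (?\<Psi> u) = free_module_eval R ?F (\<lambda>p. \<Phi> (?\<Psi> (\<delta> p))) u" .
    also have "\<dots> = free_module_eval R ?F \<delta> u"
    proof (rule eval_cong[OF Fm u])
      fix p assume "p \<in> S \<times> S'"
      then obtain s t where p: "p = (s, t)" "s \<in> S" "t \<in> S'" by blast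
      then have "?\<Psi> (\<delta> p) = X.tens (b s) (c t)" using \<Psi>\<delta>[of p] by (simp add: e_def)
      then show "\<Phi> (?\<Psi> (\<delta> p)) = \<delta> p" using \<Phi>t[OF bc cc] \<beta>\<delta> p by simp
    qed (auto intro: \<delta>_carrier)
    also have "\<dots> = u" by (rule eval_\<delta>[OF u])
    finally show ?thesis .
  qed
  define im where "im = ?\<Psi> ` carrier ?F"
  interpret \<Psi>: mod_hom R ?F ?T ?\<Psi> using \<Psi> Fm X.T_module by (simp add: mod_hom_def mod_hom_axioms_def)
  note im_sub = \<Psi>.im_is_submodule[unfolded \<Psi>.im_def, folded im_def]
  have im_add: "x \<oplus>\<^bsub>?T\<^esub> y \<in> im" if "x \<in> im" "y \<in> im" for x y
    using that im_sub unfolding submodule_def by blast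
  have im_smult: "r \<odot>\<^bsub>?T\<^esub> x \<in> im" if "r \<in> carrier R" "x \<in> im" for r x
    using that im_sub unfolding submodule_def by blast
  have im_zero: "\<zero>\<^bsub>?T\<^esub> \<in> im" using im_sub unfolding submodule_def by blast
  interpret MM: module R M by (rule Mm)
  interpret NN: module R N by (rule Nm)
  have im1: "X.tens (b s) (c t) \<in> im" if "s \<in> S" "t \<in> S'" for s t
    using \<Psi>\<delta>[of "(s, t)"] \<delta>_carrier[of "(s, t)" "S \<times> S'"] that unfolding im_def e_def
    by (intro image_eqI[of _ _ "\<delta> (s, t)"]) auto
  \<comment> \<open>Tensors are reached in two stages: the left factor is expanded with a generator
    on the right, then the right factor is expanded.\<close>
  have im2: "X.tens x (c t) \<in> im" if x: "x \<in> carrier M" and t: "t \<in> S'" for x t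
  proof -
    let ?W = "{x \<in> carrier M. X.tens x (c t) \<in> im}"
    have "x = free_module_eval R M b (f' x)"
      using gfree_hom_eval[OF Mm fm(1) f'c[OF x]] ff(2) x by (simp add: b_def)
    also have "\<dots> \<in> ?W"
      unfolding free_module_eval_def
    proof (rule finsum_mem[OF Mm])
      fix s assume "s \<in> {s. f' x s \<noteq> \<zero>\<^bsub>R\<^esub>}"
      then have "s \<in> S" using f'c[OF x] unfolding free_carrier by blast
      then show "f' x s \<odot>\<^bsub>M\<^esub> b s \<in> ?W"
        using f'R[OF x] bc im1 t im_smult by (simp add: X.tens_smult_left)
    qed (use cc[OF t] im_zero im_add in \<open>auto simp: X.tens_zero_left X.tens_add_left\<close>)
    finally show ?thesis by simp
  qed
  have im3: "X.tens x y \<in> im" if x: "x \<in> carrier M" and y: "y \<in> carrier N" for x y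
  proof -
    let ?W = "{y \<in> carrier N. X.tens x y \<in> im}"
    have "y = free_module_eval R N c (h' y)"
      using gfree_hom_eval[OF Nm fm(3) h'c[OF y]] hh(2) y by (simp add: c_def)
    also have "\<dots> \<in> ?W"
      unfolding free_module_eval_def
    proof (rule finsum_mem[OF Nm])
      fix s assume "s \<in> {s. h' y s \<noteq> \<zero>\<^bsub>R\<^esub>}"
      then have "s \<in> S'" using h'c[OF y] unfolding free_carrier by blast
      then show "h' y s \<odot>\<^bsub>N\<^esub> c s \<in> ?W"
        using h'R[OF y] cc im2 x im_smult by (simp add: X.tens_smult_right)
    qed (use x im_zero im_add in \<open>auto simp: X.tens_zero_right X.tens_add_right\<close>)
    finally show ?thesis by simp
  qed
  have surj: "Z \<in> im" if "Z \<in> carrier ?T" for Z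
    by (rule X.tens_generate[OF that]) (use im3 im_zero im_add im_smult in auto)
  have "?\<Psi> ` carrier ?F = carrier ?T"
  proof
    show "?\<Psi> ` carrier ?F \<subseteq> carrier ?T" using \<Psi>.f_im by blast
    show "carrier ?T \<subseteq> ?\<Psi> ` carrier ?F" using surj unfolding im_def by blast
  qed
  moreover have "inj_on ?\<Psi> (carrier ?F)"
    by (rule inj_on_inverseI[of _ \<Phi>]) (simp add: \<Phi>\<Psi>)
  ultimately have bij: "bij_betw ?\<Psi> (carrier ?F) (carrier ?T)" by (simp add: bij_betw_def)
  \<comment> \<open>A pure tensor has some preimage by surjectivity, and applying the left inverse
    \<Phi> identifies that preimage as the coordinate function.\<close>
  have \<Psi>\<beta>: "?\<Psi> (\<beta> x y) = X.tens x y" if xy: "x \<in> carrier M" "y \<in> carrier N" for x y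
  proof -
    obtain w where w: "w \<in> carrier ?F" "X.tens x y = ?\<Psi> w" using im3[OF xy] unfolding im_def by blast
    then have "\<beta> x y = w" using \<Phi>t[OF xy] \<Phi>\<Psi>[of w] by simp
    then show ?thesis using w by simp
  qed
  let ?V = "restrict_scalars R ?T"
  interpret V: vectorspace k ?V by (rule restrict_vectorspace[OF X.T_module])
  define G where "G u = {X.tens x y | x y g h. g + h = u \<and> x \<in> gcomp M g \<and> y \<in> gcomp N h}" for u
  have gcM: "x \<in> carrier M" if "x \<in> gcomp M g" for x g by (rule graded_moduleD(2)[OF M(1) that])
  have gcN: "x \<in> carrier N" if "x \<in> gcomp N g" for x g by (rule graded_moduleD(2)[OF N(1) that])
  have GT: "carrier ?GT = carrier ?T" "add ?GT = add ?T" "\<zero>\<^bsub>?GT\<^esub> = \<zero>\<^bsub>?T\<^esub>" "smult ?GT = smult ?T"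
    "gcomp ?GT u = V.span (G u)" for u
    by (simp_all add: graded_tensor_def G_def X.tens_def)
  have GV: "G u \<subseteq> carrier ?V" for u using gcM gcN by (auto simp: G_def)
  \<comment> \<open>In one direction each coefficient is absorbed into the left factor, giving a
    tensor of homogeneous elements of total degree \<open>u\<close>. In the other, coordinates of
    homogeneous factors have degrees \<open>g - d s\<close> and \<open>v - d' t\<close>, whose sum
    is \<open>u\<close> minus the degree of the pair.\<close>
  have im_g: "?\<Psi> ` gcomp ?F u = V.span (G u)" for u
  proof
    have "subspace k (V.span (G u)) ?V" by (rule V.span_is_subspace[OF GV])
    note sp = this[unfolded restrict_subspace_iff[OF X.T_module]]
    have gen: "X.tens x y \<in> V.span (G u)" if "x \<in> gcomp M g" "y \<in> gcomp N v" "g + v = u" for x y g v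
      by (rule subsetD[OF V.in_own_span[OF GV]]) (use that in \<open>auto simp: G_def\<close>)
    show "?\<Psi> ` gcomp ?F u \<subseteq> V.span (G u)"
    proof (rule image_subsetI)
      fix w assume w: "w \<in> gcomp ?F u"
      have wc: "w \<in> carrier (free_module R (S \<times> S'))" and wg: "\<And>p. p \<in> S \<times> S' \<Longrightarrow> w p \<in> gcomp R (u - ?D p)"
        using w unfolding gcomp_gfree by blast+
      show "?\<Psi> w \<in> V.span (G u)"
        unfolding free_module_eval_def
      proof (rule finsum_mem[OF X.T_module])
        fix p assume "p \<in> {p. w p \<noteq> \<zero>\<^bsub>R\<^esub>}"
        then have pS: "p \<in> S \<times> S'" using wc unfolding free_carrier by blast
        then obtain s t where p: "p = (s, t)" "s \<in> S" "t \<in> S'" by blast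
        have wp: "w p \<in> gcomp R (u - ?D p)" by (rule wg[OF pS])
        have "e p = X.tens (b s) (c t)" by (simp add: e_def p(1))
        then have "w p \<odot>\<^bsub>?T\<^esub> e p = X.tens (w p \<odot>\<^bsub>M\<^esub> b s) (c t)"
          by (simp only: X.tens_smult_left[OF gcomp_R_carrier[OF wp]])
        also have "\<dots> \<in> V.span (G u)"
          by (rule gen[OF graded_moduleD(7)[OF M(1) wp bg[OF p(2)]] cg[OF p(3)]]) (simp add: p)
        finally show "w p \<odot>\<^bsub>?T\<^esub> e p \<in> V.span (G u)" .
      qed (use sp in auto)
    qed
    have "subspace k (?\<Psi> ` gcomp ?F u) ?V"
      unfolding restrict_subspace_iff[OF X.T_module]
    proof (intro conjI ballI)
      have Fc: "w \<in> carrier ?F" if "w \<in> gcomp ?F u" for w by (rule graded_moduleD(2)[OF gfree_graded that])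
      show "?\<Psi> ` gcomp ?F u \<subseteq> carrier ?T" by (rule image_subsetI) (rule \<Psi>.f_im[OF Fc])
      show "\<zero>\<^bsub>?T\<^esub> \<in> ?\<Psi> ` gcomp ?F u"
        by (rule image_eqI[where x = "\<zero>\<^bsub>?F\<^esub>"], rule \<Psi>.f0_is_0[symmetric], rule graded_moduleD(3)[OF gfree_graded])
      fix x y assume "x \<in> ?\<Psi> ` gcomp ?F u" "y \<in> ?\<Psi> ` gcomp ?F u"
      then obtain v w where vw: "v \<in> gcomp ?F u" "w \<in> gcomp ?F u" "x = ?\<Psi> v" "y = ?\<Psi> w" by blast
      have "x \<oplus>\<^bsub>?T\<^esub> y = ?\<Psi> (v \<oplus>\<^bsub>?F\<^esub> w)"
        unfolding vw(3,4) by (rule module_hom_add[OF \<Psi> Fc[OF vw(1)] Fc[OF vw(2)], symmetric])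
      then show "x \<oplus>\<^bsub>?T\<^esub> y \<in> ?\<Psi> ` gcomp ?F u"
        using graded_moduleD(4)[OF gfree_graded vw(1,2)] by (rule image_eqI)
    next
      have Fc: "w \<in> carrier ?F" if "w \<in> gcomp ?F u" for w by (rule graded_moduleD(2)[OF gfree_graded that])
      fix a x assume a: "a \<in> carrier k" and "x \<in> ?\<Psi> ` gcomp ?F u"
      then obtain v where v: "v \<in> gcomp ?F u" "x = ?\<Psi> v" by blast
      have "\<iota> a \<odot>\<^bsub>?T\<^esub> x = ?\<Psi> (\<iota> a \<odot>\<^bsub>?F\<^esub> v)"
        unfolding v(2) by (rule module_hom_smult[OF \<Psi> \<iota>_closed[OF a] Fc[OF v(1)], symmetric])
      then show "\<iota> a \<odot>\<^bsub>?T\<^esub> x \<in> ?\<Psi> ` gcomp ?F u"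
        using graded_moduleD(5)[OF gfree_graded a v(1)] by (rule image_eqI)
    qed
    then have sm: "submodule k (?\<Psi> ` gcomp ?F u) ?V" by (simp add: subspace_def)
    have "G u \<subseteq> ?\<Psi> ` gcomp ?F u"
    proof
      fix Z assume "Z \<in> G u"
      then obtain x y g v where Z: "Z = X.tens x y" "g + v = u" "x \<in> gcomp M g" "y \<in> gcomp N v"
        by (auto simp: G_def)
      have "\<beta> x y p \<in> gcomp R (u - ?D p)" if pS: "p \<in> S \<times> S'" for p
      proof -
        obtain s t where p: "p = (s, t)" "s \<in> S" "t \<in> S'" using pS by blast
        have "f' x s \<in> gcomp R (g - d s)" "h' y t \<in> gcomp R (v - d' t)"
          using f'g[OF Z(3)] h'g[OF Z(4)] p by (auto simp: gcomp_gfree)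
        from gcomp_R_mult[OF this] have "f' x s \<otimes>\<^bsub>R\<^esub> h' y t \<in> gcomp R ((g - d s) + (v - d' t))" .
        moreover have "(g - d s) + (v - d' t) = u - ?D p" using Z(2) p by (simp add: algebra_simps)
        ultimately show ?thesis using p by (simp add: \<beta>_def)
      qed
      then have mem: "\<beta> x y \<in> gcomp ?F u"
        using \<beta>c[OF gcM[OF Z(3)] gcN[OF Z(4)]] unfolding gcomp_gfree gfree_simps by blast
      have Zeq: "Z = ?\<Psi> (\<beta> x y)" using \<Psi>\<beta>[OF gcM[OF Z(3)] gcN[OF Z(4)]] Z(1) by simp
      show "Z \<in> ?\<Psi> ` gcomp ?F u" unfolding Zeq by (rule imageI[OF mem])
    qed
    from V.span_is_subset[OF this sm] show "V.span (G u) \<subseteq> ?\<Psi> ` gcomp ?F u" .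
  qed
  have GTm: "module R ?GT"
    by (rule module_transport[OF X.T_module, where f = "\<lambda>x. x"]) (auto simp: GT bij_betw_def)
  have \<Psi>': "?\<Psi> \<in> module_hom R ?F ?GT" using \<Psi> by (simp add: module_hom_def GT)
  have bij': "bij_betw ?\<Psi> (carrier ?F) (carrier ?GT)" using bij by (simp add: GT)
  show iso: "graded_isomorphic R ?F ?GT"
    by (rule graded_isoI[OF Fm \<Psi>' bij' _ im_g[folded GT(5)]])
      (rule subsetI, rule graded_moduleD(2)[OF gfree_graded])
  have "gcomp ?GT g \<subseteq> carrier ?GT" for g
    unfolding GT im_g[symmetric]
    by (rule image_subsetI) (rule \<Psi>.f_im[OF graded_moduleD(2)[OF gfree_graded]])
  from graded_of_iso[OF gfree_graded GTm this iso] show "is_graded_module k R ?GT" .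
qed

end

section \<open>The Grothendieck ring\<close>

text \<open>Injectivity of \<open>f\<close> pulls back the ring equations, and surjectivity supplies
  additive inverses.\<close>

lemma cring_transport:
  assumes A: "cring A" and f: "bij_betw f (carrier B) (carrier A)"
    and z: "\<zero>\<^bsub>B\<^esub> \<in> carrier B" "f \<zero>\<^bsub>B\<^esub> = \<zero>\<^bsub>A\<^esub>" and o: "\<one>\<^bsub>B\<^esub> \<in> carrier B" "f \<one>\<^bsub>B\<^esub> = \<one>\<^bsub>A\<^esub>"
    and ac: "\<And>x y. x \<in> carrier B \<Longrightarrow> y \<in> carrier B \<Longrightarrow> x \<oplus>\<^bsub>B\<^esub> y \<in> carrier B"
    and a: "\<And>x y. x \<in> carrier B \<Longrightarrow> y \<in> carrier B \<Longrightarrow> f (x \<oplus>\<^bsub>B\<^esub> y) = f x \<oplus>\<^bsub>A\<^esub> f y"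
    and mc: "\<And>x y. x \<in> carrier B \<Longrightarrow> y \<in> carrier B \<Longrightarrow> x \<otimes>\<^bsub>B\<^esub> y \<in> carrier B"
    and m: "\<And>x y. x \<in> carrier B \<Longrightarrow> y \<in> carrier B \<Longrightarrow> f (x \<otimes>\<^bsub>B\<^esub> y) = f x \<otimes>\<^bsub>A\<^esub> f y"
  shows "cring B"
proof -
  interpret A: cring A by fact
  have fc [simp]: "f x \<in> carrier A" if "x \<in> carrier B" for x using f that by (auto simp: bij_betw_def)
  have eqI: "x = y" if "f x = f y" "x \<in> carrier B" "y \<in> carrier B" for x y
    using f that by (auto simp: bij_betw_def inj_on_def)
  show ?thesis
  proof (rule cringI)
    show "abelian_group B"
    proof (rule abelian_groupI)
      fix x assume x: "x \<in> carrier B"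
      have "\<ominus>\<^bsub>A\<^esub> f x \<in> f ` carrier B" using f x by (auto simp: bij_betw_def)
      then obtain y where "y \<in> carrier B" "f y = \<ominus>\<^bsub>A\<^esub> f x" by auto
      then show "\<exists>y\<in>carrier B. y \<oplus>\<^bsub>B\<^esub> x = \<zero>\<^bsub>B\<^esub>"
        using x z by (intro bexI[of _ y] eqI) (auto simp: a ac A.l_neg)
    qed (auto intro!: eqI simp: z ac a A.a_ac)
    show "Group.comm_monoid B"
      by (rule comm_monoidI) (auto intro!: eqI simp: o mc m A.m_ac)
  qed (auto intro!: eqI simp: ac a mc m A.l_distr)
qed

context pdcf_algebra begin

sublocale A: cring Q.A by (rule Q.series_ring_cring)

text \<open>The generators found by minimality are exchanged for the canonical ones with the same
  counts, so that the free model depends on the \<open>K_series\<close> alone.\<close>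

lemma K_props:
  fixes M :: "('r, 'm, 'g) graded_module"
  assumes P: "bdf_projective k R M"
  shows "K_series k R M \<in> carrier Q.A" "K_series k R M g \<ge> 0"
    "graded_isomorphic R (gfree {(g, i). i < nat (K_series k R M g)} fst) M"
    "bdf_index {(g, i). i < nat (K_series k R M g)} fst"
    "cnt {(g, i). i < nat (K_series k R M g)} fst = K_series k R M"
proof -
  have M: "is_graded_module k R M" using P by (simp add: bdf_projective_def)
  obtain S :: "('g \<times> 'm) set" where S: "bdf_index S fst" "graded_isomorphic R (gfree S fst) M"
    using bdf_projective_free[OF P] by blast
  have K: "K_series k R M = cnt S fst" by (rule gfree_type(2)[OF M S(2,1)])
  show 1: "K_series k R M \<in> carrier Q.A" unfolding K by (rule cnt_carrier[OF S(1)])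
  have pos: "K_series k R M g \<ge> 0" for g by (simp add: K cnt_def)
  then show "K_series k R M g \<ge> 0" .
  note idx = series_index[OF 1 pos]
  show "bdf_index {(g, i). i < nat (K_series k R M g)} fst" by (rule idx(1))
  show "cnt {(g, i). i < nat (K_series k R M g)} fst = K_series k R M" by (rule idx(2))
  have "graded_isomorphic R (gfree {(g, i). i < nat (K_series k R M g)} fst) (gfree S fst)"
    by (rule gfree_iso[OF idx(1) S(1) trans[OF idx(2) K]])
  then show "graded_isomorphic R (gfree {(g, i). i < nat (K_series k R M g)} fst) M"
    using S(2) by (rule graded_isomorphic_trans)
qed

lemma bdf_projective_graded: "bdf_projective k R M \<Longrightarrow> is_graded_module k R M"
  by (simp add: bdf_projective_def)

text \<open>Modules with the same \<open>K_series\<close> are isomorphic to the same canonical free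
  module; the converse is invariance of dimensions.\<close>

lemma iso_iff_K:
  assumes M: "bdf_projective k R M" and N: "bdf_projective k R N"
  shows "graded_isomorphic R M N \<longleftrightarrow> K_series k R M = K_series k R N"
proof
  assume "graded_isomorphic R M N"
  then show "K_series k R M = K_series k R N"
    using iso_bdf(3)[OF bdf_projective_graded[OF M] bdf_projective_graded[OF N]] M
    by (simp add: bdf_projective_def)
next
  assume "K_series k R M = K_series k R N"
  then have "graded_isomorphic R (gfree {(g, i). i < nat (K_series k R M g)} fst) N"
    using K_props(3)[OF N] by simp
  then show "graded_isomorphic R M N"
    by (rule graded_isomorphic_trans[OF graded_isomorphic_sym[OF K_props(3)[OF M]]])
qed

lemma rep_exists:
  fixes M :: "('r, 'm, 'g) graded_module"
  assumes M: "is_graded_module k R M" and iso: "graded_isomorphic R (gfree S d) M" and S: "bdf_index S d"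
  shows "\<exists>P :: ('k, 'r, 'g) gmodule_rep. bdf_projective k R P \<and> K_series k R P = cnt S d"
proof -
  have "bdf k R M" using gfree_type(1)[OF M iso S] by (simp add: bdf_projective_def)
  from exists_rep[OF M this] obtain P :: "('k, 'r, 'g) gmodule_rep"
    where P: "is_graded_module k R P" "graded_isomorphic R M P" by blast
  from gfree_type[OF P(1) graded_isomorphic_trans[OF iso P(2)] S] show ?thesis by blast
qed

lemma rep_of_series:
  assumes "a \<in> carrier Q.A" "\<And>g. a g \<ge> 0"
  shows "\<exists>P :: ('k, 'r, 'g) gmodule_rep. bdf_projective k R P \<and> K_series k R P = a"
  using rep_exists[OF gfree_graded graded_isomorphic_refl series_index(1)[OF assms]] series_index(2)[OF assms]
  by simp

text \<open>Ensures that the class of a module of any type is nonempty, which is what comparing and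
  evaluating classes depends on.\<close>

lemma rep_of_module:
  fixes M :: "('r, 'm, 'g) graded_module"
  assumes "bdf_projective k R M"
  shows "\<exists>P :: ('k, 'r, 'g) gmodule_rep. bdf_projective k R P \<and> K_series k R P = K_series k R M"
  by (rule rep_of_series[OF K_props(1,2)[OF assms]])

lemma direct_sum_bdf_projective:
  assumes M: "bdf_projective k R M" and N: "bdf_projective k R N"
  shows "bdf_projective k R (graded_direct_sum M N)"
    "K_series k R (graded_direct_sum M N) = K_series k R M \<oplus>\<^bsub>Q.A\<^esub> K_series k R N"
proof -
  note t = direct_sum_type[OF bdf_projective_graded[OF M] K_props(3)[OF M] bdf_projective_graded[OF N] K_props(3)[OF N]]
  note p = bdf_index_Plus[OF K_props(4)[OF M] K_props(4)[OF N]]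
  show "bdf_projective k R (graded_direct_sum M N)" by (rule gfree_type(1)[OF t(2,1) p(1)])
  show "K_series k R (graded_direct_sum M N) = K_series k R M \<oplus>\<^bsub>Q.A\<^esub> K_series k R N"
    unfolding gfree_type(2)[OF t(2,1) p(1)] by (simp add: fun_eq_iff p(2) K_props(5)[OF M] K_props(5)[OF N])
qed

lemma tensor_bdf_projective:
  assumes M: "bdf_projective k R M" and N: "bdf_projective k R N"
  shows "bdf_projective k R (graded_tensor k R M N)"
    "K_series k R (graded_tensor k R M N) = K_series k R M \<otimes>\<^bsub>Q.A\<^esub> K_series k R N"
proof -
  note t = tensor_type[OF bdf_projective_graded[OF M] K_props(3)[OF M] bdf_projective_graded[OF N] K_props(3)[OF N]]
  note p = bdf_index_times[OF K_props(4)[OF M] K_props(4)[OF N]]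
  show "bdf_projective k R (graded_tensor k R M N)" by (rule gfree_type(1)[OF t(2,1) p(1)])
  show "K_series k R (graded_tensor k R M N) = K_series k R M \<otimes>\<^bsub>Q.A\<^esub> K_series k R N"
    unfolding gfree_type(2)[OF t(2,1) p(1)] by (simp only: p(2) K_props(5)[OF M] K_props(5)[OF N])
qed

lemma regular_bdf_projective: "bdf_projective k R RR" "K_series k R RR = \<one>\<^bsub>Q.A\<^esub>"
proof -
  note t = gfree_type[OF regular_graded regular_type(1,2)]
  show "bdf_projective k R RR" by (rule t(1))
  show "K_series k R RR = \<one>\<^bsub>Q.A\<^esub>" unfolding t(2) by (rule regular_type(3))
qed

abbreviation "ZM \<equiv> zero_graded_module :: ('r, unit, 'g) graded_module"

lemma zero_bdf_projective: "bdf_projective k R ZM" "K_series k R ZM = \<zero>\<^bsub>Q.A\<^esub>"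
proof -
  note t = gfree_type[OF zero_type(2,1,3)]
  show "bdf_projective k R ZM" by (rule t(1))
  show "K_series k R ZM = \<zero>\<^bsub>Q.A\<^esub>" unfolding t(2) by (simp add: zero_type(4))
qed

lemma iso_class_eq:
  assumes "bdf_projective k R M"
  shows "iso_class k R M = {P. bdf_projective k R P \<and> K_series k R P = K_series k R M}"
  unfolding iso_class_def by (auto simp: iso_iff_K[OF assms])

text \<open>Equal classes share a representative, as they are nonempty, and its
  \<open>K_series\<close> is that of both modules.\<close>

lemma iso_class_eq_iff:
  assumes M: "bdf_projective k R M" and N: "bdf_projective k R N"
  shows "iso_class k R M = iso_class k R N \<longleftrightarrow> K_series k R M = K_series k R N"
  unfolding iso_class_eq[OF M] iso_class_eq[OF N] using rep_of_module[OF M] by auto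

abbreviation "S \<equiv> bdf_monoid k R"

lemma carrier_S:
  "carrier S = {iso_class k R P | P :: ('k, 'r, 'g) gmodule_rep. bdf_projective k R P}"
  by (auto simp: bdf_monoid_def)

lemma iso_class_mem:
  assumes M: "bdf_projective k R M"
  shows "iso_class k R M \<in> carrier S"
proof -
  obtain P :: "('k, 'r, 'g) gmodule_rep" where P: "bdf_projective k R P" "K_series k R P = K_series k R M"
    using rep_of_module[OF M] by blast
  then have "iso_class k R P = iso_class k R M" using iso_class_eq_iff[OF P(1) M] by simp
  then show ?thesis using P(1) unfolding carrier_S by blast
qed

text \<open>All members of an isomorphism class have the same \<open>K_series\<close>, so the choice
  does not affect the value.\<close>

definition \<kappa> :: "('k, 'r, 'g) gmodule_rep set \<Rightarrow> 'g \<Rightarrow> int"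
  where "\<kappa> X = K_series k R (SOME P. P \<in> X)"

lemma \<kappa>_iso_class:
  assumes M: "bdf_projective k R M"
  shows "\<kappa> (iso_class k R M) = K_series k R M"
proof -
  obtain P :: "('k, 'r, 'g) gmodule_rep" where "bdf_projective k R P" "K_series k R P = K_series k R M"
    using rep_of_module[OF M] by blast
  then have "P \<in> iso_class k R M" by (simp add: iso_class_eq[OF M])
  then have "(SOME P. P \<in> iso_class k R M) \<in> iso_class k R M" by (rule someI)
  then show ?thesis unfolding \<kappa>_def by (subst (asm) (2) iso_class_eq[OF M]) simp
qed

text \<open>Addition is a union over representatives of both classes. It is constant because the
  series of a direct sum depends only on the two series.\<close>

lemma S_mult:
  fixes P P' :: "('k, 'r, 'g) gmodule_rep"
  assumes P: "bdf_projective k R P" and P': "bdf_projective k R P'"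
  shows "iso_class k R P \<otimes>\<^bsub>S\<^esub> iso_class k R P' = iso_class k R (graded_direct_sum P P')"
proof -
  let ?C = "iso_class k R (graded_direct_sum P P')"
  have const: "iso_class k R (graded_direct_sum U V) = ?C" if "U \<in> iso_class k R P" "V \<in> iso_class k R P'" for U V
  proof -
    have U: "bdf_projective k R U" "K_series k R U = K_series k R P" using that(1) by (simp_all add: iso_class_eq[OF P])
    have V: "bdf_projective k R V" "K_series k R V = K_series k R P'" using that(2) by (simp_all add: iso_class_eq[OF P'])
    show ?thesis
      by (subst iso_class_eq_iff[OF direct_sum_bdf_projective(1)[OF U(1) V(1)] direct_sum_bdf_projective(1)[OF P P']])
        (simp only: direct_sum_bdf_projective(2)[OF U(1) V(1)] direct_sum_bdf_projective(2)[OF P P'] U V)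
  qed
  have ne: "iso_class k R P \<noteq> {}" "iso_class k R P' \<noteq> {}"
    using P P' by (auto simp: iso_class_eq)
  have inner: "(\<Union>V\<in>iso_class k R P'. iso_class k R (graded_direct_sum U V)) = ?C" if "U \<in> iso_class k R P" for U
    by (rule SUP_eq_const[OF ne(2)]) (rule const[OF that])
  have "(\<Union>U\<in>iso_class k R P. \<Union>V\<in>iso_class k R P'. iso_class k R (graded_direct_sum U V)) = ?C"
    by (rule SUP_eq_const[OF ne(1)]) (rule inner)
  then show ?thesis by (simp add: bdf_monoid_def)
qed

lemma S_cases:
  assumes "X \<in> carrier S"
  obtains P :: "('k, 'r, 'g) gmodule_rep" where "bdf_projective k R P" "X = iso_class k R P"
  using assms unfolding carrier_S by blast

lemma A_minus: "a \<ominus>\<^bsub>Q.A\<^esub> b = (\<lambda>g. a g - b g)" if "a \<in> carrier Q.A" "b \<in> carrier Q.A"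
proof -
  have "(\<lambda>g. - b g) \<in> carrier Q.A" using that(2) by (simp add: Q.series_carrier)
  then have "\<ominus>\<^bsub>Q.A\<^esub> b = (\<lambda>g. - b g)" using that(2) by (intro A.minus_equality) auto
  then show ?thesis by (simp add: A.minus_eq)
qed

lemma A_cancel:
  assumes "a \<oplus>\<^bsub>Q.A\<^esub> c = b \<oplus>\<^bsub>Q.A\<^esub> c" "a \<in> carrier Q.A" "b \<in> carrier Q.A" "c \<in> carrier Q.A"
  shows "a = b"
  using assms(1) by (simp add: fun_eq_iff)

text \<open>The invariant \<kappa> is additive because direct sums add counting series, and
  injective because the \<open>K_series\<close> classifies.\<close>

sublocale K: grothendieck_iso Q.A "bdf_monoid k R" \<kappa>
proof
  fix X Y assume "X \<in> carrier S" "Y \<in> carrier S"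
  then obtain P P' :: "('k, 'r, 'g) gmodule_rep" where P: "bdf_projective k R P" "X = iso_class k R P"
    and P': "bdf_projective k R P'" "Y = iso_class k R P'" by (metis S_cases)
  note d = direct_sum_bdf_projective[OF P(1) P'(1)]
  show "X \<otimes>\<^bsub>S\<^esub> Y \<in> carrier S" unfolding P P' S_mult[OF P(1) P'(1)] by (rule iso_class_mem[OF d(1)])
  show "\<kappa> (X \<otimes>\<^bsub>S\<^esub> Y) = \<kappa> X \<oplus>\<^bsub>Q.A\<^esub> \<kappa> Y"
    unfolding P P' S_mult[OF P(1) P'(1)] \<kappa>_iso_class[OF d(1)] \<kappa>_iso_class[OF P(1)] \<kappa>_iso_class[OF P'(1)] by (rule d(2))
next
  have one: "\<one>\<^bsub>S\<^esub> = iso_class k R ZM" by (simp add: bdf_monoid_def)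
  show "\<one>\<^bsub>S\<^esub> \<in> carrier S" unfolding one by (rule iso_class_mem[OF zero_bdf_projective(1)])
  show "\<kappa> \<one>\<^bsub>S\<^esub> = \<zero>\<^bsub>Q.A\<^esub>" unfolding one \<kappa>_iso_class[OF zero_bdf_projective(1)] by (rule zero_bdf_projective(2))
next
  fix X assume "X \<in> carrier S"
  then obtain P :: "('k, 'r, 'g) gmodule_rep" where P: "bdf_projective k R P" "X = iso_class k R P" by (rule S_cases)
  show "\<kappa> X \<in> carrier Q.A" unfolding P \<kappa>_iso_class[OF P(1)] by (rule K_props(1)[OF P(1)])
next
  show "inj_on \<kappa> (carrier S)"
  proof (rule inj_onI)
    fix X Y assume XY: "X \<in> carrier S" "Y \<in> carrier S" "\<kappa> X = \<kappa> Y"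
    then obtain P P' :: "('k, 'r, 'g) gmodule_rep" where P: "bdf_projective k R P" "X = iso_class k R P"
      and P': "bdf_projective k R P'" "Y = iso_class k R P'" by (metis S_cases)
    then show "X = Y" using XY(3) iso_class_eq_iff[OF P(1) P'(1)] by (simp add: \<kappa>_iso_class)
  qed
next
  fix c assume c: "c \<in> carrier Q.A"
  \<comment> \<open>The positive and negative parts of \<open>c\<close>. Both are nonnegative with
    support inside that of \<open>c\<close>, hence both are realised by modules.\<close>
  define p where "p g = max (c g) 0" for g
  define n where "n g = max (- c g) 0" for g
  have pn: "p \<in> carrier Q.A" "n \<in> carrier Q.A"
    using c unfolding Q.series_carrier by (auto simp: p_def n_def elim!: Q.bounded_support_subset)
  obtain P :: "('k, 'r, 'g) gmodule_rep" where P: "bdf_projective k R P" "K_series k R P = p"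
    using rep_of_series[OF pn(1)] by (auto simp: p_def)
  obtain P' :: "('k, 'r, 'g) gmodule_rep" where P': "bdf_projective k R P'" "K_series k R P' = n"
    using rep_of_series[OF pn(2)] by (auto simp: n_def)
  have "c = p \<ominus>\<^bsub>Q.A\<^esub> n" unfolding A_minus[OF pn] by (auto simp: p_def n_def fun_eq_iff)
  then have "c = \<kappa> (iso_class k R P) \<ominus>\<^bsub>Q.A\<^esub> \<kappa> (iso_class k R P')"
    by (simp only: \<kappa>_iso_class[OF P(1)] \<kappa>_iso_class[OF P'(1)] P(2) P'(2))
  then show "\<exists>x\<in>carrier S. \<exists>y\<in>carrier S. c = \<kappa> x \<ominus>\<^bsub>Q.A\<^esub> \<kappa> y"
    using iso_class_mem[OF P(1)] iso_class_mem[OF P'(1)] by blast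
qed

section \<open>The isomorphism and the product on the Grothendieck group\<close>

lemma K0_class_mem: "bdf_projective k R M \<Longrightarrow> K0_class k R M \<in> carrier (K0 k R)"
  unfolding K0_class_def K0_def by (rule K.class_mem[OF iso_class_mem])

lemma \<Phi>_K0_class: "bdf_projective k R M \<Longrightarrow> K.\<Phi> (K0_class k R M) = K_series k R M"
  unfolding K0_class_def by (simp add: K.\<Phi>_class iso_class_mem \<kappa>_iso_class)

lemma K0_generated:
  assumes "X \<in> carrier (K0 k R)"
  obtains P P' :: "('k, 'r, 'g) gmodule_rep" where "bdf_projective k R P" "bdf_projective k R P'"
    "X \<otimes>\<^bsub>K0 k R\<^esub> K0_class k R P' = K0_class k R P"
proof -
  from K.generated[OF assms[unfolded K0_def]] obtain x y where xy: "x \<in> carrier S" "y \<in> carrier S"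
    "X \<otimes>\<^bsub>K0 k R\<^esub> grothendieck_class S y = grothendieck_class S x" unfolding K0_def by blast
  obtain P :: "('k, 'r, 'g) gmodule_rep" where P: "bdf_projective k R P" "x = iso_class k R P" using xy(1) by (rule S_cases)
  obtain P' :: "('k, 'r, 'g) gmodule_rep" where P': "bdf_projective k R P'" "y = iso_class k R P'" using xy(2) by (rule S_cases)
  show thesis by (rule that[OF P(1) P'(1)]) (use xy(3) P P' in \<open>simp add: K0_class_def\<close>)
qed

lemmas \<Phi>_mult = K.\<Phi>_mult[folded K0_def] and \<Phi>_mem = K.\<Phi>_mem[folded K0_def]
  and \<Phi>_eq_iff = K.\<Phi>_eq_iff[folded K0_def] and \<Phi>_bij = K.\<Phi>_bij[folded K0_def]
  and K0_mult_mem = K.mult_G_mem[folded K0_def] and K0_one_mem = K.one_G_mem[folded K0_def]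
  and \<Phi>_one = K.\<Phi>_one[folded K0_def] and \<Phi>_iso = K.\<Phi>_iso[folded K0_def]

text \<open>Any element becomes a class after adding a class, and series cancel; so the prescribed
  values on classes leave one possibility.\<close>

lemma K_series_iso_eq:
  assumes \<phi>: "is_K_series_iso k R \<phi>" and X: "X \<in> carrier (K0 k R)"
  shows "\<phi> X = K.\<Phi> X"
proof -
  have hom: "\<phi> \<in> hom (K0 k R) (add_monoid Q.A)"
    and cl: "\<And>P :: ('k, 'r, 'g) gmodule_rep. bdf_projective k R P \<Longrightarrow> \<phi> (K0_class k R P) = K_series k R P"
    using \<phi> by (auto simp: is_K_series_iso_def iso_def)
  obtain P P' :: "('k, 'r, 'g) gmodule_rep" where P: "bdf_projective k R P" "bdf_projective k R P'"
    "X \<otimes>\<^bsub>K0 k R\<^esub> K0_class k R P' = K0_class k R P"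
    using X by (rule K0_generated)
  have "\<phi> X \<oplus>\<^bsub>Q.A\<^esub> K_series k R P' = K_series k R P"
    using hom_mult[OF hom X K0_class_mem[OF P(2)]] P by (simp add: cl del: Q.series_simps)
  moreover have "K.\<Phi> X \<oplus>\<^bsub>Q.A\<^esub> K_series k R P' = K_series k R P"
    using \<Phi>_mult[OF X K0_class_mem[OF P(2)]] P by (simp add: \<Phi>_K0_class del: Q.series_simps)
  moreover have "\<phi> X \<in> carrier Q.A" using hom X by (auto simp: hom_def)
  ultimately show ?thesis
    using A_cancel[OF _ _ \<Phi>_mem[OF X] K_props(1)[OF P(2)]] by metis
qed

text \<open>Restriction gives the map the fixed value outside the group that
  \<open>is_K_series_iso\<close> prescribes, so that uniqueness can hold literally.\<close>

lemma K_series_iso_restrict: "is_K_series_iso k R (restrict K.\<Phi> (carrier (K0 k R)))"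
  unfolding is_K_series_iso_def
proof (intro conjI allI impI)
  have "\<And>X Y. X \<in> carrier (K0 k R) \<Longrightarrow> Y \<in> carrier (K0 k R) \<Longrightarrow> X \<otimes>\<^bsub>K0 k R\<^esub> Y \<in> carrier (K0 k R)"
    by (rule K0_mult_mem)
  then show "restrict K.\<Phi> (carrier (K0 k R)) \<in> iso (K0 k R) (add_monoid Q.A)"
    using \<Phi>_iso unfolding iso_def hom_def by (auto simp: bij_betw_restrict_eq)
qed (simp_all add: K0_class_mem \<Phi>_K0_class)

text \<open>On classes of modules this is multiplicativity of counting series under tensor products.
  Biadditivity and cancellation extend it to all elements, one argument at a time.\<close>

lemma tensor_mult_\<Phi>:
  assumes mul: "is_tensor_mult k R mul" and X: "X \<in> carrier (K0 k R)" and Y: "Y \<in> carrier (K0 k R)"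
  shows "K.\<Phi> (mul (X, Y)) = K.\<Phi> X \<otimes>\<^bsub>Q.A\<^esub> K.\<Phi> Y"
proof -
  have mc: "mul (X, Y) \<in> carrier (K0 k R)" if "X \<in> carrier (K0 k R)" "Y \<in> carrier (K0 k R)" for X Y
    using mul that by (auto simp: is_tensor_mult_def)
  have l: "mul (X \<otimes>\<^bsub>K0 k R\<^esub> Y, Z) = mul (X, Z) \<otimes>\<^bsub>K0 k R\<^esub> mul (Y, Z)"
    and r: "mul (X, Y \<otimes>\<^bsub>K0 k R\<^esub> Z) = mul (X, Y) \<otimes>\<^bsub>K0 k R\<^esub> mul (X, Z)"
    if "X \<in> carrier (K0 k R)" "Y \<in> carrier (K0 k R)" "Z \<in> carrier (K0 k R)" for X Y Z
    using mul that by (auto simp: is_tensor_mult_def)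
  have cl: "K.\<Phi> (mul (K0_class k R P, K0_class k R P')) = K_series k R P \<otimes>\<^bsub>Q.A\<^esub> K_series k R P'"
    if "bdf_projective k R P" "bdf_projective k R P'" for P P' :: "('k, 'r, 'g) gmodule_rep"
  proof -
    have "mul (K0_class k R P, K0_class k R P') = K0_class k R (graded_tensor k R P P')"
      using mul that by (simp add: is_tensor_mult_def)
    then show ?thesis using tensor_bdf_projective[OF that] by (simp add: \<Phi>_K0_class)
  qed
  have cancel: "a = b" if "a \<oplus>\<^bsub>Q.A\<^esub> c = b \<oplus>\<^bsub>Q.A\<^esub> c" "a \<in> carrier Q.A" "b \<in> carrier Q.A" "c \<in> carrier Q.A" for a b c
    using that by (rule A_cancel)
  \<comment> \<open>The first argument becomes arbitrary while the second remains a class.\<close>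
  have left: "K.\<Phi> (mul (X, K0_class k R F)) = K.\<Phi> X \<otimes>\<^bsub>Q.A\<^esub> K_series k R F"
    if X: "X \<in> carrier (K0 k R)" and F: "bdf_projective k R F" for X and F :: "('k, 'r, 'g) gmodule_rep"
  proof -
    obtain P P' :: "('k, 'r, 'g) gmodule_rep" where P: "bdf_projective k R P" "bdf_projective k R P'"
      "X \<otimes>\<^bsub>K0 k R\<^esub> K0_class k R P' = K0_class k R P"
      using X by (rule K0_generated)
    note c = X K0_class_mem[OF P(2)] K0_class_mem[OF F]
    have KP: "K_series k R P = K.\<Phi> X \<oplus>\<^bsub>Q.A\<^esub> K_series k R P'"
      using \<Phi>_mult[OF c(1,2)] unfolding P(3) \<Phi>_K0_class[OF P(1)] \<Phi>_K0_class[OF P(2)] .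
    have "K.\<Phi> (mul (X, K0_class k R F)) \<oplus>\<^bsub>Q.A\<^esub> K_series k R P' \<otimes>\<^bsub>Q.A\<^esub> K_series k R F =
        K.\<Phi> (mul (X \<otimes>\<^bsub>K0 k R\<^esub> K0_class k R P', K0_class k R F))"
      unfolding l[OF c] \<Phi>_mult[OF mc[OF c(1,3)] mc[OF c(2,3)]] cl[OF P(2) F] ..
    also have "\<dots> = K_series k R P \<otimes>\<^bsub>Q.A\<^esub> K_series k R F" unfolding P(3) by (rule cl[OF P(1) F])
    also have "\<dots> = K.\<Phi> X \<otimes>\<^bsub>Q.A\<^esub> K_series k R F \<oplus>\<^bsub>Q.A\<^esub> K_series k R P' \<otimes>\<^bsub>Q.A\<^esub> K_series k R F"
      unfolding KP by (rule A.l_distr[OF \<Phi>_mem[OF X] K_props(1)[OF P(2)] K_props(1)[OF F]])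
    finally show ?thesis
      by (rule cancel)
        (intro \<Phi>_mem mc c A.m_closed K_props(1)[OF P(2)] K_props(1)[OF F] X)+
  qed
  \<comment> \<open>The second argument is now written as a difference of classes as well, with
    \<open>left\<close> settling both of its terms.\<close>
  obtain P P' :: "('k, 'r, 'g) gmodule_rep" where P: "bdf_projective k R P" "bdf_projective k R P'"
    "Y \<otimes>\<^bsub>K0 k R\<^esub> K0_class k R P' = K0_class k R P"
    using Y by (rule K0_generated)
  note c = X Y K0_class_mem[OF P(2)]
  have KP: "K_series k R P = K.\<Phi> Y \<oplus>\<^bsub>Q.A\<^esub> K_series k R P'"
    using \<Phi>_mult[OF c(2,3)] unfolding P(3) \<Phi>_K0_class[OF P(1)] \<Phi>_K0_class[OF P(2)] .
  have "K.\<Phi> (mul (X, Y)) \<oplus>\<^bsub>Q.A\<^esub> K.\<Phi> X \<otimes>\<^bsub>Q.A\<^esub> K_series k R P' = K.\<Phi> (mul (X, Y \<otimes>\<^bsub>K0 k R\<^esub> K0_class k R P'))"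
    unfolding r[OF c] \<Phi>_mult[OF mc[OF c(1,2)] mc[OF c(1,3)]] left[OF X P(2)] ..
  also have "\<dots> = K.\<Phi> X \<otimes>\<^bsub>Q.A\<^esub> K_series k R P" unfolding P(3) by (rule left[OF X P(1)])
  also have "\<dots> = K.\<Phi> X \<otimes>\<^bsub>Q.A\<^esub> K.\<Phi> Y \<oplus>\<^bsub>Q.A\<^esub> K.\<Phi> X \<otimes>\<^bsub>Q.A\<^esub> K_series k R P'"
    unfolding KP by (rule A.r_distr[OF \<Phi>_mem[OF Y] K_props(1)[OF P(2)] \<Phi>_mem[OF X]])
  finally show ?thesis
    by (rule cancel) (intro \<Phi>_mem mc c A.m_closed K_props(1)[OF P(2)])+
qed

text \<open>The product is taken over from the series ring. That it computes tensor products of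
  representatives follows since both sides have the same series.\<close>

lemma tensor_mult_exists: "\<exists>mul. is_tensor_mult k R mul"
proof -
  define i where "i = inv_into (carrier (K0 k R)) K.\<Phi>"
  have i: "i a \<in> carrier (K0 k R)" "K.\<Phi> (i a) = a" if "a \<in> carrier Q.A" for a
    using \<Phi>_bij that by (auto simp: bij_betw_def i_def inv_into_into f_inv_into_f)
  \<comment> \<open>Being defined on elements of the group, this raises no question of independence
    from representatives.\<close>
  define mul where "mul = (\<lambda>(X, Y)\<in>carrier (K0 k R) \<times> carrier (K0 k R). i (K.\<Phi> X \<otimes>\<^bsub>Q.A\<^esub> K.\<Phi> Y))"
  have mul: "mul (X, Y) \<in> carrier (K0 k R)" "K.\<Phi> (mul (X, Y)) = K.\<Phi> X \<otimes>\<^bsub>Q.A\<^esub> K.\<Phi> Y"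
    if "X \<in> carrier (K0 k R)" "Y \<in> carrier (K0 k R)" for X Y
    using i[OF A.m_closed[OF \<Phi>_mem \<Phi>_mem]] that by (simp_all add: mul_def)
  have "is_tensor_mult k R mul"
    unfolding is_tensor_mult_def
  proof (intro conjI ballI allI impI)
    show "mul \<in> carrier (K0 k R) \<times> carrier (K0 k R) \<rightarrow>\<^sub>E carrier (K0 k R)"
      using mul(1) by (auto simp: PiE_iff) (simp add: mul_def)
  next
    fix X Y Z assume c: "X \<in> carrier (K0 k R)" "Y \<in> carrier (K0 k R)" "Z \<in> carrier (K0 k R)"
    note m = K0_mult_mem mul(1) c
    have "K.\<Phi> (mul (X \<otimes>\<^bsub>K0 k R\<^esub> Y, Z)) = K.\<Phi> (mul (X, Z) \<otimes>\<^bsub>K0 k R\<^esub> mul (Y, Z))"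
      by (simp add: m mul(2) \<Phi>_mult A.l_distr[OF \<Phi>_mem \<Phi>_mem \<Phi>_mem] del: Q.series_simps)
    then show "mul (X \<otimes>\<^bsub>K0 k R\<^esub> Y, Z) = mul (X, Z) \<otimes>\<^bsub>K0 k R\<^esub> mul (Y, Z)"
      by (subst (asm) \<Phi>_eq_iff) (simp_all add: m)
    have "K.\<Phi> (mul (X, Y \<otimes>\<^bsub>K0 k R\<^esub> Z)) = K.\<Phi> (mul (X, Y) \<otimes>\<^bsub>K0 k R\<^esub> mul (X, Z))"
      by (simp add: m mul(2) \<Phi>_mult A.r_distr[OF \<Phi>_mem \<Phi>_mem \<Phi>_mem] del: Q.series_simps)
    then show "mul (X, Y \<otimes>\<^bsub>K0 k R\<^esub> Z) = mul (X, Y) \<otimes>\<^bsub>K0 k R\<^esub> mul (X, Z)"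
      by (subst (asm) \<Phi>_eq_iff) (simp_all add: m)
  next
    fix F F' :: "('k, 'r, 'g) gmodule_rep"
    assume F: "bdf_projective k R F" and F': "bdf_projective k R F'"
    note c = K0_class_mem[OF F] K0_class_mem[OF F']
    note t = tensor_bdf_projective[OF F F']
    have "K.\<Phi> (mul (K0_class k R F, K0_class k R F')) = K.\<Phi> (K0_class k R (graded_tensor k R F F'))"
      unfolding mul(2)[OF c] \<Phi>_K0_class[OF F] \<Phi>_K0_class[OF F'] \<Phi>_K0_class[OF t(1)] t(2) ..
    then show "mul (K0_class k R F, K0_class k R F') = K0_class k R (graded_tensor k R F F')"
      by (subst (asm) \<Phi>_eq_iff[OF mul(1)[OF c] K0_class_mem[OF t(1)]])
  qed
  then show ?thesis by (rule exI[of _ mul])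
qed

text \<open>Both products are carried by the injective map to the product of series; outside pairs
  of group elements both are \<open>undefined\<close>.\<close>

lemma tensor_mult_unique:
  assumes mul: "is_tensor_mult k R mul" and mul': "is_tensor_mult k R mul'"
  shows "mul = mul'"
proof (rule extensionalityI[of _ "carrier (K0 k R) \<times> carrier (K0 k R)"])
  show "mul \<in> extensional (carrier (K0 k R) \<times> carrier (K0 k R))"
    "mul' \<in> extensional (carrier (K0 k R) \<times> carrier (K0 k R))"
    using mul mul' by (simp_all add: is_tensor_mult_def PiE_iff)
  fix p assume "p \<in> carrier (K0 k R) \<times> carrier (K0 k R)"
  then obtain X Y where p: "p = (X, Y)" "X \<in> carrier (K0 k R)" "Y \<in> carrier (K0 k R)" by blast
  have m: "mul p \<in> carrier (K0 k R)" "mul' p \<in> carrier (K0 k R)"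
    using mul mul' p by (auto simp: is_tensor_mult_def)
  have "K.\<Phi> (mul p) = K.\<Phi> (mul' p)"
    unfolding p(1) tensor_mult_\<Phi>[OF mul p(2,3)] tensor_mult_\<Phi>[OF mul' p(2,3)] ..
  then show "mul p = mul' p" by (subst (asm) \<Phi>_eq_iff[OF m])
qed

lemma K0_ring_simps [simp]:
  "carrier (K0_ring k R mul) = carrier (K0 k R)"
  "X \<otimes>\<^bsub>K0_ring k R mul\<^esub> Y = mul (X, Y)" "X \<oplus>\<^bsub>K0_ring k R mul\<^esub> Y = X \<otimes>\<^bsub>K0 k R\<^esub> Y"
  "\<one>\<^bsub>K0_ring k R mul\<^esub> = K0_class k R RR" "\<zero>\<^bsub>K0_ring k R mul\<^esub> = \<one>\<^bsub>K0 k R\<^esub>"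
  by (simp_all add: K0_ring_def)

lemma K0_ring_cring:
  assumes mul: "is_tensor_mult k R mul"
  shows "cring (K0_ring k R mul)"
proof (rule cring_transport[OF Q.series_ring_cring, where f = K.\<Phi>])
  show "bij_betw K.\<Phi> (carrier (K0_ring k R mul)) (carrier Q.A)" using \<Phi>_bij by simp
  show "\<one>\<^bsub>K0_ring k R mul\<^esub> \<in> carrier (K0_ring k R mul)"
    using K0_class_mem[OF regular_bdf_projective(1)] by simp
  show "K.\<Phi> \<one>\<^bsub>K0_ring k R mul\<^esub> = \<one>\<^bsub>Q.A\<^esub>"
    unfolding K0_ring_simps \<Phi>_K0_class[OF regular_bdf_projective(1)] by (rule regular_bdf_projective(2))
  show "K.\<Phi> \<zero>\<^bsub>K0_ring k R mul\<^esub> = \<zero>\<^bsub>Q.A\<^esub>" unfolding K0_ring_simps by (rule \<Phi>_one)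
  fix X Y assume "X \<in> carrier (K0_ring k R mul)" "Y \<in> carrier (K0_ring k R mul)"
  then have c: "X \<in> carrier (K0 k R)" "Y \<in> carrier (K0 k R)" by simp_all
  show "X \<otimes>\<^bsub>K0_ring k R mul\<^esub> Y \<in> carrier (K0_ring k R mul)"
    using mul c by (auto simp: is_tensor_mult_def)
  show "K.\<Phi> (X \<otimes>\<^bsub>K0_ring k R mul\<^esub> Y) = K.\<Phi> X \<otimes>\<^bsub>Q.A\<^esub> K.\<Phi> Y"
    unfolding K0_ring_simps by (rule tensor_mult_\<Phi>[OF mul c])
  show "K.\<Phi> (X \<oplus>\<^bsub>K0_ring k R mul\<^esub> Y) = K.\<Phi> X \<oplus>\<^bsub>Q.A\<^esub> K.\<Phi> Y"
    unfolding K0_ring_simps by (rule \<Phi>_mult[OF c])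
  show "X \<oplus>\<^bsub>K0_ring k R mul\<^esub> Y \<in> carrier (K0_ring k R mul)" using K0_mult_mem[OF c] by simp
qed (simp add: K0_one_mem)

lemma K_series_ring_hom:
  assumes mul: "is_tensor_mult k R mul" and \<phi>: "is_K_series_iso k R \<phi>"
  shows "\<phi> \<in> ring_hom (K0_ring k R mul) Q.A"
proof (rule ring_hom_memI)
  note eq = K_series_iso_eq[OF \<phi>]
  fix X assume "X \<in> carrier (K0_ring k R mul)"
  then have X: "X \<in> carrier (K0 k R)" by simp
  show "\<phi> X \<in> carrier Q.A" unfolding eq[OF X] by (rule \<Phi>_mem[OF X])
  fix Y assume "Y \<in> carrier (K0_ring k R mul)"
  then have Y: "Y \<in> carrier (K0 k R)" by simp
  have m: "mul (X, Y) \<in> carrier (K0 k R)" using mul X Y by (auto simp: is_tensor_mult_def)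
  show "\<phi> (X \<otimes>\<^bsub>K0_ring k R mul\<^esub> Y) = \<phi> X \<otimes>\<^bsub>Q.A\<^esub> \<phi> Y"
    unfolding K0_ring_simps eq[OF X] eq[OF Y] eq[OF m] by (rule tensor_mult_\<Phi>[OF mul X Y])
  show "\<phi> (X \<oplus>\<^bsub>K0_ring k R mul\<^esub> Y) = \<phi> X \<oplus>\<^bsub>Q.A\<^esub> \<phi> Y"
    unfolding K0_ring_simps eq[OF X] eq[OF Y] eq[OF K0_mult_mem[OF X Y]] by (rule \<Phi>_mult[OF X Y])
next
  show "\<phi> \<one>\<^bsub>K0_ring k R mul\<^esub> = \<one>\<^bsub>Q.A\<^esub>"
    unfolding K0_ring_simps K_series_iso_eq[OF \<phi> K0_class_mem[OF regular_bdf_projective(1)]]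
      \<Phi>_K0_class[OF regular_bdf_projective(1)] by (rule regular_bdf_projective(2))
qed

text \<open>The specification of the product mentions only modules of the representative type.
  Comparing series extends the formula to modules of arbitrary types, whose tensor product has yet
  another type.\<close>

lemma tensor_mult_class:
  fixes F :: "('r, 'm, 'g) graded_module" and F' :: "('r, 'n, 'g) graded_module"
  assumes mul: "is_tensor_mult k R mul" and F: "bdf_projective k R F" and F': "bdf_projective k R F'"
  shows "mul (K0_class k R F, K0_class k R F') = K0_class k R (graded_tensor k R F F')"
proof -
  note c = K0_class_mem[OF F] K0_class_mem[OF F']
  note t = tensor_bdf_projective[OF F F']
  have m: "mul (K0_class k R F, K0_class k R F') \<in> carrier (K0 k R)"
    using mul c by (auto simp: is_tensor_mult_def)
  have "K.\<Phi> (mul (K0_class k R F, K0_class k R F')) = K.\<Phi> (K0_class k R (graded_tensor k R F F'))"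
    unfolding tensor_mult_\<Phi>[OF mul c] \<Phi>_K0_class[OF F] \<Phi>_K0_class[OF F'] \<Phi>_K0_class[OF t(1)] t(2) ..
  then show ?thesis by (subst (asm) \<Phi>_eq_iff[OF m K0_class_mem[OF t(1)]])
qed

lemma K_series_iso_unique:
  assumes "is_K_series_iso k R \<phi>" "is_K_series_iso k R \<phi>'"
  shows "\<phi> = \<phi>'"
proof (rule extensionalityI[of _ "carrier (K0 k R)"])
  show "\<phi> \<in> extensional (carrier (K0 k R))" "\<phi>' \<in> extensional (carrier (K0 k R))"
    using assms by (simp_all add: is_K_series_iso_def)
qed (simp add: K_series_iso_eq[OF assms(1)] K_series_iso_eq[OF assms(2)])

end

text \<open>The two unique existence claims keep the last clause from being vacuous and let it speak
  of the product and the isomorphism. The modules in it have arbitrary element types.\<close>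

theorem corollary6:
  fixes k :: "'k ring"
    and R :: "('k, 'r, 'g::ab_group_add) graded_module"
  assumes "field k"
    and "is_graded_algebra k R"
    and "domain R"
    and "pdcf k R"
  shows "(\<exists>!mul. is_tensor_mult k R mul) \<and>
    (\<exists>!\<phi>. is_K_series_iso k R \<phi>) \<and>
    (\<forall>mul \<phi>. is_tensor_mult k R mul \<longrightarrow> is_K_series_iso k R \<phi> \<longrightarrow>
       cring (K0_ring k R mul) \<and>
       \<phi> \<in> ring_hom (K0_ring k R mul) (series_ring (gsupp R)) \<and>
       (\<forall>(F :: ('r, 'm, 'g) graded_module) (F' :: ('r, 'n, 'g) graded_module).
          bdf_projective k R F \<longrightarrow> bdf_projective k R F' \<longrightarrow>
          bdf_projective k R (graded_tensor k R F F') \<and>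
          K0_class k R F \<in> carrier (K0 k R) \<and>
          \<phi> (K0_class k R F) = K_series k R F \<and>
          mul (K0_class k R F, K0_class k R F') = K0_class k R (graded_tensor k R F F')))"
proof -
  interpret pdcf_algebra k R by (rule pdcf_algebra.intro[OF assms])
  show ?thesis
  proof (intro conjI allI impI)
    show "\<exists>!mul. is_tensor_mult k R mul"
      using tensor_mult_exists tensor_mult_unique by blast
    show "\<exists>!\<phi>. is_K_series_iso k R \<phi>"
      using K_series_iso_restrict K_series_iso_unique by blast
  next
    fix mul \<phi> assume mul: "is_tensor_mult k R mul" and \<phi>: "is_K_series_iso k R \<phi>"
    show "cring (K0_ring k R mul)" by (rule K0_ring_cring[OF mul])
    show "\<phi> \<in> ring_hom (K0_ring k R mul) (series_ring (gsupp R))" by (rule K_series_ring_hom[OF mul \<phi>])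
    fix F :: "('r, 'm, 'g) graded_module" and F' :: "('r, 'n, 'g) graded_module"
    assume F: "bdf_projective k R F" and F': "bdf_projective k R F'"
    show "bdf_projective k R (graded_tensor k R F F')" by (rule tensor_bdf_projective(1)[OF F F'])
    show "K0_class k R F \<in> carrier (K0 k R)" by (rule K0_class_mem[OF F])
    show "\<phi> (K0_class k R F) = K_series k R F"
      unfolding K_series_iso_eq[OF \<phi> K0_class_mem[OF F]] by (rule \<Phi>_K0_class[OF F])
    show "mul (K0_class k R F, K0_class k R F') = K0_class k R (graded_tensor k R F F')"
      by (rule tensor_mult_class[OF mul F F'])
  qed
qed

end
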